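(* Let $d \ge 1$ and $p \ge 0$ be integers. Then $\mathcal{O}_{\mathbf{P}^n}(d)$ satisfies Property $N_p$ for all $n \ge p$ if and only if $\mathcal{O}_{\mathbf{P}^p}(d)$ satisfies Property $N_p$.
   Context: All varieties are over $\mathbf{C}$. Property $N_p$ (for an integer $p \ge 0$): let $Y$ be a smooth complex projective variety and $L$ a very ample line bundle on $Y$. Put $S = \bigoplus_{m\ge 0} \mathrm{Sym}^m H^0(Y,L)$, the homogeneous coordinate ring of $\mathbf{P}(H^0(Y,L)^* )$, and consider the graded $S$-module $G = \bigoplus_{m\ge 0} H^0(Y, L^{m})$. Let $$0 \to E_l \to E_{l-1} \to \cdots \to E_0 \to G \to 0$$ be a minimal graded free resolution of $G$ over $S$. Then $L$ satisfies Property $N_p$ if and only if $E_0 = S$ and, for every $1 \le i \le p$, $E_i$ is a direct sum of copies of $S(-i-1)$. *)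

theory Defs
  imports Complex_Main "HOL-Library.Poly_Mapping" "HOL-Algebra.Module" "HOL-Algebra.AbelCoset"
begin

type_synonym 'v mpoly = "('v \<Rightarrow>\<^sub>0 nat) \<Rightarrow>\<^sub>0 complex"

definition monom_degree :: "('v \<Rightarrow>\<^sub>0 nat) \<Rightarrow> nat" where
  "monom_degree m = (\<Sum>v\<in>Poly_Mapping.keys m. Poly_Mapping.lookup m v)"

definition polynomials_in :: "'v set \<Rightarrow> 'v mpoly set" where
  "polynomials_in V = {f. \<forall>m\<in>Poly_Mapping.keys f. Poly_Mapping.keys m \<subseteq> V}"

definition polynomial_ring :: "'v set \<Rightarrow> 'v mpoly ring" where
  "polynomial_ring V =
     \<lparr>carrier = polynomials_in V, mult = (*), one = 1, zero = 0, add = (+)\<rparr>"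

definition homogeneous_polynomials :: "'v set \<Rightarrow> int \<Rightarrow> 'v mpoly set" where
  "homogeneous_polynomials V k =
     {f \<in> polynomials_in V. \<forall>m\<in>Poly_Mapping.keys f. int (monom_degree m) = k}"

record ('a, 'b) graded_module = "('a, 'b) module" +
  component :: "int \<Rightarrow> 'b set"

text \<open>
  With \<open>S = \<complex>[x\<^sub>v : v \<in> V]\<close>, a list of integers \<open>[a\<^sub>0, \<dots>, a\<^sub>r\<^sub>-\<^sub>1]\<close> describes the graded free
  module \<open>S(-a\<^sub>0) \<oplus> \<dots> \<oplus> S(-a\<^sub>r\<^sub>-\<^sub>1)\<close>; its elements are the families of \<open>r\<close> polynomials,
  extended by zero. The degree \<open>e\<close> component of \<open>S(-a)\<close> is \<open>S\<^sub>e\<^sub>-\<^sub>a\<close>. The ring operations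
  of a record describing a module carry no information.
\<close>

definition graded_free_module ::
    "'v set \<Rightarrow> int list \<Rightarrow> ('v mpoly, nat \<Rightarrow> 'v mpoly) graded_module" where
  "graded_free_module V as =
     \<lparr>carrier = {u. (\<forall>j<length as. u j \<in> polynomials_in V) \<and> (\<forall>j\<ge>length as. u j = 0)},
      mult = undefined, one = undefined, zero = (\<lambda>_. 0), add = (\<lambda>u v j. u j + v j),
      smult = (\<lambda>f u j. f * u j),
      component = (\<lambda>e. {u. (\<forall>j<length as. u j \<in> homogeneous_polynomials V (e - as ! j)) \<and>
                           (\<forall>j\<ge>length as. u j = 0)})\<rparr>"

definition graded_hom ::
    "('a, 'r) ring_scheme \<Rightarrow> ('a, 'b, 'm) graded_module_scheme \<Rightarrow>
     ('a, 'c, 'n) graded_module_scheme \<Rightarrow> ('b \<Rightarrow> 'c) set" where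
  "graded_hom R M N =
     {h \<in> carrier M \<rightarrow> carrier N.
        (\<forall>x\<in>carrier M. \<forall>y\<in>carrier M. h (x \<oplus>\<^bsub>M\<^esub> y) = h x \<oplus>\<^bsub>N\<^esub> h y) \<and>
        (\<forall>a\<in>carrier R. \<forall>x\<in>carrier M. h (a \<odot>\<^bsub>M\<^esub> x) = a \<odot>\<^bsub>N\<^esub> h x) \<and>
        (\<forall>e. \<forall>x\<in>component M e. h x \<in> component N e)}"

text \<open>
  A resolution \<open>0 \<rightarrow> E\<^sub>l \<rightarrow> \<dots> \<rightarrow> E\<^sub>0 \<rightarrow> G \<rightarrow> 0\<close>, where \<open>E\<^sub>i\<close> has the list of shifts \<open>shifts i\<close>,
  \<open>\<delta> i\<close> is the map \<open>E\<^sub>i\<^sub>+\<^sub>1 \<rightarrow> E\<^sub>i\<close>, and \<open>E\<^sub>i = 0\<close> for \<open>i > l\<close>. Minimality says that the image of each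
  \<open>\<delta> i\<close> lies in \<open>\<mm> E\<^sub>i\<close> for the irrelevant ideal \<open>\<mm>\<close>, i.e. that all coordinates of its values
  have constant term zero.
\<close>

definition minimal_graded_free_resolution ::
    "'v set \<Rightarrow> ('v mpoly, 'b, 'm) graded_module_scheme \<Rightarrow> nat \<Rightarrow> (nat \<Rightarrow> int list) \<Rightarrow>
     (nat \<Rightarrow> (nat \<Rightarrow> 'v mpoly) \<Rightarrow> nat \<Rightarrow> 'v mpoly) \<Rightarrow> ((nat \<Rightarrow> 'v mpoly) \<Rightarrow> 'b) \<Rightarrow> bool" where
  "minimal_graded_free_resolution V G l shifts \<delta> \<epsilon> \<longleftrightarrow>
     (let S = polynomial_ring V; E = (\<lambda>i. graded_free_module V (shifts i)) in
       (\<forall>i>l. shifts i = []) \<and>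
       \<epsilon> \<in> graded_hom S (E 0) G \<and>
       (\<forall>i. \<delta> i \<in> graded_hom S (E (Suc i)) (E i)) \<and>
       \<epsilon> ` carrier (E 0) = carrier G \<and>
       \<delta> 0 ` carrier (E 1) = a_kernel (E 0) G \<epsilon> \<and>
       (\<forall>i. \<delta> (Suc i) ` carrier (E (Suc (Suc i))) = a_kernel (E (Suc i)) (E i) (\<delta> i)) \<and>
       (\<forall>i. \<forall>u\<in>carrier (E (Suc i)). \<forall>j. Poly_Mapping.lookup (\<delta> i u j) 0 = 0))"

text \<open>
  Sections of the line bundles \<open>O(k)\<close> on projective \<open>n\<close>-space are represented
  inside the ring of Laurent polynomials with complex coefficients; an exponent vector assigns an
  integer to each variable \<open>x\<^sub>0, x\<^sub>1, \<dots>\<close>.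
\<close>

type_synonym laurent = "(nat \<Rightarrow>\<^sub>0 int) \<Rightarrow>\<^sub>0 complex"

definition variable :: "nat \<Rightarrow> laurent" where
  "variable i = Poly_Mapping.single (Poly_Mapping.single i 1) 1"

definition exponents :: "nat \<Rightarrow> int \<Rightarrow> (nat \<Rightarrow>\<^sub>0 int) set" where
  "exponents n k = {\<alpha>. Poly_Mapping.keys \<alpha> \<subseteq> {..n} \<and> (\<forall>i. 0 \<le> Poly_Mapping.lookup \<alpha> i) \<and>
     (\<Sum>i\<le>n. Poly_Mapping.lookup \<alpha> i) = k}"

definition forms :: "nat \<Rightarrow> int \<Rightarrow> laurent set" where
  "forms n k = {f. Poly_Mapping.keys f \<subseteq> exponents n k}"

text \<open>
  The sections of \<open>O(k)\<close> over the affine chart \<open>x\<^sub>i \<noteq> 0\<close> are the fractions \<open>g / x\<^sub>i\<^sup>e\<close> with \<open>g\<close> a form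
  of degree \<open>k + e\<close>. As all restriction maps between intersections of charts are inclusions of
  subspaces of the Laurent polynomials, a global section, i.e. a compatible family of sections over
  the charts, is a Laurent polynomial that is a section over each chart.
\<close>

definition chart_sections :: "nat \<Rightarrow> int \<Rightarrow> nat \<Rightarrow> laurent set" where
  "chart_sections n k i = {f. \<exists>e::nat. f * variable i ^ e \<in> forms n (k + int e)}"

definition global_sections :: "nat \<Rightarrow> int \<Rightarrow> laurent set" where
  "global_sections n k = (\<Inter>i\<le>n. chart_sections n k i)"

definition monomial_sections :: "nat \<Rightarrow> int \<Rightarrow> laurent set" where
  "monomial_sections n k = (\<lambda>\<alpha>. Poly_Mapping.single \<alpha> 1) ` exponents n k"

text \<open>
  Let \<open>R m = H\<^sup>0(Y, L\<^sup>m)\<close> and let \<open>B\<close> be a basis of \<open>R 1\<close>, so that \<open>S = Sym H\<^sup>0(Y, L)\<close> is the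
  polynomial ring with one variable for each element of \<open>B\<close>. The direct sum of the \<open>R m\<close>
  is formed externally by finitely supported families; the product of \<open>poly_mapping\<close> then
  is the multiplication of sections. The variable of \<open>b \<in> B\<close> acts as multiplication by \<open>b\<close>,
  placed in degree 1.
\<close>

definition section_of_polynomial :: "laurent mpoly \<Rightarrow> (nat \<Rightarrow>\<^sub>0 laurent)" where
  "section_of_polynomial f =
     (\<Sum>m\<in>Poly_Mapping.keys f.
        Poly_Mapping.single 0 (Poly_Mapping.single 0 (Poly_Mapping.lookup f m)) *
        (\<Prod>b\<in>Poly_Mapping.keys m. Poly_Mapping.single 1 b ^ Poly_Mapping.lookup m b))"

definition section_module ::
    "(nat \<Rightarrow> laurent set) \<Rightarrow> (laurent mpoly, nat \<Rightarrow>\<^sub>0 laurent) graded_module" where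
  "section_module R =
     \<lparr>carrier = {g. \<forall>m. Poly_Mapping.lookup g m \<in> R m},
      mult = undefined, one = undefined, zero = 0, add = (+),
      smult = (\<lambda>f g. section_of_polynomial f * g),
      component = (\<lambda>e. {g. (\<forall>m. Poly_Mapping.lookup g m \<in> R m) \<and>
                           (\<forall>m\<in>Poly_Mapping.keys g. int m = e)})\<rparr>"

definition property_N :: "nat \<Rightarrow> laurent set \<Rightarrow> (nat \<Rightarrow> laurent set) \<Rightarrow> bool" where
  "property_N p B R \<longleftrightarrow>
     (\<exists>l shifts \<delta> \<epsilon>.
        minimal_graded_free_resolution B (section_module R) l shifts \<delta> \<epsilon> \<and>
        shifts 0 = [0] \<and>
        (\<forall>i. 1 \<le> i \<and> i \<le> p \<longrightarrow> (\<forall>a\<in>set (shifts i). a = int i + 1)))"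

text \<open>
  Here \<open>L = O(d)\<close>, hence \<open>L\<^sup>m = O(md)\<close>; the monomials of degree \<open>d\<close> form the basis of
  \<open>H\<^sup>0(P\<^sup>n, O(d))\<close> by \<open>monomial_sections_span\<close> and \<open>monomial_sections_independent\<close> below.
\<close>

definition O_satisfies_N :: "nat \<Rightarrow> nat \<Rightarrow> nat \<Rightarrow> bool" where
  "O_satisfies_N n d p \<longleftrightarrow>
     property_N p (monomial_sections n (int d)) (\<lambda>m. global_sections n (int m * int d))"

lemma variable_power: "variable i ^ e = Poly_Mapping.single (Poly_Mapping.single i (int e)) 1"
  by (induction e)
    (auto simp: variable_def mult_single single_add [symmetric] algebra_simps)

lemma poly_mapping_expansion:
  fixes f :: "'b \<Rightarrow>\<^sub>0 'c::comm_monoid_add"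
  shows "f = (\<Sum>a\<in>Poly_Mapping.keys f. Poly_Mapping.single a (Poly_Mapping.lookup f a))"
  by (rule poly_mapping_eqI) (auto simp: lookup_sum lookup_single when_def in_keys_iff)

lemma lookup_times_monomial:
  fixes f :: laurent
  shows "Poly_Mapping.lookup (f * Poly_Mapping.single b 1) (a + b) = Poly_Mapping.lookup f a"
proof -
  let ?s = "\<lambda>c. Poly_Mapping.single c (Poly_Mapping.lookup f c)"
  have "f * Poly_Mapping.single b 1 =
      (\<Sum>c\<in>Poly_Mapping.keys f. ?s c) * Poly_Mapping.single b 1"
    by (simp only: poly_mapping_expansion [of f, symmetric])
  also have "\<dots> = (\<Sum>c\<in>Poly_Mapping.keys f. Poly_Mapping.single (c + b) (Poly_Mapping.lookup f c))"
    by (simp only: sum_distrib_right mult_single mult_1_right)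
  finally have "Poly_Mapping.lookup (f * Poly_Mapping.single b 1) (a + b) =
      (\<Sum>c\<in>Poly_Mapping.keys f. if c = a then Poly_Mapping.lookup f c else 0)"
    by (simp add: lookup_sum lookup_single when_def)
  then show ?thesis by (simp add: in_keys_iff)
qed

lemma keys_times_monomial:
  fixes f :: laurent
  assumes "a \<in> Poly_Mapping.keys f"
  shows "a + b \<in> Poly_Mapping.keys (f * Poly_Mapping.single b 1)"
  using assms by (simp add: in_keys_iff lookup_times_monomial)

lemma global_sections_eq_forms:
  assumes "k \<ge> 0"
  shows "global_sections n k = forms n k"
proof
  show "forms n k \<subseteq> global_sections n k"
  proof
    fix f assume "f \<in> forms n k"
    then have "f * variable i ^ 0 \<in> forms n (k + int 0)" for i by simp
    then show "f \<in> global_sections n k"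
      unfolding global_sections_def chart_sections_def by (intro INT_I CollectI exI)
  qed
  show "global_sections n k \<subseteq> forms n k"
  proof
    fix f assume f: "f \<in> global_sections n k"
    have "a \<in> exponents n k" if a: "a \<in> Poly_Mapping.keys f" for a
    proof -
      have shifted: "\<exists>e::nat. a + Poly_Mapping.single i (int e) \<in> exponents n (k + int e)"
        if "i \<le> n" for i
      proof -
        have "f \<in> chart_sections n k i"
          using f that by (simp add: global_sections_def)
        then obtain e where "Poly_Mapping.keys (f * variable i ^ e) \<subseteq> exponents n (k + int e)"
          unfolding chart_sections_def forms_def by blast
        then have "a + Poly_Mapping.single i (int e) \<in> exponents n (k + int e)"
          using keys_times_monomial [OF a] unfolding variable_power by blast
        then show ?thesis ..
      qed
      have nonneg: "0 \<le> Poly_Mapping.lookup a j" if "i \<le> n" "j \<noteq> i" for i j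
      proof -
        obtain e where "a + Poly_Mapping.single i (int e) \<in> exponents n (k + int e)"
          using shifted [OF \<open>i \<le> n\<close>] by blast
        then have "0 \<le> Poly_Mapping.lookup (a + Poly_Mapping.single i (int e)) j"
          unfolding exponents_def by blast
        then show ?thesis using \<open>j \<noteq> i\<close> by (simp add: lookup_add lookup_single)
      qed
      obtain i e where i: "i \<le> n" and e: "a + Poly_Mapping.single i (int e) \<in> exponents n (k + int e)"
        using shifted [of n] by blast
      have zero_outside: "Poly_Mapping.lookup a j = 0" if "j > n" for j
      proof -
        have "j \<notin> Poly_Mapping.keys (a + Poly_Mapping.single i (int e))"
          using e that by (auto simp: exponents_def)
        then show ?thesis using that i by (simp add: in_keys_iff lookup_add lookup_single)
      qed
      have "(\<Sum>j\<le>n. Poly_Mapping.lookup a j) + (\<Sum>j\<le>n. (int e when i = j)) = k + int e"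
        using e by (simp add: exponents_def lookup_add lookup_single sum.distrib)
      moreover have "(\<Sum>j\<le>n. (int e when i = j)) = int e"
        using i by (simp add: when_def)
      ultimately have total: "(\<Sum>i\<le>n. Poly_Mapping.lookup a i) = k" by simp
      have "0 \<le> Poly_Mapping.lookup a j" for j
      proof (cases "j = 0")
        case False
        then show ?thesis using nonneg [of 0 j] by simp
      next
        case True
        show ?thesis
        proof (cases "n = 0")
          case True
          then show ?thesis using total assms \<open>j = 0\<close> by simp
        next
          case False
          then show ?thesis using nonneg [of n j] \<open>j = 0\<close> by simp
        qed
      qed
      moreover have "Poly_Mapping.keys a \<subseteq> {..n}"
        using zero_outside by (meson atMost_iff in_keys_iff leI subsetI)
      ultimately show ?thesis using total by (simp add: exponents_def)
    qed
    then show "f \<in> forms n k" by (auto simp: forms_def)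
  qed
qed

definition scale_section :: "complex \<Rightarrow> laurent \<Rightarrow> laurent" where
  "scale_section c f = Poly_Mapping.single 0 c * f"

interpretation sections: vector_space scale_section
  by unfold_locales
    (auto simp: scale_section_def distrib_left distrib_right single_add mult_single
      mult.assoc [symmetric])

lemma monomial_sections_span:
  assumes "k \<ge> 0"
  shows "sections.span (monomial_sections n k) = global_sections n k"
proof -
  have sub: "sections.subspace (forms n k)"
  proof (rule sections.subspaceI)
    fix c and f :: laurent assume f: "f \<in> forms n k"
    show "scale_section c f \<in> forms n k"
      using f keys_mult [of "Poly_Mapping.single 0 c" f]
      by (fastforce simp: scale_section_def forms_def split: if_splits)
  qed (use keys_add in \<open>fastforce simp: forms_def\<close>)+
  have "monomial_sections n k \<subseteq> forms n k"
    by (auto simp: monomial_sections_def forms_def)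
  moreover have "f \<in> sections.span (monomial_sections n k)" if "f \<in> forms n k" for f
  proof -
    have "f = (\<Sum>a\<in>Poly_Mapping.keys f. Poly_Mapping.single a (Poly_Mapping.lookup f a))"
      by (rule poly_mapping_expansion)
    also have "\<dots> = (\<Sum>a\<in>Poly_Mapping.keys f.
        scale_section (Poly_Mapping.lookup f a) (Poly_Mapping.single a 1))"
      by (simp add: scale_section_def mult_single)
    also have "\<dots> \<in> sections.span (monomial_sections n k)"
      using that
      by (intro sections.span_sum sections.span_scale sections.span_base)
        (auto simp: monomial_sections_def forms_def)
    finally show ?thesis .
  qed
  ultimately show ?thesis
    using sections.span_minimal [OF _ sub] global_sections_eq_forms [OF assms] by blast
qed

lemma monomial_sections_independent: "\<not> sections.dependent (monomial_sections n k)"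
proof
  assume "sections.dependent (monomial_sections n k)"
  then obtain T u where T: "finite T" "T \<subseteq> monomial_sections n k"
    and z: "(\<Sum>v\<in>T. scale_section (u v) v) = 0" and nz: "\<exists>v\<in>T. u v \<noteq> 0"
    unfolding sections.dependent_explicit by blast
  from nz obtain v where v: "v \<in> T" "u v \<noteq> 0" by blast
  from v T obtain a where a: "v = Poly_Mapping.single a 1" by (auto simp: monomial_sections_def)
  have coeff: "Poly_Mapping.lookup (scale_section (u w) w) a = (if w = v then u v else 0)"
    if "w \<in> T" for w
    using that T a
    by (auto simp: monomial_sections_def scale_section_def mult_single lookup_single when_def)
  have "0 = (\<Sum>w\<in>T. Poly_Mapping.lookup (scale_section (u w) w) a)"
    using z by (simp add: lookup_sum [symmetric])
  also have "\<dots> = (\<Sum>w\<in>T. if w = v then u v else 0)"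
    by (rule sum.cong) (auto simp: coeff)
  also have "\<dots> = u v" using T v by simp
  finally show False using v by simp
qed

lemma polynomials_in_closed:
  "0 \<in> polynomials_in V" "1 \<in> polynomials_in V"
  "f \<in> polynomials_in V \<Longrightarrow> g \<in> polynomials_in V \<Longrightarrow> f + g \<in> polynomials_in V"
  "f \<in> polynomials_in V \<Longrightarrow> - f \<in> polynomials_in V"
  "f \<in> polynomials_in V \<Longrightarrow> g \<in> polynomials_in V \<Longrightarrow> f * g \<in> polynomials_in V"
proof -
  show "0 \<in> polynomials_in V" "1 \<in> polynomials_in V" by (auto simp: polynomials_in_def)
  show "f \<in> polynomials_in V \<Longrightarrow> g \<in> polynomials_in V \<Longrightarrow> f + g \<in> polynomials_in V"
    using keys_add [of f g] by (auto simp: polynomials_in_def)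
  show "f \<in> polynomials_in V \<Longrightarrow> - f \<in> polynomials_in V"
    by (simp add: polynomials_in_def keys_minus)
  assume f: "f \<in> polynomials_in V" and g: "g \<in> polynomials_in V"
  have "Poly_Mapping.keys m \<subseteq> V" if m: "m \<in> Poly_Mapping.keys (f * g)" for m
  proof -
    obtain a b where "m = a + b" "a \<in> Poly_Mapping.keys f" "b \<in> Poly_Mapping.keys g"
      using keys_mult [of f g] m by blast
    then show ?thesis using f g keys_add [of a b] unfolding polynomials_in_def by blast
  qed
  then show "f * g \<in> polynomials_in V" by (simp add: polynomials_in_def)
qed

lemma cring_polynomial_ring: "cring (polynomial_ring V)"
proof (rule cringI)
  show "abelian_group (polynomial_ring V)"
  proof (rule abelian_groupI)
    fix x assume "x \<in> carrier (polynomial_ring V)"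
    then show "\<exists>y\<in>carrier (polynomial_ring V). y \<oplus>\<^bsub>polynomial_ring V\<^esub> x = \<zero>\<^bsub>polynomial_ring V\<^esub>"
      by (intro bexI [of _ "- x"]) (auto simp: polynomial_ring_def polynomials_in_closed)
  qed (auto simp: polynomial_ring_def polynomials_in_closed algebra_simps)
  show "comm_monoid (polynomial_ring V)"
    by (rule comm_monoidI) (auto simp: polynomial_ring_def polynomials_in_closed algebra_simps)
qed (auto simp: polynomial_ring_def algebra_simps)

lemma module_graded_free_module:
  "module (polynomial_ring V) (graded_free_module V as)"
proof (rule moduleI)
  show "abelian_group (graded_free_module V as)"
  proof (rule abelian_groupI)
    fix x assume "x \<in> carrier (graded_free_module V as)"
    then show "\<exists>y\<in>carrier (graded_free_module V as).
        y \<oplus>\<^bsub>graded_free_module V as\<^esub> x = \<zero>\<^bsub>graded_free_module V as\<^esub>"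
      by (intro bexI [of _ "\<lambda>j. - x j"]) (auto simp: graded_free_module_def polynomials_in_closed)
  qed (auto simp: graded_free_module_def polynomials_in_closed algebra_simps)
qed (auto simp: cring_polynomial_ring [unfolded polynomial_ring_def] graded_free_module_def polynomial_ring_def
      polynomials_in_closed algebra_simps)

definition monomial_product :: "(laurent \<Rightarrow>\<^sub>0 nat) \<Rightarrow> (nat \<Rightarrow>\<^sub>0 laurent)" where
  "monomial_product m =
     (\<Prod>b\<in>Poly_Mapping.keys m. Poly_Mapping.single 1 b ^ Poly_Mapping.lookup m b)"

lemma monomial_product_add:
  "monomial_product (m + m') = monomial_product m * monomial_product m'"
proof -
  let ?K = "Poly_Mapping.keys m \<union> Poly_Mapping.keys m'"
  have *: "monomial_product a = (\<Prod>b\<in>?K. Poly_Mapping.single 1 b ^ Poly_Mapping.lookup a b)"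
    if "Poly_Mapping.keys a \<subseteq> ?K" for a
    unfolding monomial_product_def using that
    by (intro prod.mono_neutral_left) (auto simp: in_keys_iff)
  show ?thesis
    using keys_add [of m m'] by (simp add: * lookup_add power_add prod.distrib)
qed

lemma section_of_polynomial_superset:
  assumes "finite A" "Poly_Mapping.keys f \<subseteq> A"
  shows "section_of_polynomial f =
    (\<Sum>m\<in>A. Poly_Mapping.single 0 (Poly_Mapping.single 0 (Poly_Mapping.lookup f m)) *
      monomial_product m)"
  unfolding section_of_polynomial_def monomial_product_def using assms
  by (intro sum.mono_neutral_left) (auto simp: in_keys_iff)

lemma section_of_polynomial_single:
  "section_of_polynomial (Poly_Mapping.single m c) =
     Poly_Mapping.single 0 (Poly_Mapping.single 0 c) * monomial_product m"
  by (subst section_of_polynomial_superset [of "{m}"]) auto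

lemma section_of_polynomial_add:
  "section_of_polynomial (f + g) = section_of_polynomial f + section_of_polynomial g"
proof -
  let ?K = "Poly_Mapping.keys f \<union> Poly_Mapping.keys g"
  have *: "finite ?K" "Poly_Mapping.keys f \<subseteq> ?K" "Poly_Mapping.keys g \<subseteq> ?K"
    "Poly_Mapping.keys (f + g) \<subseteq> ?K" using keys_add [of f g] by auto
  show ?thesis
    unfolding section_of_polynomial_superset [OF *(1,2)] section_of_polynomial_superset [OF *(1,3)]
      section_of_polynomial_superset [OF *(1,4)]
    by (simp add: lookup_add single_add distrib_right sum.distrib)
qed

lemma section_of_polynomial_sum:
  "section_of_polynomial (\<Sum>i\<in>A. f i) = (\<Sum>i\<in>A. section_of_polynomial (f i))"
proof (induction A rule: infinite_finite_induct)
  case empty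
  then show ?case by (simp add: section_of_polynomial_def)
qed (simp_all add: section_of_polynomial_add section_of_polynomial_def [of 0])

lemma section_of_polynomial_one: "section_of_polynomial 1 = 1"
  using section_of_polynomial_single [of 0 1] by (simp add: monomial_product_def)

lemma section_of_polynomial_mult:
  "section_of_polynomial (f * g) = section_of_polynomial f * section_of_polynomial g"
proof -
  let ?s = "\<lambda>f m. Poly_Mapping.single m (Poly_Mapping.lookup f m)"
  have single: "section_of_polynomial (Poly_Mapping.single m c * Poly_Mapping.single m' c') =
      section_of_polynomial (Poly_Mapping.single m c) *
      section_of_polynomial (Poly_Mapping.single m' c')" for m m' c c'
  proof -
    have "Poly_Mapping.single 0 (Poly_Mapping.single 0 (c * c')) =
        (Poly_Mapping.single 0 (Poly_Mapping.single 0 c) *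
         Poly_Mapping.single 0 (Poly_Mapping.single 0 c') :: nat \<Rightarrow>\<^sub>0 laurent)"
      by (simp add: mult_single)
    then show ?thesis
      by (simp only: mult_single [of m c m' c'] section_of_polynomial_single monomial_product_add
          mult.assoc mult.left_commute)
  qed
  have "section_of_polynomial (f * g) = section_of_polynomial
      ((\<Sum>m\<in>Poly_Mapping.keys f. ?s f m) * (\<Sum>m\<in>Poly_Mapping.keys g. ?s g m))"
    by (simp only: poly_mapping_expansion [symmetric])
  also have "\<dots> = section_of_polynomial (\<Sum>m\<in>Poly_Mapping.keys f. ?s f m) *
      section_of_polynomial (\<Sum>m\<in>Poly_Mapping.keys g. ?s g m)"
    by (simp only: sum_product section_of_polynomial_sum single)
  also have "\<dots> = section_of_polynomial f * section_of_polynomial g"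
    by (simp only: poly_mapping_expansion [symmetric])
  finally show ?thesis .
qed

lemma forms_closed:
  "0 \<in> forms n k"
  "f \<in> forms n k \<Longrightarrow> g \<in> forms n k \<Longrightarrow> f + g \<in> forms n k"
  "f \<in> forms n k \<Longrightarrow> - f \<in> forms n k"
  "f \<in> forms n k \<Longrightarrow> h \<in> forms n l \<Longrightarrow> f * h \<in> forms n (k + l)"
proof -
  show "0 \<in> forms n k" "f \<in> forms n k \<Longrightarrow> g \<in> forms n k \<Longrightarrow> f + g \<in> forms n k"
    using keys_add [of f g] by (auto simp: forms_def)
  show "f \<in> forms n k \<Longrightarrow> - f \<in> forms n k"
    by (simp add: forms_def keys_minus)
  have "a + b \<in> exponents n (k + l)" if "a \<in> exponents n k" "b \<in> exponents n l" for a b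
    using that keys_add [of a b] by (auto simp: exponents_def lookup_add sum.distrib)
  then show "f \<in> forms n k \<Longrightarrow> h \<in> forms n l \<Longrightarrow> f * h \<in> forms n (k + l)"
    using keys_mult [of f h] unfolding forms_def by blast
qed

lemma module_section_module:
  fixes n d :: nat
  defines "R \<equiv> \<lambda>m::nat. global_sections n (int m * int d)"
  shows "module (polynomial_ring (monomial_sections n (int d))) (section_module R)"
proof -
  let ?B = "monomial_sections n (int d)"
  define G where "G = {g. \<forall>m. Poly_Mapping.lookup g m \<in> R m}"
  have R: "R m = forms n (int m * int d)" for m
    by (simp add: R_def global_sections_eq_forms)
  have zero: "0 \<in> G" by (simp add: G_def R forms_closed)
  have add: "f + g \<in> G" if "f \<in> G" "g \<in> G" for f g
    using that by (simp add: G_def R lookup_add forms_closed)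
  have minus: "- f \<in> G" if "f \<in> G" for f
    using that by (simp add: G_def R forms_closed)
  have sum: "(\<Sum>i\<in>A. f i) \<in> G" if "\<And>i. i \<in> A \<Longrightarrow> f i \<in> G"
    for A and f :: "'z \<Rightarrow> (nat \<Rightarrow>\<^sub>0 laurent)"
    using that by (induction A rule: infinite_finite_induct) (simp_all add: zero add)
  have single: "Poly_Mapping.single m s \<in> G" if "s \<in> R m" for m s
    using that by (simp add: G_def lookup_single when_def R forms_closed)
  have mult: "f * g \<in> G" if "f \<in> G" "g \<in> G" for f g
  proof -
    have prod: "Poly_Mapping.lookup f a * Poly_Mapping.lookup g b \<in> R (a + b)" for a b
      
    proof -
      have "Poly_Mapping.lookup f a \<in> forms n (int a * int d)"
        "Poly_Mapping.lookup g b \<in> forms n (int b * int d)"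
        using that by (simp_all add: G_def R)
      from forms_closed(4) [OF this] show ?thesis by (simp add: R distrib_right)
    qed
    have "f * g = (\<Sum>a\<in>Poly_Mapping.keys f. Poly_Mapping.single a (Poly_Mapping.lookup f a)) *
        (\<Sum>b\<in>Poly_Mapping.keys g. Poly_Mapping.single b (Poly_Mapping.lookup g b))"
      by (simp only: poly_mapping_expansion [symmetric])
    also have "\<dots> = (\<Sum>a\<in>Poly_Mapping.keys f. \<Sum>b\<in>Poly_Mapping.keys g.
        Poly_Mapping.single (a + b) (Poly_Mapping.lookup f a * Poly_Mapping.lookup g b))"
      by (simp only: sum_product mult_single)
    also have "\<dots> \<in> G"
      by (intro sum single prod)
    finally show ?thesis .
  qed
  have const: "Poly_Mapping.single 0 c \<in> R 0" for c
    by (auto simp: R forms_def exponents_def)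
  have one: "1 \<in> G" using single [OF const [of 1]] by simp
  have pow: "Poly_Mapping.single 1 b ^ e \<in> G" if "b \<in> ?B" for b e
  proof (induction e)
    case (Suc e)
    have "b \<in> R 1" using that by (auto simp: R forms_def monomial_sections_def)
    then show ?case using mult [OF single Suc] by simp
  qed (use one in simp)
  have mono: "(\<Prod>b\<in>A. Poly_Mapping.single 1 b ^ e b) \<in> G" if "A \<subseteq> ?B" for A e
    using that
  proof (induction A rule: infinite_finite_induct)
    case (insert b A)
    then show ?case using mult [OF pow [of b "e b"]] by simp
  qed (use one in simp_all)
  have eval: "section_of_polynomial f \<in> G" if "f \<in> polynomials_in ?B" for f
    unfolding section_of_polynomial_def using that
    by (intro sum mult single const mono) (auto simp: polynomials_in_def)
  show ?thesis
  proof (rule moduleI)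
    show "abelian_group (section_module R)"
    proof (rule abelian_groupI)
      fix x assume "x \<in> carrier (section_module R)"
      then show "\<exists>y\<in>carrier (section_module R). y \<oplus>\<^bsub>section_module R\<^esub> x = \<zero>\<^bsub>section_module R\<^esub>"
        using minus [of x] by (intro bexI [of _ "- x"]) (auto simp: section_module_def G_def)
    qed (use zero add in \<open>auto simp: section_module_def G_def algebra_simps\<close>)
  next
    fix a x
    assume "a \<in> carrier (polynomial_ring ?B)" "x \<in> carrier (section_module R)"
    then show "a \<odot>\<^bsub>section_module R\<^esub> x \<in> carrier (section_module R)"
      using mult [OF eval [of a], of x] by (simp add: polynomial_ring_def section_module_def G_def)
  qed (simp_all add: cring_polynomial_ring [unfolded polynomial_ring_def] section_module_def polynomial_ring_def
        section_of_polynomial_add section_of_polynomial_mult section_of_polynomial_one algebra_simps)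
qed

end

theory Submission
  imports Defs "HOL-Library.Function_Algebras" "HOL-Library.FuncSet" "HOL-Combinatorics.Permutations"
begin

text \<open>
  The shifts occurring in step \<open>i\<close> of a minimal resolution are the degrees in which the Koszul
  homology \<open>K\<^sub>i\<close> of \<open>G\<close> does not vanish, so the claim is that \<open>K\<^sub>i\<close> vanishes in degree \<open>e\<close> on
  \<open>n\<close>-space if it does so on \<open>p\<close>-space, where \<open>i \<le> p\<close>. For \<open>P(V)\<close>, \<open>K\<^sub>i\<close> is a subquotient of a
  tensor product of \<open>i + 1\<close> symmetric powers of \<open>V\<close>. Hence all its highest weights have at most
  \<open>i + 1\<close> rows, and the weight spaces supported on the first \<open>p + 1\<close> variables, which do not
  depend on \<open>n\<close>, already detect it. Instead of representation theory we use Capelli's identity for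
  the polarizations \<open>x\<^sub>a \<partial>/\<partial>x\<^sub>b\<close>. Finite minimal resolutions are constructed from the syzygies; their
  Koszul homology is that of \<open>G\<close> with a shift in homological degree, so it is bounded and
  eventually zero.
\<close>

section \<open>Koszul homology of graded modules\<close>

text \<open>\<open>property_N\<close> asks for some resolution, so the two sides are used
  differently: from the resolution given on p-space only vanishing of Koszul homology is read off
  (\<open>resolution_koszul_vanishes\<close>), while on n-space a resolution is built whose shifts
  all come from nonvanishing homology (\<open>minimal_resolution_exists\<close>). No two resolutions
  are ever compared. The condition E_0 = S holds for every n, since a monomial of degree m d is a
  product of m monomials of degree d. The bound i <= p enters by counting. A chain has i exterior
  factors and one symmetric factor, while a weight that involves x_0, ..., x_i and a variable beyond
  x_p offers i + 2 indices. A determinant of polarizations of that size vanishes, because two of its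
  derivatives must fall on the same factor. Induction over weights makes a cycle a highest weight
  vector modulo boundaries; on such a vector all terms of the determinant act by nonnegative
  scalars, so nothing cancels and a positive multiple of the cycle is a boundary. Working modulo
  boundaries avoids any appeal to complete reducibility.\<close>

text \<open>
  Elements of \<open>\<Lambda>\<^sup>i \<otimes> M\<close> are encoded as alternating functions on lists of length \<open>i\<close>, which makes the
  differential free of signs.
\<close>

definition alternating :: "('v list \<Rightarrow> 'b::ab_group_add) \<Rightarrow> bool" where
  "alternating c \<longleftrightarrow> (\<forall>xs u v ys. c (xs @ u # v # ys) = - c (xs @ v # u # ys))"

definition koszul_d :: "('v \<Rightarrow> 'b \<Rightarrow> 'b) \<Rightarrow> 'v set \<Rightarrow> ('v list \<Rightarrow> 'b::ab_group_add) \<Rightarrow> 'v list \<Rightarrow> 'b" where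
  "koszul_d X V c L = (\<Sum>v\<in>V. X v (c (v # L)))"

text \<open>Unfolded, this is the sum of (-1)^j w(b_j) applied to \<open>c\<close> at the list
  without b_j: exterior multiplication by the sum of all e_b \<otimes> w_b. It is the candidate for
  a homotopy against \<open>koszul_d\<close>.\<close>

fun wedge :: "('v \<Rightarrow> 'b \<Rightarrow> 'b) \<Rightarrow> ('v list \<Rightarrow> 'b::ab_group_add) \<Rightarrow> 'v list \<Rightarrow> 'b" where
  "wedge w c [] = 0"
| "wedge w c (b # L) = w b (c L) - wedge w (\<lambda>xs. c (b # xs)) L"

lemma alternating_Cons: "alternating c \<Longrightarrow> alternating (\<lambda>L. c (b # L))"
  unfolding alternating_def by (metis append_Cons)

lemma alternating_swap: "alternating c \<Longrightarrow> c (u # v # L) = - c (v # u # L)"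
  unfolding alternating_def by (metis append_Nil)

text \<open>Adjacent swaps bring the two equal entries together, where one more swap shows that the
  value is its own negative.\<close>

lemma alternating_not_distinct:
  fixes c :: "'v list \<Rightarrow> complex"
  assumes c: "alternating c" and "\<not> distinct L"
  shows "c L = 0"
proof -
  have 0: "c (xs @ y # ys @ y # zs) = 0" for xs y ys zs
  proof (induction ys arbitrary: xs)
    case Nil
    have "c (xs @ y # y # zs) = - c (xs @ y # y # zs)"
      using c unfolding alternating_def by (elim allE)
    then have "2 * c (xs @ y # y # zs) = 0" by (simp only: eq_neg_iff_add_eq_0 mult_2)
    then show ?case by simp
  next
    case (Cons u ys)
    have "c (xs @ y # u # ys @ y # zs) = - c (xs @ u # y # ys @ y # zs)"
      using c unfolding alternating_def by (elim allE)
    also have "\<dots> = 0" using Cons [of "xs @ [u]"] by simp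
    finally show ?case by simp
  qed
  obtain xs y ys zs where "L = xs @ [y] @ ys @ [y] @ zs"
    using not_distinct_decomp [OF assms(2)] by blast
  then show ?thesis using 0 by simp
qed

lemma koszul_d_alternating:
  assumes "alternating c" "\<And>v x y. v \<in> V \<Longrightarrow> X v (- x) = - X v x"
  shows "alternating (koszul_d X V c)"
  unfolding alternating_def koszul_d_def
proof (intro allI)
  fix xs u v ys
  have "c (w # xs @ u # v # ys) = - c (w # xs @ v # u # ys)" for w
    using assms(1) unfolding alternating_def by (metis append_Cons)
  then show "(\<Sum>w\<in>V. X w (c (w # xs @ u # v # ys))) = - (\<Sum>w\<in>V. X w (c (w # xs @ v # u # ys)))"
    by (simp add: assms(2) sum_negf)
qed

text \<open>The double sum changes sign when its two indices are exchanged, so twice the sum is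
  zero; \<open>two\<close> then removes the factor.\<close>

lemma koszul_d_koszul_d:
  assumes c: "alternating c" and fin: "finite V"
    and add: "\<And>v x y. v \<in> V \<Longrightarrow> X v (x + y) = X v x + X v y"
    and comm: "\<And>u v x. u \<in> V \<Longrightarrow> v \<in> V \<Longrightarrow> X u (X v x) = X v (X u x)"
    and two: "\<And>x::'b::ab_group_add. x + x = 0 \<Longrightarrow> x = 0"
  shows "koszul_d X V (koszul_d X V c) L = (0::'b)"
proof -
  have zero: "X v 0 = 0" if "v \<in> V" for v using add [OF that, of 0 0] by simp
  have minus: "X v (- x) = - X v x" if "v \<in> V" for v x
    using add [OF that, of x "- x"] zero [OF that] by (simp add: eq_neg_iff_add_eq_0 add.commute)
  have sum: "X v (sum f A) = (\<Sum>a\<in>A. X v (f a))" if "v \<in> V" for v and f :: "'a \<Rightarrow> 'b" and A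
    by (induction A rule: infinite_finite_induct) (simp_all add: zero add that)
  define s where "s = (\<Sum>v\<in>V. \<Sum>u\<in>V. X v (X u (c (u # v # L))))"
  have "s = (\<Sum>u\<in>V. \<Sum>v\<in>V. X v (X u (c (u # v # L))))"
    unfolding s_def by (rule sum.swap)
  also have "\<dots> = (\<Sum>u\<in>V. \<Sum>v\<in>V. - X u (X v (c (v # u # L))))"
  proof (intro sum.cong refl)
    fix u v assume "u \<in> V" "v \<in> V"
    then show "X v (X u (c (u # v # L))) = - X u (X v (c (v # u # L)))"
      using alternating_swap [OF c, of u v L] minus comm by metis
  qed
  also have "\<dots> = - s" unfolding s_def by (simp add: sum_negf)
  finally have "s + s = 0" by (simp only: eq_neg_iff_add_eq_0)
  then have "s = 0" by (rule two)
  then show ?thesis unfolding koszul_d_def s_def by (simp add: sum)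
qed

lemma wedge_minus:
  assumes "\<And>b x. w b (- x) = - w b x"
  shows "wedge w (\<lambda>L. - c L) L = - wedge w c L"
  by (induction L arbitrary: c) (simp_all add: assms)

lemma wedge_add:
  assumes "\<And>b x y. w b (x + y) = w b x + w b y"
  shows "wedge w (\<lambda>L. c L + c' L) L = wedge w c L + wedge w c' L"
  by (induction L arbitrary: c c') (simp_all add: assms)

lemma wedge_zero:
  assumes "\<And>b. w b 0 = 0"
  shows "wedge w (\<lambda>L. 0) L = 0"
  by (induction L) (simp_all add: assms)

lemma wedge_sum:
  assumes "\<And>b x y. w b (x + y) = w b x + w b y"
  shows "wedge w (\<lambda>L. \<Sum>a\<in>A. c a L) L = (\<Sum>a\<in>A. wedge w (c a) L)"
proof -
  have "w b 0 = 0" for b using assms [of b 0 0] by simp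
  then show ?thesis
    by (induction A rule: infinite_finite_induct) (simp_all add: wedge_zero wedge_add assms)
qed

lemma wedge_alternating:
  assumes c: "alternating c" and add: "\<And>b x y. w b (x + y) = w b x + w b y"
  shows "alternating (wedge w c)"
proof -
  have zero: "w b 0 = 0" for b using add [of b 0 0] by simp
  have minus: "w b (- x) = - w b x" for b x
    using add [of b x "- x"] zero by (simp add: eq_neg_iff_add_eq_0 add.commute)
  have "wedge w c (xs @ u # v # ys) = - wedge w c (xs @ v # u # ys)"
    if "alternating c" for xs u v ys c
    using that
  proof (induction xs arbitrary: c)
    case Nil
    have "wedge w (\<lambda>L. c (u # v # L)) ys = - wedge w (\<lambda>L. c (v # u # L)) ys"
      unfolding alternating_swap [OF Nil, of u v] by (rule wedge_minus) (rule minus)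
    then show ?case by simp
  next
    case (Cons b xs)
    have "c (xs @ u # v # ys) = - c (xs @ v # u # ys)"
      using Cons.prems unfolding alternating_def by blast
    moreover note Cons.IH [OF alternating_Cons [OF Cons.prems, of b]]
    ultimately show ?case by (simp add: minus)
  qed
  with c show ?thesis unfolding alternating_def by blast
qed

text \<open>
  The hypothesis on \<open>w\<close> covers both homotopies used below: partial derivatives (\<open>\<kappa> = 1\<close>), and
  division by a single variable (\<open>\<kappa> = 0\<close>).
\<close>

lemma koszul_homotopy:
  fixes X :: "'v \<Rightarrow> 'b::ab_group_add \<Rightarrow> 'b" and c :: "'v list \<Rightarrow> 'b" and V :: "'v set"
  assumes c: "alternating c" and fin: "finite V" and L: "set L \<subseteq> V"
    and addX: "\<And>v x y. X v (x + y) = X v x + X v y"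
    and addw: "\<And>v x y. w v (x + y) = w v x + w v y"
    and addk: "\<And>x y. \<kappa> (x + y) = \<kappa> x + \<kappa> y"
    and comm: "\<And>u v x. w u (X v x) = X v (w u x) + (if u = v then \<kappa> x else 0)"
  shows "koszul_d X V (wedge w c) L + wedge w (koszul_d X V c) L =
    (\<Sum>v\<in>V. X v (w v (c L))) + (\<Sum>i<length L. \<kappa> (c L))"
proof -
  define \<delta> where "\<delta> v u x = (if u = v then \<kappa> x else 0)" for v u :: 'v and x
  have zk: "\<kappa> 0 = 0" using addk [of 0 0] by simp
  have zX: "X v 0 = 0" for v using addX [of v 0 0] by simp
  have mX: "X v (x - y) = X v x - X v y" for v x y
    using addX [of v "x - y" y] by simp
  have mk: "\<kappa> (- x) = - \<kappa> x" for x
    using addk [of x "- x"] zk by (simp add: eq_neg_iff_add_eq_0 add.commute)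
  \<comment> \<open>Commuting X v past the operators w b leaves an error term for every entry equal
    to v; \<open>\<delta> v\<close> collects these terms as a wedge of its own.\<close>
  have com: "wedge w (\<lambda>xs. X v (c xs)) L = X v (wedge w c L) + wedge (\<delta> v) c L" for v c L
    by (induction L arbitrary: c) (simp_all add: zX comm mX \<delta>_def)
  \<comment> \<open>Deleting the entry v at place j and putting it in front moves it across j
    entries, which cancels the sign (-1)^j. So each place of \<open>L\<close> contributes \<kappa>
    (c L) exactly once.\<close>
  have count: "(\<Sum>v\<in>V. wedge (\<delta> v) (\<lambda>xs. c (v # xs)) L) = (\<Sum>i<length L. \<kappa> (c L))"
    if "alternating c" "set L \<subseteq> V" for c :: "'v list \<Rightarrow> 'b" and L
    using that
  proof (induction L arbitrary: c)
    case (Cons u L)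
    have sw: "wedge (\<delta> v) (\<lambda>xs. c (v # u # xs)) L = - wedge (\<delta> v) (\<lambda>xs. c (u # v # xs)) L" for v
      unfolding alternating_swap [OF Cons.prems(1), of v u] by (rule wedge_minus) (simp add: \<delta>_def mk)
    have "(\<Sum>v\<in>V. wedge (\<delta> v) (\<lambda>xs. c (v # xs)) (u # L)) =
        (\<Sum>v\<in>V. \<delta> v u (c (v # L)) + wedge (\<delta> v) (\<lambda>xs. c (u # v # xs)) L)"
      by (simp add: sw)
    also have "\<dots> = \<kappa> (c (u # L)) + (\<Sum>i<length L. \<kappa> (c (u # L)))"
    proof -
      have "(\<Sum>v\<in>V. \<delta> v u (c (v # L))) = \<kappa> (c (u # L))"
        using Cons.prems(2) fin by (simp add: \<delta>_def)
      then show ?thesis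
        using Cons.IH [OF alternating_Cons [OF Cons.prems(1), of u]] Cons.prems(2)
        by (simp add: sum.distrib)
    qed
    finally show ?case by (simp add: add.commute)
  qed simp
  have "koszul_d X V (wedge w c) L = (\<Sum>v\<in>V. X v (w v (c L))) - (\<Sum>v\<in>V. X v (wedge w (\<lambda>xs. c (v # xs)) L))"
    unfolding koszul_d_def by (simp add: mX sum_subtractf)
  moreover have "wedge w (koszul_d X V c) L = (\<Sum>v\<in>V. wedge w (\<lambda>xs. X v (c (v # xs))) L)"
    unfolding koszul_d_def by (rule wedge_sum) (rule addw)
  ultimately show ?thesis
    using count [OF c L] by (simp add: com sum.distrib)
qed

lemma wedge_support:
  assumes "\<And>b. w b 0 = 0" and "wedge w c L \<noteq> 0"
  shows "\<exists>xs b ys. L = xs @ b # ys \<and> w b (c (xs @ ys)) \<noteq> 0"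
  using assms(2)
proof (induction L arbitrary: c)
  case (Cons b L)
  show ?case
  proof (cases "w b (c L) = 0")
    case True
    then have "wedge w (\<lambda>xs. c (b # xs)) L \<noteq> 0" using Cons.prems by simp
    from Cons.IH [OF this] obtain xs b' ys where "L = xs @ b' # ys" "w b' (c (b # xs @ ys)) \<noteq> 0" by blast
    then show ?thesis by (metis append_Cons)
  next
    case False then show ?thesis by (metis append_Nil)
  qed
qed simp

lemma wedge_in:
  assumes "0 \<in> A" "\<And>x y. x \<in> A \<Longrightarrow> y \<in> A \<Longrightarrow> x - y \<in> A" "\<And>b L. w b (c L) \<in> A"
  shows "wedge w c L \<in> A"
  using assms(3) by (induction L arbitrary: c) (simp_all add: assms)

text \<open>Exterior variables have degree 1, so in total degree e the coefficients lie in M (e -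
  i). Requiring 0 on all other lists makes equality of chains plain equality of functions.\<close>

definition koszul_chain ::
    "'v set \<Rightarrow> (int \<Rightarrow> 'b set) \<Rightarrow> nat \<Rightarrow> int \<Rightarrow> ('v list \<Rightarrow> 'b::ab_group_add) \<Rightarrow> bool" where
  "koszul_chain V M i e c \<longleftrightarrow> alternating c \<and>
     (\<forall>L. c L \<in> M (e - int i) \<and> (c L \<noteq> 0 \<longrightarrow> length L = i \<and> set L \<subseteq> V))"

definition koszul_vanishes ::
    "('v \<Rightarrow> 'b \<Rightarrow> 'b) \<Rightarrow> 'v set \<Rightarrow> (int \<Rightarrow> 'b::ab_group_add set) \<Rightarrow> nat \<Rightarrow> int \<Rightarrow> bool" where
  "koszul_vanishes X V M i e \<longleftrightarrow>
     (\<forall>c. koszul_chain V M i e c \<and> (\<forall>L. koszul_d X V c L = 0) \<longrightarrow>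
        (\<exists>c'. koszul_chain V M (Suc i) e c' \<and> koszul_d X V c' = c))"

lemma koszul_vanishesI:
  assumes "\<And>c. koszul_chain V M i e c \<Longrightarrow> (\<And>L. koszul_d X V c L = 0) \<Longrightarrow>
    \<exists>c'. koszul_chain V M (Suc i) e c' \<and> koszul_d X V c' = c"
  shows "koszul_vanishes X V M i e"
  using assms unfolding koszul_vanishes_def by simp

lemma koszul_vanishesE:
  assumes "koszul_vanishes X V M i e" "koszul_chain V M i e c" "\<And>L. koszul_d X V c L = 0"
  obtains c' where "koszul_chain V M (Suc i) e c'" "koszul_d X V c' = c"
  using assms unfolding koszul_vanishes_def by (elim allE [of _ c]) auto

text \<open>One interface for Laurent forms, sections, free modules and their submodules. Of the
  complex scalars only the absence of 2-torsion is kept, which gives d d = 0.\<close>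

definition graded_action :: "('v \<Rightarrow> 'b \<Rightarrow> 'b) \<Rightarrow> 'v set \<Rightarrow> (int \<Rightarrow> 'b::ab_group_add set) \<Rightarrow> bool" where
  "graded_action X V M \<longleftrightarrow> finite V \<and> (\<forall>x::'b. x + x = 0 \<longrightarrow> x = 0) \<and>
     (\<forall>v x y. X v (x + y) = X v x + X v y) \<and> (\<forall>u v x. X u (X v x) = X v (X u x)) \<and>
     (\<forall>e. 0 \<in> M e \<and> (\<forall>x\<in>M e. \<forall>y\<in>M e. x - y \<in> M e) \<and> (\<forall>v\<in>V. \<forall>x\<in>M e. X v x \<in> M (e + 1)))"

lemma graded_actionD:
  fixes X :: "'v \<Rightarrow> 'b::ab_group_add \<Rightarrow> 'b"
  assumes "graded_action X V M"
  shows "finite V" "x + x = 0 \<Longrightarrow> x = 0" "X v (x + y) = X v x + X v y" "X u (X v x) = X v (X u x)"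
    "0 \<in> M e" "x \<in> M e \<Longrightarrow> y \<in> M e \<Longrightarrow> x - y \<in> M e" "v \<in> V \<Longrightarrow> x \<in> M e \<Longrightarrow> X v x \<in> M (e + 1)"
    "X v 0 = 0" "X v (- x) = - X v x" "X v (x - y) = X v x - X v y"
    "x \<in> M e \<Longrightarrow> - x \<in> M e" "x \<in> M e \<Longrightarrow> y \<in> M e \<Longrightarrow> x + y \<in> M e"
proof -
  note A = assms [unfolded graded_action_def]
  note * = A [THEN conjunct1] A [THEN conjunct2, THEN conjunct1]
    A [THEN conjunct2, THEN conjunct2, THEN conjunct1]
    A [THEN conjunct2, THEN conjunct2, THEN conjunct2, THEN conjunct1]
    A [THEN conjunct2, THEN conjunct2, THEN conjunct2, THEN conjunct2]
  show "finite V" by (rule *(1))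
  show "x + x = 0 \<Longrightarrow> x = 0" using *(2) [rule_format] .
  show add: "X v (x + y) = X v x + X v y" for x y using *(3) [rule_format] .
  show "X u (X v x) = X v (X u x)" using *(4) [rule_format] .
  show z: "0 \<in> M e" and d: "x \<in> M e \<Longrightarrow> y \<in> M e \<Longrightarrow> x - y \<in> M e"
    and "v \<in> V \<Longrightarrow> x \<in> M e \<Longrightarrow> X v x \<in> M (e + 1)" for x y
    using *(5) by blast+
  show "X v 0 = 0" using add [of 0 0] by simp
  show "X v (x - y) = X v x - X v y" for x y using add [of "x - y" y] by simp
  from this [of 0 x] \<open>X v 0 = 0\<close> show "X v (- x) = - X v x" by simp
  show m: "x \<in> M e \<Longrightarrow> - x \<in> M e" for x using d [of 0 x] z by simp
  show "x \<in> M e \<Longrightarrow> y \<in> M e \<Longrightarrow> x + y \<in> M e" using d [of x "- y"] m [of y] by simp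
qed

lemma graded_action_sum:
  assumes "graded_action X V M" "\<And>a. a \<in> A \<Longrightarrow> f a \<in> M e"
  shows "sum f A \<in> M e"
  using assms(2)
  by (induction A rule: infinite_finite_induct)
    (simp_all add: graded_actionD(5,12) [OF assms(1)])

lemma koszul_chain_d:
  assumes "graded_action X V M" "koszul_chain V M (Suc i) e c"
  shows "koszul_chain V M i e (koszul_d X V c)"
  unfolding koszul_chain_def
proof (intro conjI allI impI)
  note M = graded_actionD [OF assms(1)]
  show "alternating (koszul_d X V c)"
    using assms(2) M(9) by (intro koszul_d_alternating) (auto simp: koszul_chain_def)
  fix L
  have "X v (c (v # L)) \<in> M (e - int (Suc i) + 1)" if "v \<in> V" for v
    using assms(2) that by (intro M(7)) (auto simp: koszul_chain_def)
  then show "koszul_d X V c L \<in> M (e - int i)"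
    unfolding koszul_d_def by (intro graded_action_sum [OF assms(1)]) (simp add: algebra_simps)
  assume "koszul_d X V c L \<noteq> 0"
  then obtain v where "X v (c (v # L)) \<noteq> 0"
    unfolding koszul_d_def by (meson sum.not_neutral_contains_not_neutral)
  then have "c (v # L) \<noteq> 0" using M(8) by metis
  then have "length (v # L) = Suc i \<and> set (v # L) \<subseteq> V"
    using assms(2) unfolding koszul_chain_def by blast
  then show "length L = i" "set L \<subseteq> V" by auto
qed

lemma koszul_chain_diff:
  assumes "graded_action X V M" "koszul_chain V M i e c" "koszul_chain V M i e c'"
  shows "koszul_chain V M i e (\<lambda>L. c L - c' L)"
proof -
  have c: "alternating c" "c L \<in> M (e - int i)" "c L \<noteq> 0 \<Longrightarrow> length L = i \<and> set L \<subseteq> V"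
    and c': "alternating c'" "c' L \<in> M (e - int i)" "c' L \<noteq> 0 \<Longrightarrow> length L = i \<and> set L \<subseteq> V" for L
    using assms(2,3) unfolding koszul_chain_def by blast+
  have "alternating (\<lambda>L. c L - c' L)"
    unfolding alternating_def
  proof (intro allI)
    fix xs u v ys
    have "c (xs @ u # v # ys) = - c (xs @ v # u # ys)" "c' (xs @ u # v # ys) = - c' (xs @ v # u # ys)"
      using c(1) c'(1) unfolding alternating_def by blast+
    then show "c (xs @ u # v # ys) - c' (xs @ u # v # ys) = - (c (xs @ v # u # ys) - c' (xs @ v # u # ys))"
      by simp
  qed
  moreover have "c L - c' L \<in> M (e - int i)" for L
    using graded_actionD(6) [OF assms(1)] c(2) c'(2) by blast
  moreover have "length L = i \<and> set L \<subseteq> V" if "c L - c' L \<noteq> 0" for L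
    using c(3) [of L] c'(3) [of L] that by (cases "c L = 0") auto
  ultimately show ?thesis unfolding koszul_chain_def by blast
qed

lemma koszul_d_diff:
  assumes "graded_action X V M"
  shows "koszul_d X V (\<lambda>L. c L - c' L) L = koszul_d X V c L - koszul_d X V c' L"
  unfolding koszul_d_def by (simp add: graded_actionD(10) [OF assms] sum_subtractf)

lemma koszul_cycle_d:
  assumes "graded_action X V M" "koszul_chain V M i e c"
  shows "koszul_d X V (koszul_d X V c) L = 0"
proof (rule koszul_d_koszul_d)
  show "alternating c" using assms(2) unfolding koszul_chain_def by blast
qed (rule graded_actionD(1,2,3,4) [OF assms(1)]; assumption?)+

text \<open>Oddness of \<open>f\<close> is all that alternation asks for, so this serves
  homomorphisms as well as the set-theoretic sections of \<open>odd_section\<close>.\<close>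

lemma koszul_chain_map:
  assumes "koszul_chain V M i e c"
    and "f 0 = 0" "\<And>x. x \<in> M (e - int i) \<Longrightarrow> f (- x) = - f x"
    and "\<And>x. x \<in> M (e - int i) \<Longrightarrow> f x \<in> N (e - int i)"
  shows "koszul_chain V N i e (\<lambda>L. f (c L))"
proof -
  have c: "alternating c" "c L \<in> M (e - int i)" "c L \<noteq> 0 \<Longrightarrow> length L = i \<and> set L \<subseteq> V" for L
    using assms(1) unfolding koszul_chain_def by blast+
  have "alternating (\<lambda>L. f (c L))"
    unfolding alternating_def
  proof (intro allI)
    fix xs u v ys
    have "c (xs @ u # v # ys) = - c (xs @ v # u # ys)"
      using c(1) unfolding alternating_def by blast
    then show "f (c (xs @ u # v # ys)) = - f (c (xs @ v # u # ys))"
      using assms(3) [OF c(2) [of "xs @ v # u # ys"]] by presburger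
  qed
  moreover have "length L = i \<and> set L \<subseteq> V" if "f (c L) \<noteq> 0" for L
  proof -
    have "c L \<noteq> 0" using that assms(2) by metis
    then show ?thesis by (rule c(3))
  qed
  moreover have "f (c L) \<in> N (e - int i)" for L
    by (rule assms(4) [OF c(2)])
  ultimately show ?thesis by (simp add: koszul_chain_def)
qed

section \<open>Long exact sequence of Koszul homology for a graded surjection\<close>

definition graded_surjection ::
    "('v \<Rightarrow> 'b \<Rightarrow> 'b) \<Rightarrow> ('v \<Rightarrow> 'c \<Rightarrow> 'c) \<Rightarrow> 'v set \<Rightarrow> (int \<Rightarrow> 'b::ab_group_add set) \<Rightarrow>
     (int \<Rightarrow> 'c::ab_group_add set) \<Rightarrow> ('b \<Rightarrow> 'c) \<Rightarrow> bool" where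
  "graded_surjection X Y V F M \<phi> \<longleftrightarrow> graded_action X V F \<and> graded_action Y V M \<and>
     (\<forall>e. \<forall>x\<in>F e. \<exists>y\<in>F e. y + y = x) \<and>
     (\<forall>e. \<forall>x\<in>F e. \<forall>y\<in>F e. \<phi> (x + y) = \<phi> x + \<phi> y) \<and>
     (\<forall>e. \<forall>x\<in>F e. \<forall>v\<in>V. \<phi> (X v x) = Y v (\<phi> x)) \<and> (\<forall>e. \<phi> ` F e = M e)"

definition kernel_components ::
    "(int \<Rightarrow> 'b set) \<Rightarrow> ('b \<Rightarrow> 'c::zero) \<Rightarrow> int \<Rightarrow> 'b set" where
  "kernel_components F \<phi> e = {x \<in> F e. \<phi> x = 0}"

context
  fixes X :: "'v \<Rightarrow> 'b::ab_group_add \<Rightarrow> 'b" and Y :: "'v \<Rightarrow> 'c::ab_group_add \<Rightarrow> 'c" and V F M \<phi>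
  assumes surj: "graded_surjection X Y V F M \<phi>"
begin

lemma FM: "graded_action X V F" "graded_action Y V M"
  using surj by (simp_all add: graded_surjection_def)

lemma phi_add: "x \<in> F e \<Longrightarrow> y \<in> F e \<Longrightarrow> \<phi> (x + y) = \<phi> x + \<phi> y"
  and phi_act: "x \<in> F e \<Longrightarrow> v \<in> V \<Longrightarrow> \<phi> (X v x) = Y v (\<phi> x)"
  and phi_onto: "\<phi> ` F e = M e"
  using surj by (simp_all add: graded_surjection_def)

lemma phi_zero: "\<phi> 0 = 0"
  using phi_add [OF graded_actionD(5) [OF FM(1)] graded_actionD(5) [OF FM(1)]] by simp

lemma phi_minus: "x \<in> F e \<Longrightarrow> \<phi> (- x) = - \<phi> x"
  using phi_add [of x e "- x"] graded_actionD(11) [OF FM(1), of x e] phi_zero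
  by (simp add: eq_neg_iff_add_eq_0 add.commute)

lemma phi_diff: "x \<in> F e \<Longrightarrow> y \<in> F e \<Longrightarrow> \<phi> (x - y) = \<phi> x - \<phi> y"
  using phi_add [of x e "- y"] phi_minus [of y e] graded_actionD(11) [OF FM(1), of y e] by simp

lemma phi_sum: "(\<And>a. a \<in> A \<Longrightarrow> f a \<in> F e) \<Longrightarrow> \<phi> (sum f A) = (\<Sum>a\<in>A. \<phi> (f a))"
  by (induction A rule: infinite_finite_induct)
    (simp_all add: phi_zero phi_add [of _ e] graded_action_sum [OF FM(1)])

text \<open>An odd set-theoretic section suffices to lift alternating chains.\<close>

lemma odd_section:
  "\<exists>s. s 0 = 0 \<and> (\<forall>x\<in>M e. s x \<in> F e \<and> \<phi> (s x) = x \<and> s (- x) = - s x)"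
proof -
  define l where "l x = (SOME y. y \<in> F e \<and> \<phi> y = x)" for x
  have l: "l x \<in> F e" "\<phi> (l x) = x" if "x \<in> M e" for x
  proof -
    have "\<exists>y. y \<in> F e \<and> \<phi> y = x" using that phi_onto [of e] by (metis imageE)
    from someI_ex [OF this] show "l x \<in> F e" "\<phi> (l x) = x"
      unfolding l_def by simp_all
  qed
  define half where "half x = (SOME y. y \<in> F e \<and> y + y = x)" for x
  have half: "half x \<in> F e" "half x + half x = x" if "x \<in> F e" for x
  proof -
    have "\<exists>y. y \<in> F e \<and> y + y = x"
      using surj that unfolding graded_surjection_def by (elim conjE) blast
    from someI_ex [OF this] show "half x \<in> F e" "half x + half x = x"
      unfolding half_def by simp_all
  qed
  have halfu: "half x = y" if "x \<in> F e" "y + y = x" for x y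
  proof -
    have "half x - y + (half x - y) = (half x + half x) - (y + y)"
      by (rule add_diff_add [symmetric])
    also have "\<dots> = 0" using half(2) [OF that(1)] that(2) by simp
    finally show ?thesis using graded_actionD(2) [OF FM(1), of "half x - y"] by simp
  qed
  note F = graded_actionD [OF FM(1)] and Mm = graded_actionD [OF FM(2)]
  \<comment> \<open>An arbitrary lift \<open>l\<close> is antisymmetrized: \<phi> sends l x - l (-
    x) to 2 x, and since halves are unique in F, the half of this difference is an odd function of
    x.\<close>
  define s where "s x = half (l x - l (- x))" for x
  have s: "s x \<in> F e \<and> \<phi> (s x) = x \<and> s (- x) = - s x" if x: "x \<in> M e" for x
  proof -
    have mx: "- x \<in> M e" by (rule Mm(11) [OF x])
    have y: "l x - l (- x) \<in> F e" by (rule F(6) [OF l(1) [OF x] l(1) [OF mx]])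
    have sx: "s x \<in> F e" "s x + s x = l x - l (- x)" using half [OF y] by (simp_all add: s_def)
    have "\<phi> (s x) + \<phi> (s x) = \<phi> (l x - l (- x))"
      unfolding sx(2) [symmetric] by (rule phi_add [OF sx(1) sx(1), symmetric])
    also have "\<dots> = x + x"
      using phi_diff [OF l(1) [OF x] l(1) [OF mx]] l(2) [OF x] l(2) [OF mx] by simp
    finally have "\<phi> (s x) - x + (\<phi> (s x) - x) = 0"
      by (metis add_diff_add diff_self)
    then have "\<phi> (s x) - x = 0" by (rule Mm(2))
    then have "\<phi> (s x) = x" by simp
    moreover have "s (- x) = - s x"
    proof -
      have "- s x + - s x = l (- x) - l x" using sx(2) by (metis minus_add_distrib minus_diff_eq add.commute)
      then show ?thesis
        unfolding s_def [of "- x"] minus_minus using F(6) [OF l(1) [OF mx] l(1) [OF x]] by (intro halfu)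
    qed
    ultimately show ?thesis using sx(1) by simp
  qed
  moreover have "s 0 = 0" unfolding s_def using F(5) by (intro halfu) simp_all
  ultimately show ?thesis by blast
qed

lemma koszul_chain_lift:
  assumes "koszul_chain V M i e c"
  obtains c' where "koszul_chain V F i e c'" "\<And>L. \<phi> (c' L) = c L"
proof -
  obtain s where "s 0 = 0" "\<forall>x\<in>M (e - int i). s x \<in> F (e - int i) \<and> \<phi> (s x) = x \<and> s (- x) = - s x"
    using odd_section by blast
  note s = this
  show ?thesis
  proof (rule that)
    show "koszul_chain V F i e (\<lambda>L. s (c L))"
      using s by (intro koszul_chain_map [OF assms]) simp_all
    have "c L \<in> M (e - int i)" for L
      using assms unfolding koszul_chain_def by blast
    then show "\<phi> (s (c L)) = c L" for L
      using s(2) by simp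
  qed
qed

lemma phi_koszul_d:
  assumes "koszul_chain V F i e c"
  shows "\<phi> (koszul_d X V c L) = koszul_d Y V (\<lambda>L. \<phi> (c L)) L"
proof -
  have c: "c L \<in> F (e - int i)" for L using assms unfolding koszul_chain_def by blast
  have "\<phi> (\<Sum>v\<in>V. X v (c (v # L))) = (\<Sum>v\<in>V. \<phi> (X v (c (v # L))))"
    by (rule phi_sum) (rule graded_actionD(7) [OF FM(1) _ c])
  then show ?thesis unfolding koszul_d_def by (simp add: phi_act [OF c])
qed

lemma phi_koszul_chain: "koszul_chain V F i e c \<Longrightarrow> koszul_chain V M i e (\<lambda>L. \<phi> (c L))"
  by (erule koszul_chain_map) (rule phi_zero, erule phi_minus, subst phi_onto [symmetric], erule imageI)

lemma kernel_chain_iff: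
  "koszul_chain V (kernel_components F \<phi>) i e c \<longleftrightarrow> koszul_chain V F i e c \<and> (\<forall>L. \<phi> (c L) = 0)"
  unfolding koszul_chain_def kernel_components_def by (simp add: all_conj_distrib) blast

text \<open>Exactness of the long sequence at K_(i+1) of M: the differential of a lifted cycle is a
  cycle with values in the kernel (the connecting map). If that one bounds, the lift can be
  corrected to a cycle of F.\<close>

lemma koszul_vanishes_from_kernel:
  assumes F: "koszul_vanishes X V F (Suc i) e"
    and K: "koszul_vanishes X V (kernel_components F \<phi>) i e"
  shows "koszul_vanishes Y V M (Suc i) e"
proof (rule koszul_vanishesI)
  fix c assume c: "koszul_chain V M (Suc i) e c" and cyc: "\<And>L. koszul_d Y V c L = 0"
  obtain f where f: "koszul_chain V F (Suc i) e f" and fc: "\<And>L. \<phi> (f L) = c L"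
    using koszul_chain_lift [OF c] by blast
  have "koszul_chain V (kernel_components F \<phi>) i e (koszul_d X V f)"
    unfolding kernel_chain_iff
    using koszul_chain_d [OF FM(1) f] phi_koszul_d [OF f] cyc by (simp add: fc)
  then obtain k where k: "koszul_chain V (kernel_components F \<phi>) (Suc i) e k"
    and kf: "koszul_d X V k = koszul_d X V f"
    by (rule koszul_vanishesE [OF K]) (rule koszul_cycle_d [OF FM(1) f])
  have k': "koszul_chain V F (Suc i) e k" "\<phi> (k L) = 0" for L
    using k by (simp_all add: kernel_chain_iff)
  have dfk: "koszul_d X V (\<lambda>L. f L - k L) L = 0" for L
    unfolding koszul_d_diff [OF FM(1)] kf by simp
  obtain g where g: "koszul_chain V F (Suc (Suc i)) e g"
    and gf: "koszul_d X V g = (\<lambda>L. f L - k L)"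
    by (rule koszul_vanishesE [OF F koszul_chain_diff [OF FM(1) f k'(1)] dfk])
  have "koszul_d Y V (\<lambda>L. \<phi> (g L)) L = c L" for L
  proof -
    have "f L \<in> F (e - int (Suc i))" "k L \<in> F (e - int (Suc i))"
      using f k'(1) unfolding koszul_chain_def by blast+
    then show ?thesis
      using phi_koszul_d [OF g, of L] by (simp add: gf phi_diff [of _ "e - int (Suc i)"] fc k'(2))
  qed
  then show "\<exists>c'. koszul_chain V M (Suc (Suc i)) e c' \<and> koszul_d Y V c' = c"
    using phi_koszul_chain [OF g] by (intro exI conjI ext)
qed

text \<open>Exactness of the long sequence at K_i of the kernel. The second premise says that K_i of
  the kernel maps to zero in K_i of F. This is weaker than vanishing of K_i of F, which fails for i
  = 0; there minimality of the cover supplies it.\<close>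

lemma koszul_vanishes_kernel:
  assumes M: "koszul_vanishes Y V M (Suc i) e"
    and F: "\<And>c. koszul_chain V (kernel_components F \<phi>) i e c \<Longrightarrow> (\<And>L. koszul_d X V c L = 0) \<Longrightarrow>
       \<exists>c'. koszul_chain V F (Suc i) e c' \<and> koszul_d X V c' = c"
  shows "koszul_vanishes X V (kernel_components F \<phi>) i e"
proof (rule koszul_vanishesI)
  fix c assume c: "koszul_chain V (kernel_components F \<phi>) i e c" and cyc: "\<And>L. koszul_d X V c L = 0"
  obtain f where f: "koszul_chain V F (Suc i) e f" and fc: "koszul_d X V f = c"
    using F [OF c cyc] by (elim exE conjE)
  have c0: "\<phi> (c L) = 0" for L using c by (simp add: kernel_chain_iff)
  have df: "koszul_d Y V (\<lambda>L. \<phi> (f L)) L = 0" for L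
    using phi_koszul_d [OF f, of L] by (simp add: fc c0)
  obtain m where m: "koszul_chain V M (Suc (Suc i)) e m" and mf: "koszul_d Y V m = (\<lambda>L. \<phi> (f L))"
    by (rule koszul_vanishesE [OF M phi_koszul_chain [OF f] df])
  obtain g where g: "koszul_chain V F (Suc (Suc i)) e g" and gm: "\<And>L. \<phi> (g L) = m L"
    using koszul_chain_lift [OF m] by blast
  let ?k = "\<lambda>L. f L - koszul_d X V g L"
  note dg = koszul_chain_d [OF FM(1) g]
  have "koszul_chain V F (Suc i) e ?k" by (rule koszul_chain_diff [OF FM(1) f dg])
  moreover have "\<phi> (?k L) = 0" for L
  proof -
    have "f L \<in> F (e - int (Suc i))" "koszul_d X V g L \<in> F (e - int (Suc i))"
      using f dg unfolding koszul_chain_def by blast+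
    then show ?thesis
      using phi_koszul_d [OF g, of L] by (simp add: phi_diff [of _ "e - int (Suc i)"] gm mf)
  qed
  ultimately have "koszul_chain V (kernel_components F \<phi>) (Suc i) e ?k"
    unfolding kernel_chain_iff by (intro conjI allI)
  moreover have "koszul_d X V ?k = c"
  proof (rule ext)
    fix L
    have "koszul_d X V ?k L = koszul_d X V f L - koszul_d X V (koszul_d X V g) L"
      by (rule koszul_d_diff [OF FM(1)])
    then show "koszul_d X V ?k L = c L" by (simp only: koszul_cycle_d [OF FM(1) g] fc diff_0_right)
  qed
  ultimately show "\<exists>c'. koszul_chain V (kernel_components F \<phi>) (Suc i) e c' \<and> koszul_d X V c' = c"
    by (intro exI conjI)
qed

end

section \<open>Capelli's identity\<close>

type_synonym exponent_matrix = "nat \<Rightarrow> (nat \<Rightarrow>\<^sub>0 int)"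

abbreviation unit_exponent :: "nat \<Rightarrow> (nat \<Rightarrow>\<^sub>0 int)" where
  "unit_exponent k \<equiv> Poly_Mapping.single k 1"

text \<open>
  A function on exponent matrices is the family of coefficients of a polynomial in variables
  \<open>y\<^sub>s\<^sub>k\<close>. The polarization \<open>\<Sum>\<^sub>s y\<^sub>s\<^sub>a \<partial>/\<partial>y\<^sub>s\<^sub>b\<close> over the factors \<open>s < m\<close> acts on such families. The operator
  \<open>normal_ordered\<close> below is the product of the polarizations from \<open>k\<close> to \<open>\<tau> k\<close> for \<open>k \<in> A\<close>, with all
  derivatives applied before all multiplications.
\<close>

definition polarization ::
    "nat \<Rightarrow> nat \<Rightarrow> nat \<Rightarrow> (exponent_matrix \<Rightarrow> complex) \<Rightarrow> exponent_matrix \<Rightarrow> complex" where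
  "polarization m a b F M =
     (\<Sum>s<m. of_int (Poly_Mapping.lookup (M s + (unit_exponent b - unit_exponent a)) b) *
        F (M(s := M s + (unit_exponent b - unit_exponent a))))"

text \<open>Coefficients are pulled back: the value at M comes from the monomial before the move,
  where each factor \<open>s k\<close> still has a y_k in place of y_(\<tau> k). As the k in A are
  distinct, no variable is differentiated twice, so the coefficient in \<open>normal_ordered\<close>
  is a plain product of exponents of this earlier monomial.\<close>

definition moved :: "nat set \<Rightarrow> (nat \<Rightarrow> nat) \<Rightarrow> (nat \<Rightarrow> nat) \<Rightarrow> exponent_matrix \<Rightarrow> exponent_matrix" where
  "moved A \<tau> s M = (\<lambda>t. M t + (\<Sum>k\<in>A. if s k = t then unit_exponent k - unit_exponent (\<tau> k) else 0))"

definition normal_ordered ::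
    "nat \<Rightarrow> nat set \<Rightarrow> (nat \<Rightarrow> nat) \<Rightarrow> (exponent_matrix \<Rightarrow> complex) \<Rightarrow> exponent_matrix \<Rightarrow> complex" where
  "normal_ordered m A \<tau> F M =
     (\<Sum>s\<in>A \<rightarrow>\<^sub>E {..<m}. (\<Prod>k\<in>A. of_int (Poly_Mapping.lookup (moved A \<tau> s M (s k)) k)) *
        F (moved A \<tau> s M))"

lemma sum_PiE_insert:
  assumes "x \<notin> S"
  shows "sum f (insert x S \<rightarrow>\<^sub>E T) = (\<Sum>g\<in>S \<rightarrow>\<^sub>E T. \<Sum>y\<in>T. f (g(x := y)))"
proof -
  have "sum f (insert x S \<rightarrow>\<^sub>E T) = (\<Sum>(y, g)\<in>T \<times> (S \<rightarrow>\<^sub>E T). f (g(x := y)))"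
    unfolding PiE_insert_eq
    using inj_combinator [OF assms, of "\<lambda>_. T"]
    by (subst sum.reindex) (auto simp: inj_on_def case_prod_beta)
  also have "\<dots> = (\<Sum>y\<in>T. \<Sum>g\<in>S \<rightarrow>\<^sub>E T. f (g(x := y)))"
    by (simp add: sum.cartesian_product)
  also have "\<dots> = (\<Sum>g\<in>S \<rightarrow>\<^sub>E T. \<Sum>y\<in>T. f (g(x := y)))"
    by (rule sum.swap)
  finally show ?thesis .
qed

lemma moved_insert:
  assumes "finite B" "b \<notin> B"
  shows "moved (insert b B) \<tau> (s(b := t)) M =
    (moved B \<tau> s M)(t := moved B \<tau> s M t + (unit_exponent b - unit_exponent (\<tau> b)))"
proof
  fix u
  have "(\<Sum>k\<in>B. if (s(b := t)) k = u then unit_exponent k - unit_exponent (\<tau> k) else 0) =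
      (\<Sum>k\<in>B. if s k = u then unit_exponent k - unit_exponent (\<tau> k) else 0)"
    using assms(2) by (intro sum.cong) auto
  then show "moved (insert b B) \<tau> (s(b := t)) M u =
    ((moved B \<tau> s M)(t := moved B \<tau> s M t + (unit_exponent b - unit_exponent (\<tau> b)))) u"
    using assms by (simp add: moved_def algebra_simps)
qed

lemma moved_cong: "(\<And>k. k \<in> A \<Longrightarrow> \<tau> k = \<tau>' k) \<Longrightarrow> moved A \<tau> s M = moved A \<tau>' s M"
  unfolding moved_def by (intro ext arg_cong2 [where f = "(+)"] refl sum.cong) auto

lemma normal_ordered_cong:
  assumes "\<And>k. k \<in> A \<Longrightarrow> \<tau> k = \<tau>' k"
  shows "normal_ordered m A \<tau> F = normal_ordered m A \<tau>' F"
  unfolding normal_ordered_def by (simp add: moved_cong [OF assms])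

text \<open>Leibniz rule. With a = \<tau> b, the only derivative that can hit the new multiplication
  by y_a is the one by y_a itself, present if a lies in B. This contraction joins the moves from b
  to a and from a to \<tau> a into a single move from b to \<tau> a.\<close>

lemma normal_ordered_polarization:
  assumes "finite B" "b \<notin> B"
  shows "normal_ordered m B \<tau> (polarization m (\<tau> b) b F) M =
    normal_ordered m (insert b B) \<tau> F M +
    (if \<tau> b \<in> B then normal_ordered m (insert b (B - {\<tau> b})) (\<tau>(b := \<tau> (\<tau> b))) F M else 0)"
proof -
  let ?a = "\<tau> b" and ?T = "{..<m}"
  define L where "L s t = moved (insert b B) \<tau> (s(b := t)) M" for s t
  define c where "c X k t = (of_int (Poly_Mapping.lookup (X t) k) :: complex)" for X :: exponent_matrix and k t
  have Leq: "L s t = (moved B \<tau> s M)(t := moved B \<tau> s M t + (unit_exponent b - unit_exponent ?a))" for s t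
    unfolding L_def by (rule moved_insert [OF assms])
  have lhs: "normal_ordered m B \<tau> (polarization m ?a b F) M =
      (\<Sum>s\<in>B \<rightarrow>\<^sub>E ?T. \<Sum>t<m. (\<Prod>k\<in>B. c (moved B \<tau> s M) k (s k)) * (c (L s t) b t * F (L s t)))"
    unfolding normal_ordered_def polarization_def Leq c_def by (simp add: sum_distrib_left)
  have big: "normal_ordered m (insert b B) \<tau> F M =
      (\<Sum>s\<in>B \<rightarrow>\<^sub>E ?T. \<Sum>t<m. (\<Prod>k\<in>B. c (L s t) k (s k)) * (c (L s t) b t * F (L s t)))"
  proof -
    have "(\<Prod>k\<in>insert b B. c (L s t) k ((s(b := t)) k)) = (\<Prod>k\<in>B. c (L s t) k (s k)) * c (L s t) b t" for s t
    proof -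
      have "(\<Prod>k\<in>B. c (L s t) k ((s(b := t)) k)) = (\<Prod>k\<in>B. c (L s t) k (s k))"
        using assms(2) by (intro prod.cong) auto
      then show ?thesis using assms by (simp add: mult.commute)
    qed
    then show ?thesis
      unfolding normal_ordered_def sum_PiE_insert [OF assms(2)] L_def [symmetric] c_def [symmetric]
      by (simp add: mult.assoc)
  qed
  \<comment> \<open>\<open>L s t\<close> differs from \<open>moved B \<tau> s M\<close> by e_b - e_a
    in row t. As k is not b, only the exponent of ?a in that row changes; this 1 is the
    commutator.\<close>
  have step: "c (moved B \<tau> s M) k (s k) = c (L s t) k (s k) + (if k = ?a \<and> s k = t then 1 else 0)"
    if "k \<in> B" for s t k
    using that assms(2) by (auto simp: c_def Leq lookup_add lookup_minus lookup_single)
  show ?thesis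
  proof (cases "?a \<in> B")
    case False
    have "(\<Prod>k\<in>B. c (moved B \<tau> s M) k (s k)) = (\<Prod>k\<in>B. c (L s t) k (s k))" for s t
      using False by (intro prod.cong refl) (auto simp: step [of _ s t])
    then show ?thesis using False unfolding lhs big by simp
  next
    case True
    define C where "C = B - {?a}"
    have C: "finite C" "?a \<notin> C" "b \<notin> C" "B = insert ?a C"
      using assms True by (auto simp: C_def)
    define r where "r s t = (\<Prod>k\<in>C. c (L s t) k (s k)) * (c (L s t) b t * F (L s t))" for s t
    have split: "(\<Prod>k\<in>B. c (moved B \<tau> s M) k (s k)) =
        (\<Prod>k\<in>B. c (L s t) k (s k)) + (if s ?a = t then \<Prod>k\<in>C. c (L s t) k (s k) else 0)" for s t
    proof -
      have "(\<Prod>k\<in>C. c (moved B \<tau> s M) k (s k)) = (\<Prod>k\<in>C. c (L s t) k (s k))"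
        using C step [of _ s t] by (intro prod.cong refl) auto
      then have "(\<Prod>k\<in>insert ?a C. c (moved B \<tau> s M) k (s k)) =
          (c (L s t) ?a (s ?a) + (if s ?a = t then 1 else 0)) * (\<Prod>k\<in>C. c (L s t) k (s k))"
        using C(1,2) step [OF True, of s t] by simp
      also have "\<dots> = (\<Prod>k\<in>insert ?a C. c (L s t) k (s k)) +
          (if s ?a = t then \<Prod>k\<in>C. c (L s t) k (s k) else 0)"
        using C(1,2) by (simp add: algebra_simps)
      finally show ?thesis by (simp only: C(4) [symmetric])
    qed
    have "normal_ordered m B \<tau> (polarization m ?a b F) M - normal_ordered m (insert b B) \<tau> F M =
        (\<Sum>s\<in>B \<rightarrow>\<^sub>E ?T. \<Sum>t<m. if s ?a = t then r s t else 0)"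
      unfolding lhs big sum_subtractf [symmetric]
    proof (intro sum.cong refl)
      fix s t
      show "(\<Prod>k\<in>B. c (moved B \<tau> s M) k (s k)) * (c (L s t) b t * F (L s t)) -
          (\<Prod>k\<in>B. c (L s t) k (s k)) * (c (L s t) b t * F (L s t)) = (if s ?a = t then r s t else 0)"
        unfolding split [of s t] r_def by (simp add: algebra_simps)
    qed
    also have "\<dots> = (\<Sum>g\<in>C \<rightarrow>\<^sub>E ?T. \<Sum>u<m. r (g(?a := u)) u)"
      using C(4) sum_PiE_insert [OF C(2), of "\<lambda>s. \<Sum>t<m. if s ?a = t then r s t else 0" ?T] by simp
    also have "\<dots> = normal_ordered m (insert b C) (\<tau>(b := \<tau> ?a)) F M"
    proof -
      let ?\<tau>' = "\<tau>(b := \<tau> ?a)"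
      \<comment> \<open>Both moves happen in row u, where e_b - e_a and e_a - e_(\<tau> a)
        telescope.\<close>
      have Lm: "L (g(?a := u)) u = moved (insert b C) ?\<tau>' (g(b := u)) M" for g u
      proof -
        have "moved B \<tau> (g(?a := u)) M =
            (moved C \<tau> g M)(u := moved C \<tau> g M u + (unit_exponent ?a - unit_exponent (\<tau> ?a)))"
          unfolding C(4) by (rule moved_insert [OF C(1,2)])
        moreover have "moved C ?\<tau>' g M = moved C \<tau> g M" using C(3) by (intro moved_cong) auto
        ultimately show ?thesis
          unfolding Leq moved_insert [OF C(1,3)] by (simp add: algebra_simps)
      qed
      have "r (g(?a := u)) u = (\<Prod>k\<in>insert b C. c (moved (insert b C) ?\<tau>' (g(b := u)) M) k ((g(b := u)) k)) *
          F (moved (insert b C) ?\<tau>' (g(b := u)) M)" for g u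
      proof -
        let ?X = "moved (insert b C) ?\<tau>' (g(b := u)) M"
        have "(\<Prod>k\<in>C. c ?X k ((g(?a := u)) k)) = (\<Prod>k\<in>C. c ?X k ((g(b := u)) k))"
          using C by (intro prod.cong refl) (metis fun_upd_other)
        then show ?thesis using C(1,3) unfolding r_def Lm by simp
      qed
      then show ?thesis
        unfolding normal_ordered_def sum_PiE_insert [OF C(3)] c_def by simp
    qed
    finally show ?thesis using True by (simp add: C_def diff_eq_eq add.commute)
  qed
qed

text \<open>Only the total of the units removed from a row counts; k and l use the same row, so
  exchanging their targets changes nothing.\<close>

lemma moved_transpose:
  assumes "finite A" "k \<in> A" "l \<in> A" "s k = s l"
  shows "moved A (\<sigma> \<circ> Transposition.transpose k l) s M = moved A \<sigma> s M"
proof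
  fix t
  let ?\<rho> = "Transposition.transpose k l"
  have s: "s (?\<rho> j) = s j" for j using assms(4) by (auto simp: Transposition.transpose_def)
  have bij: "bij_betw ?\<rho> A A"
    using assms by (intro permutes_imp_bij permutes_swap_id)
  have "(\<Sum>j\<in>A. if s j = t then unit_exponent j - unit_exponent (\<sigma> (?\<rho> j)) else 0) =
      (\<Sum>j\<in>A. if s j = t then unit_exponent j else 0) -
      (\<Sum>j\<in>A. if s (?\<rho> j) = t then unit_exponent (\<sigma> (?\<rho> j)) else 0)"
    unfolding s sum_subtractf [symmetric] by (intro sum.cong) auto
  also have "(\<Sum>j\<in>A. if s (?\<rho> j) = t then unit_exponent (\<sigma> (?\<rho> j)) else 0) =
      (\<Sum>j\<in>A. if s j = t then unit_exponent (\<sigma> j) else 0)"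
    by (rule sum.reindex_bij_betw [OF bij])
  also have "(\<Sum>j\<in>A. if s j = t then unit_exponent j else 0) - \<dots> =
      (\<Sum>j\<in>A. if s j = t then unit_exponent j - unit_exponent (\<sigma> j) else 0)"
    unfolding sum_subtractf [symmetric] by (intro sum.cong) auto
  finally show "moved A (\<sigma> \<circ> ?\<rho>) s M t = moved A \<sigma> s M t"
    unfolding moved_def o_apply by simp
qed

text \<open>With more indices than factors, every \<open>s\<close> puts two of them into one factor;
  composing with their transposition reverses the sign of the term and changes nothing else.\<close>

lemma normal_ordered_determinant:
  assumes "finite A" "m < card A"
  shows "(\<Sum>\<sigma> | \<sigma> permutes A. of_int (sign \<sigma>) * normal_ordered m A \<sigma> F M) = 0"
proof -
  define f where "f s \<sigma> = of_int (sign \<sigma>) * ((\<Prod>k\<in>A. of_int (Poly_Mapping.lookup (moved A \<sigma> s M (s k)) k)) *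
        F (moved A \<sigma> s M))" for s \<sigma>
  have "(\<Sum>\<sigma> | \<sigma> permutes A. f s \<sigma>) = 0" if s: "s \<in> A \<rightarrow>\<^sub>E {..<m}" for s
  proof -
    have "\<not> inj_on s A"
    proof
      assume "inj_on s A"
      moreover have "s ` A \<subseteq> {..<m}" using s by auto
      ultimately have "card A \<le> m" using card_inj_on_le [of s A "{..<m}"] by simp
      with assms show False by simp
    qed
    then obtain k l where kl: "k \<in> A" "l \<in> A" "k \<noteq> l" "s k = s l" unfolding inj_on_def by blast
    let ?\<rho> = "Transposition.transpose k l"
    have \<rho>: "?\<rho> permutes A" using kl by (intro permutes_swap_id)
    have flip: "f s (\<sigma> \<circ> ?\<rho>) = - f s \<sigma>" if "\<sigma> permutes A" for \<sigma>
    proof -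
      have "permutation \<sigma>" "permutation ?\<rho>"
        using that \<rho> assms(1) unfolding permutation_permutes by blast+
      then have "sign (\<sigma> \<circ> ?\<rho>) = - sign \<sigma>"
        using kl(3) by (simp add: sign_compose sign_swap_id)
      then show ?thesis
        unfolding f_def moved_transpose [OF assms(1) kl(1,2,4)] by simp
    qed
    have "(\<Sum>\<sigma> | \<sigma> permutes A. f s \<sigma>) = (\<Sum>\<sigma> | \<sigma> permutes A. f s (\<sigma> \<circ> ?\<rho>))"
      by (rule sum_permutations_compose_right [OF \<rho>])
    also have "\<dots> = - (\<Sum>\<sigma> | \<sigma> permutes A. f s \<sigma>)"
      by (simp add: flip sum_negf)
    finally have "2 * (\<Sum>\<sigma> | \<sigma> permutes A. f s \<sigma>) = 0" by (simp only: eq_neg_iff_add_eq_0 mult_2)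
    then show ?thesis by simp
  qed
  moreover have "(\<Sum>\<sigma> | \<sigma> permutes A. of_int (sign \<sigma>) * normal_ordered m A \<sigma> F M) =
      (\<Sum>s\<in>A \<rightarrow>\<^sub>E {..<m}. \<Sum>\<sigma> | \<sigma> permutes A. f s \<sigma>)"
    unfolding normal_ordered_def f_def sum_distrib_left by (rule sum.swap)
  ultimately show ?thesis by simp
qed

section \<open>Capelli's identity modulo a subspace stable under polarizations\<close>

definition polarization_stable :: "nat \<Rightarrow> nat set \<Rightarrow> (exponent_matrix \<Rightarrow> complex) set \<Rightarrow> bool" where
  "polarization_stable m R W \<longleftrightarrow> (\<lambda>_. 0) \<in> W \<and>
     (\<forall>F\<in>W. \<forall>G\<in>W. (\<lambda>M. F M + G M) \<in> W) \<and> (\<forall>F\<in>W. \<forall>c. (\<lambda>M. c * F M) \<in> W) \<and>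
     (\<forall>F\<in>W. \<forall>a\<in>R. \<forall>b\<in>R. polarization m a b F \<in> W)"

context
  fixes m R W
  assumes W: "polarization_stable m R W"
begin

lemma W_add: "F \<in> W \<Longrightarrow> G \<in> W \<Longrightarrow> (\<lambda>M. F M + G M) \<in> W"
  and W_scale: "F \<in> W \<Longrightarrow> (\<lambda>M. c * F M) \<in> W"
  and W_polarization: "F \<in> W \<Longrightarrow> a \<in> R \<Longrightarrow> b \<in> R \<Longrightarrow> polarization m a b F \<in> W"
  and W_zero: "(\<lambda>_. 0) \<in> W"
  using W unfolding polarization_stable_def by blast+

lemma W_diff: "F \<in> W \<Longrightarrow> G \<in> W \<Longrightarrow> (\<lambda>M. F M - G M) \<in> W"
  using W_add [of F "\<lambda>M. (-1) * G M"] W_scale [of G "-1"] by simp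

lemma W_sum: "(\<And>a. a \<in> A \<Longrightarrow> f a \<in> W) \<Longrightarrow> (\<lambda>M. \<Sum>a\<in>A. f a M) \<in> W"
  by (induction A rule: infinite_finite_induct) (simp_all add: W_zero W_add)

text \<open>\<open>normal_ordered_polarization\<close> is solved for its larger normally ordered
  term, which puts normally ordered products into the algebra generated by the polarizations. The
  induction runs on the size of A, and the contracted term has one index fewer.\<close>

lemma W_normal_ordered:
  assumes "finite A" "A \<subseteq> R" "\<tau> ` A \<subseteq> R" "F \<in> W"
  shows "normal_ordered m A \<tau> F \<in> W"
  using assms
proof (induction "card A" arbitrary: A \<tau> F rule: less_induct)
  case less
  show ?case
  proof (cases "A = {}")
    case True
    have "normal_ordered m {} \<tau> F = F" by (rule ext) (simp add: normal_ordered_def moved_def)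
    then show ?thesis using True less.prems(4) by simp
  next
    case False
    then obtain b where b: "b \<in> A" by blast
    define B where "B = A - {b}"
    have B: "finite B" "b \<notin> B" "A = insert b B" "card A = Suc (card B)"
      using less.prems(1) b card_Suc_Diff1 [OF less.prems(1) b] by (auto simp: B_def)
    have 1: "normal_ordered m B \<tau> (polarization m (\<tau> b) b F) \<in> W"
      using less.prems B by (intro less.hyps W_polarization) auto
    show ?thesis
    proof (cases "\<tau> b \<in> B")
      case True
      have "card (insert b (B - {\<tau> b})) < card A"
        using card_Suc_Diff1 [OF B(1) True] B by simp
      then have 2: "normal_ordered m (insert b (B - {\<tau> b})) (\<tau>(b := \<tau> (\<tau> b))) F \<in> W"
        using less.prems B True by (intro less.hyps) auto
      have "normal_ordered m A \<tau> F = (\<lambda>M. normal_ordered m B \<tau> (polarization m (\<tau> b) b F) M -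
          normal_ordered m (insert b (B - {\<tau> b})) (\<tau>(b := \<tau> (\<tau> b))) F M)"
        using normal_ordered_polarization [OF B(1,2), of m \<tau> F] True by (auto simp: B(3))
      then show ?thesis using W_diff [OF 1 2] by simp
    next
      case False
      have "normal_ordered m A \<tau> F = normal_ordered m B \<tau> (polarization m (\<tau> b) b F)"
        using normal_ordered_polarization [OF B(1,2), of m \<tau> F] False by (auto simp: B(3))
      then show ?thesis using 1 by simp
    qed
  qed
qed

text \<open>Splitting off the polarization of the largest moved index, a raising operator that acts
  on z first and lands in W, leaves only the contraction. Its minus sign is matched by the change of
  sign of the permutation, so all scalars stay nonnegative and cannot cancel in the
  determinant.\<close>

lemma permutation_congruence:
  assumes "finite A" "A \<subseteq> R" "\<sigma> permutes A"
    and raise: "\<And>a b. a \<in> A \<Longrightarrow> b \<in> A \<Longrightarrow> a < b \<Longrightarrow> polarization m a b z \<in> W"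
    and weight: "\<And>k. k \<in> A \<Longrightarrow> polarization m k k z = (\<lambda>M. of_real (l k) * z M)"
    and pos: "\<And>k. k \<in> A \<Longrightarrow> 0 < l k"
  shows "\<exists>c\<ge>0. (\<sigma> = id \<longrightarrow> c > 0) \<and>
    (\<lambda>M. of_int (sign \<sigma>) * normal_ordered m A \<sigma> z M - of_real c * z M) \<in> W"
  using assms
proof (induction "card A" arbitrary: A \<sigma> rule: less_induct)
  case less
  show ?case
  proof (cases "\<sigma> = id")
    case True
    \<comment> \<open>For the identity \<tau> b = b is never in B, so no contraction occurs and the
      weights multiply.\<close>
    have "normal_ordered m A id z M = of_real (\<Prod>k\<in>A. l k) * z M" for M
      using less.prems(1,5)
    proof (induction A arbitrary: M rule: finite_induct)
      case empty
      then show ?case by (simp add: normal_ordered_def moved_def)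
    next
      case (insert b B)
      have "normal_ordered m (insert b B) id z M = normal_ordered m B id (polarization m b b z) M"
        using normal_ordered_polarization [OF insert.hyps, of m id z M] insert.hyps(2) by simp
      also have "\<dots> = of_real (l b) * normal_ordered m B id z M"
        using insert.prems [of b] by (simp add: normal_ordered_def sum_distrib_left mult.left_commute)
      also have "normal_ordered m B id z M = of_real (\<Prod>k\<in>B. l k) * z M"
        using insert.prems by (intro insert.IH) auto
      finally show ?case using insert.hyps by (simp add: mult.assoc)
    qed
    moreover have "(\<Prod>k\<in>A. l k) > 0" using less.prems(6) by (rule prod_pos)
    ultimately show ?thesis
      using True W_zero by (intro exI [of _ "\<Prod>k\<in>A. l k"]) (simp add: order_less_imp_le)
  next
    case False
    define D where "D = {k \<in> A. \<sigma> k \<noteq> k}"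
    have "D \<noteq> {}"
    proof
      assume "D = {}"
      then have "\<sigma> k = k" for k using less.prems(3) unfolding D_def permutes_def by blast
      with False show False by (auto simp: fun_eq_iff)
    qed
    have finD: "finite D" using less.prems(1) by (simp add: D_def)
    \<comment> \<open>The image a of the largest moved index is again a moved index, hence smaller;
      so the polarization from b to a is a raising operator.\<close>
    define b where "b = Max D"
    define a where "a = \<sigma> b"
    have bD: "b \<in> D" unfolding b_def by (rule Max_in [OF finD \<open>D \<noteq> {}\<close>])
    have inj: "inj \<sigma>" by (rule permutes_inj [OF less.prems(3)])
    have bA: "b \<in> A" "a \<noteq> b" "a \<in> A"
      using bD permutes_in_image [OF less.prems(3), of b] by (auto simp: D_def a_def)
    have "a \<in> D" using bA inj unfolding D_def a_def by (auto dest: injD)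
    then have ab: "a < b" using Max_ge [OF finD, of a] bA(2) unfolding b_def by simp
    define B where "B = A - {b}"
    have B: "finite B" "b \<notin> B" "A = insert b B" "a \<in> B"
      using less.prems(1) bA by (auto simp: B_def)
    \<comment> \<open>This cuts a out of its cycle: \<open>\<sigma>'\<close> fixes a and sends b to
      \<sigma> a, which on A without a is the contracted map of
      \<open>normal_ordered_polarization\<close>.\<close>
    define \<sigma>' where "\<sigma>' = \<sigma> \<circ> Transposition.transpose a b"
    have \<sigma>'a: "\<sigma>' a = a" by (simp add: \<sigma>'_def a_def)
    have p\<sigma>': "\<sigma>' permutes A"
      unfolding \<sigma>'_def by (rule permutes_compose [OF permutes_swap_id [OF bA(3,1)] less.prems(3)])
    have p': "\<sigma>' permutes (A - {a})"
      using \<sigma>'a by (intro permutes_superset [OF p\<sigma>']) auto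
    have "permutation \<sigma>" "permutation (Transposition.transpose a b)"
      using less.prems(1,3) permutes_swap_id [OF bA(3,1)] unfolding permutation_permutes by blast+
    then have sg: "sign \<sigma>' = - sign \<sigma>"
      using bA(2) by (simp add: \<sigma>'_def sign_compose sign_swap_id)
    have "card (A - {a}) < card A" using less.prems(1) bA(3) by (rule card_Diff1_less)
    then obtain c where c: "c \<ge> 0"
      "(\<lambda>M. of_int (sign \<sigma>') * normal_ordered m (A - {a}) \<sigma>' z M - of_real c * z M) \<in> W"
      using less.hyps [of "A - {a}" \<sigma>', OF _ _ _ p'] less.prems by auto
    have eq: "insert b (B - {a}) = A - {a}" using B bA by auto
    have "normal_ordered m (A - {a}) (\<sigma>(b := \<sigma> a)) z = normal_ordered m (A - {a}) \<sigma>' z"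
      by (intro normal_ordered_cong) (auto simp: \<sigma>'_def Transposition.transpose_def)
    then have main: "normal_ordered m A \<sigma> z M =
        normal_ordered m B \<sigma> (polarization m a b z) M - normal_ordered m (A - {a}) \<sigma>' z M" for M
      using normal_ordered_polarization [OF B(1,2), of m \<sigma> z M] B(4)
      unfolding eq a_def [symmetric] B(3) [symmetric] by simp
    have "normal_ordered m B \<sigma> (polarization m a b z) \<in> W"
    proof (rule W_normal_ordered [OF B(1)])
      show "B \<subseteq> R" "\<sigma> ` B \<subseteq> R"
        using less.prems(2) permutes_image [OF less.prems(3)] unfolding B_def by blast+
      show "polarization m a b z \<in> W" using less.prems(4) bA ab by blast
    qed
    from W_add [OF W_scale [OF this, of "of_int (sign \<sigma>)"] c(2)]
    have "(\<lambda>M. of_int (sign \<sigma>) * normal_ordered m A \<sigma> z M - of_real c * z M) \<in> W"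
      by (simp add: main sg algebra_simps)
    then show ?thesis using c(1) False by blast
  qed
qed

text \<open>
  The normally ordered determinant of the polarizations vanishes when it has more rows than there
  are factors. Expanding it modulo the left ideal of raising operators gives a positive multiple
  of the identity on the weight space (Capelli's identity).
\<close>

lemma capelli:
  assumes "finite A" "A \<subseteq> R" "m < card A"
    and raise: "\<And>a b. a \<in> A \<Longrightarrow> b \<in> A \<Longrightarrow> a < b \<Longrightarrow> polarization m a b z \<in> W"
    and weight: "\<And>k. k \<in> A \<Longrightarrow> polarization m k k z = (\<lambda>M. of_real (l k) * z M)"
    and pos: "\<And>k. k \<in> A \<Longrightarrow> 0 < l k"
  shows "z \<in> W"
proof -
  let ?P = "{\<sigma>. \<sigma> permutes A}"
  have "\<forall>\<sigma>\<in>?P. \<exists>c\<ge>0. (\<sigma> = id \<longrightarrow> c > 0) \<and>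
    (\<lambda>M. of_int (sign \<sigma>) * normal_ordered m A \<sigma> z M - of_real c * z M) \<in> W"
    using permutation_congruence [OF assms(1,2) _ raise weight pos] by blast
  from bchoice [OF this] obtain c where "\<forall>\<sigma>\<in>?P. c \<sigma> \<ge> 0 \<and> (\<sigma> = id \<longrightarrow> c \<sigma> > 0) \<and>
    (\<lambda>M. of_int (sign \<sigma>) * normal_ordered m A \<sigma> z M - of_real (c \<sigma>) * z M) \<in> W" ..
  then have c: "c \<sigma> \<ge> 0" "\<sigma> = id \<Longrightarrow> c \<sigma> > 0"
    "(\<lambda>M. of_int (sign \<sigma>) * normal_ordered m A \<sigma> z M - of_real (c \<sigma>) * z M) \<in> W"
    if "\<sigma> \<in> ?P" for \<sigma> using that by blast+
  have fin: "finite ?P" using assms(1) by (rule finite_permutations)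
  have id: "id \<in> ?P" by (simp add: permutes_id)
  define S where "S = (\<Sum>\<sigma>\<in>?P. c \<sigma>)"
  have "S > 0" unfolding S_def using c(1,2) id fin by (intro sum_pos2 [of _ id]) auto
  have "(\<lambda>M. \<Sum>\<sigma>\<in>?P. of_int (sign \<sigma>) * normal_ordered m A \<sigma> z M - of_real (c \<sigma>) * z M) \<in> W"
    by (rule W_sum) (rule c(3))
  also have "(\<lambda>M. \<Sum>\<sigma>\<in>?P. of_int (sign \<sigma>) * normal_ordered m A \<sigma> z M - of_real (c \<sigma>) * z M) =
      (\<lambda>M. - (of_real S * z M))"
    using normal_ordered_determinant [OF assms(1,3)]
    by (simp add: sum_subtractf S_def sum_distrib_right)
  finally have "(\<lambda>M. (- 1 / of_real S) * (- (of_real S * z M))) \<in> W" by (rule W_scale)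
  then show ?thesis using \<open>S > 0\<close> by simp
qed

text \<open>Move a unit from b to a and back. The normally ordered part of this product
  differentiates by y_a, which does not occur in z, so only the contraction survives, and it is the
  weight operator of b. Hence l times z lies in W.\<close>

lemma two_row_reflection:
  assumes "a \<in> R" "b \<in> R" "a \<noteq> b" "polarization m a b z \<in> W"
    and zero: "\<And>M s. s < m \<Longrightarrow> z M \<noteq> 0 \<Longrightarrow> Poly_Mapping.lookup (M s) a = 0"
    and weight: "polarization m b b z = (\<lambda>M. l * z M)" and "l \<noteq> 0"
  shows "z \<in> W"
proof -
  define \<tau> where "\<tau> = (\<lambda>k. if k = a then b else a)"
  have 1: "normal_ordered m {b, a} \<tau> z M = 0" for M
    unfolding normal_ordered_def
  proof (intro sum.neutral ballI)
    fix s assume s: "s \<in> {b, a} \<rightarrow>\<^sub>E {..<m}"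
    let ?X = "moved {b, a} \<tau> s M"
    show "(\<Prod>k\<in>{b, a}. of_int (Poly_Mapping.lookup (?X (s k)) k)) * z ?X = 0"
    proof (cases "z ?X = 0")
      case False
      have "Poly_Mapping.lookup (?X (s a)) a = 0" using s False by (intro zero) auto
      then show ?thesis using assms(3) by simp
    qed simp
  qed
  have 2: "normal_ordered m {a} \<tau> (polarization m a b z) \<in> W"
    using assms by (intro W_normal_ordered) (auto simp: \<tau>_def)
  have 3: "normal_ordered m {a} \<tau> (polarization m a b z) M =
      normal_ordered m {b, a} \<tau> z M + normal_ordered m {b} (\<tau>(b := b)) z M" for M
    using normal_ordered_polarization [of "{a}" b m \<tau> z M] assms(3) by (simp add: \<tau>_def)
  have 4: "normal_ordered m {b} (\<tau>(b := b)) z M = l * z M" for M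
    using normal_ordered_polarization [of "{}" b m "\<tau>(b := b)" z M] weight
    by (simp add: normal_ordered_def [of _ "{}"] moved_def)
  have "normal_ordered m {a} \<tau> (polarization m a b z) = (\<lambda>M. l * z M)"
    by (rule ext) (simp only: 1 3 4 add_0)
  with 2 have "(\<lambda>M. l * z M) \<in> W" by simp
  from W_scale [OF this, of "1 / l"] show ?thesis using \<open>l \<noteq> 0\<close> by simp
qed

end

section \<open>The Koszul complex of a Veronese embedding by weights\<close>

lemma exponents_add: "a \<in> exponents n k \<Longrightarrow> b \<in> exponents n l \<Longrightarrow> a + b \<in> exponents n (k + l)"
  using keys_add [of a b] by (auto simp: exponents_def lookup_add sum.distrib)

lemma exponents_nonneg: "a \<in> exponents n k \<Longrightarrow> 0 \<le> Poly_Mapping.lookup a j"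
  by (simp add: exponents_def)

lemma exponents_le:
  assumes "a \<in> exponents n k"
  shows "Poly_Mapping.lookup a j \<le> k"
proof (cases "j \<le> n")
  case True
  then have "Poly_Mapping.lookup a j \<le> (\<Sum>i\<le>n. Poly_Mapping.lookup a i)"
    using assms by (intro member_le_sum) (auto simp: exponents_def)
  then show ?thesis using assms by (simp add: exponents_def)
next
  case False
  then have "Poly_Mapping.lookup a j = 0" using assms by (auto simp: exponents_def in_keys_iff)
  moreover have "0 \<le> k" using assms by (auto simp: exponents_def intro!: sum_nonneg)
  ultimately show ?thesis by simp
qed

lemma exponents_iff:
  "a \<in> exponents n k \<longleftrightarrow> (\<forall>j>n. Poly_Mapping.lookup a j = 0) \<and> (\<forall>j. 0 \<le> Poly_Mapping.lookup a j) \<and>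
     (\<Sum>j\<le>n. Poly_Mapping.lookup a j) = k"
  unfolding exponents_def by (auto simp: subset_iff in_keys_iff) (meson leI)

lemma finite_exponents: "finite (exponents n k)"
proof -
  let ?f = "\<lambda>a. restrict (Poly_Mapping.lookup a) {..n}"
  have "?f ` exponents n k \<subseteq> {..n} \<rightarrow>\<^sub>E {0..k}"
  proof (intro image_subsetI PiE_I)
    fix a j assume "a \<in> exponents n k" "j \<in> {..n}"
    then show "?f a j \<in> {0..k}"
      using exponents_nonneg [of a n k j] exponents_le [of a n k j] by simp
  qed simp
  then have "finite (?f ` exponents n k)"
    by (rule finite_subset) (simp add: finite_PiE)
  moreover have "inj_on ?f (exponents n k)"
  proof (rule inj_onI, rule poly_mapping_eqI)
    fix a b j assume "a \<in> exponents n k" "b \<in> exponents n k" "?f a = ?f b"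
    then show "Poly_Mapping.lookup a j = Poly_Mapping.lookup b j"
      by (cases "j \<le> n") (auto simp: exponents_iff dest: fun_cong [of _ _ j])
  qed
  ultimately show ?thesis by (rule finite_imageD)
qed

lemma exponents_shift:
  assumes "a \<in> exponents n k" "p \<le> n" "q \<le> n" "p \<noteq> q \<Longrightarrow> 1 \<le> Poly_Mapping.lookup a q"
  shows "a + unit_exponent p - unit_exponent q \<in> exponents n k"
proof -
  have "(\<Sum>j\<le>n. Poly_Mapping.lookup (unit_exponent r) j) = (1::int)" if "r \<le> n" for r
    using that by (simp add: lookup_single when_def)
  with assms show ?thesis
    by (auto simp: exponents_iff lookup_add lookup_minus sum.distrib sum_subtractf lookup_single when_def)
qed

lemma sum_list_exponents:
  "set L \<subseteq> exponents n k \<Longrightarrow> sum_list L \<in> exponents n (int (length L) * k)"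
proof (induction L)
  case Nil
  then show ?case by (simp add: exponents_iff)
next
  case (Cons b L)
  moreover have "int (length (b # L)) * k = k + int (length L) * k"
    by (simp add: algebra_simps)
  ultimately show ?case using exponents_add [of b n k "sum_list L"] by simp
qed

text \<open>Multiplying x^\<gamma> by x^b while b leaves the list keeps the weight, so the stored
  number does not change: within one weight every variable acts as the identity.\<close>

abbreviation weight_d :: "nat \<Rightarrow> int \<Rightarrow> ((nat \<Rightarrow>\<^sub>0 int) list \<Rightarrow> complex) \<Rightarrow> (nat \<Rightarrow>\<^sub>0 int) list \<Rightarrow> complex" where
  "weight_d n d \<equiv> koszul_d (\<lambda>_ x. x) (exponents n d)"

text \<open>
  The weight \<open>\<alpha>\<close> part of \<open>\<Lambda>\<^sup>i S\<^sup>dV \<otimes> S\<^sup>kV\<close>: the coefficient of \<open>b\<^sub>1 \<and> \<dots> \<and> b\<^sub>i \<otimes> x\<^sup>\<gamma>\<close> is stored at the list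
  \<open>b\<^sub>1, \<dots>, b\<^sub>i\<close> alone, since \<open>\<gamma> = \<alpha> - b\<^sub>1 - \<dots> - b\<^sub>i\<close>.
\<close>

definition weight_chain ::
    "nat \<Rightarrow> int \<Rightarrow> (nat \<Rightarrow>\<^sub>0 int) \<Rightarrow> nat \<Rightarrow> ((nat \<Rightarrow>\<^sub>0 int) list \<Rightarrow> complex) \<Rightarrow> bool" where
  "weight_chain n d \<alpha> i a \<longleftrightarrow> alternating a \<and>
     (\<forall>L. a L \<noteq> 0 \<longrightarrow> length L = i \<and> set L \<subseteq> exponents n d \<and>
        (\<forall>k. 0 \<le> Poly_Mapping.lookup (\<alpha> - sum_list L) k))"

definition weight_vanishes :: "nat \<Rightarrow> int \<Rightarrow> (nat \<Rightarrow>\<^sub>0 int) \<Rightarrow> nat \<Rightarrow> bool" where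
  "weight_vanishes n d \<alpha> i \<longleftrightarrow> (\<forall>a. weight_chain n d \<alpha> i a \<and> (\<forall>L. weight_d n d a L = 0) \<longrightarrow>
     (\<exists>a'. weight_chain n d \<alpha> (Suc i) a' \<and> weight_d n d a' = a))"

lemma weight_vanishesI:
  assumes "\<And>a. weight_chain n d \<alpha> i a \<Longrightarrow> (\<And>L. weight_d n d a L = 0) \<Longrightarrow>
    \<exists>a'. weight_chain n d \<alpha> (Suc i) a' \<and> weight_d n d a' = a"
  shows "weight_vanishes n d \<alpha> i"
  using assms unfolding weight_vanishes_def by simp

lemma weight_vanishesE:
  assumes "weight_vanishes n d \<alpha> i" "weight_chain n d \<alpha> i a" "\<And>L. weight_d n d a L = 0"
  obtains a' where "weight_chain n d \<alpha> (Suc i) a'" "weight_d n d a' = a"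
  using assms unfolding weight_vanishes_def by (elim allE [of _ a]) auto

lemma weight_chainD:
  assumes "weight_chain n d \<alpha> i a"
  shows "alternating a" "a L \<noteq> 0 \<Longrightarrow> length L = i" "a L \<noteq> 0 \<Longrightarrow> set L \<subseteq> exponents n d"
    "a L \<noteq> 0 \<Longrightarrow> 0 \<le> Poly_Mapping.lookup (\<alpha> - sum_list L) k"
  using assms unfolding weight_chain_def by blast+

lemma weight_d_support:
  assumes "weight_chain n d \<alpha> (Suc i) a" "weight_d n d a L \<noteq> 0"
  shows "length L = i" "set L \<subseteq> exponents n d"
proof -
  obtain v where "a (v # L) \<noteq> 0"
    using assms(2) unfolding koszul_d_def by (meson sum.not_neutral_contains_not_neutral)
  then have "length (v # L) = Suc i" "set (v # L) \<subseteq> exponents n d"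
    using weight_chainD(2,3) [OF assms(1)] by blast+
  then show "length L = i" "set L \<subseteq> exponents n d" by auto
qed

section \<open>Polarizations on the weight complex\<close>

fun list_polarization ::
    "nat \<Rightarrow> nat \<Rightarrow> ((nat \<Rightarrow>\<^sub>0 int) list \<Rightarrow> complex) \<Rightarrow> (nat \<Rightarrow>\<^sub>0 int) list \<Rightarrow> complex" where
  "list_polarization p q a [] = 0"
| "list_polarization p q a (u # L) =
     of_int (Poly_Mapping.lookup (u + (unit_exponent q - unit_exponent p)) q) *
       a ((u + (unit_exponent q - unit_exponent p)) # L) +
     list_polarization p q (\<lambda>xs. a (u # xs)) L"

text \<open>The first term is the action on the symmetric factor. The result has weight \<alpha> +
  e_p - e_q, so \<alpha> - \<open>sum_list L\<close> is the exponent of that factor before the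
  move.\<close>

definition weight_polarization ::
    "(nat \<Rightarrow>\<^sub>0 int) \<Rightarrow> nat \<Rightarrow> nat \<Rightarrow> ((nat \<Rightarrow>\<^sub>0 int) list \<Rightarrow> complex) \<Rightarrow> (nat \<Rightarrow>\<^sub>0 int) list \<Rightarrow> complex" where
  "weight_polarization \<alpha> p q a L =
     of_int (Poly_Mapping.lookup (\<alpha> - sum_list L) q) * a L + list_polarization p q a L"

lemma list_polarization_minus: "list_polarization p q (\<lambda>L. - a L) L = - list_polarization p q a L"
  by (induction L arbitrary: a) simp_all

lemma list_polarization_zero: "list_polarization p q (\<lambda>L. 0) L = 0"
  by (induction L) simp_all

lemma list_polarization_add:
  "list_polarization p q (\<lambda>L. a L + b L) L = list_polarization p q a L + list_polarization p q b L"
  by (induction L arbitrary: a b) (simp_all add: algebra_simps)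

lemma list_polarization_sum:
  "list_polarization p q (\<lambda>L. \<Sum>x\<in>A. f x L) L = (\<Sum>x\<in>A. list_polarization p q (f x) L)"
  by (induction A rule: infinite_finite_induct)
    (simp_all add: list_polarization_zero list_polarization_add)

lemma list_polarization_nth:
  "list_polarization p q a L =
     (\<Sum>s<length L. of_int (Poly_Mapping.lookup (L ! s + (unit_exponent q - unit_exponent p)) q) *
        a (L[s := L ! s + (unit_exponent q - unit_exponent p)]))"
  by (induction L arbitrary: a) (simp_all add: sum.lessThan_Suc_shift del: sum.lessThan_Suc)

lemma list_polarization_alternating:
  assumes "alternating a"
  shows "alternating (list_polarization p q a)"
proof -
  have "list_polarization p q a (xs @ u # v # ys) = - list_polarization p q a (xs @ v # u # ys)"
    if "alternating a" for xs u v ys a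
    using that
  proof (induction xs arbitrary: a)
    case Nil
    let ?\<eta> = "unit_exponent q - unit_exponent p"
    have "list_polarization p q (\<lambda>L. a (u # v # L)) ys = - list_polarization p q (\<lambda>L. a (v # u # L)) ys"
      unfolding alternating_swap [OF Nil, of u v] by (rule list_polarization_minus)
    moreover have "a ((u + ?\<eta>) # v # ys) = - a (v # (u + ?\<eta>) # ys)"
      "a (u # (v + ?\<eta>) # ys) = - a ((v + ?\<eta>) # u # ys)"
      by (rule alternating_swap [OF Nil])+
    ultimately show ?case by (simp add: algebra_simps)
  next
    case (Cons b xs)
    let ?b = "b + (unit_exponent q - unit_exponent p)"
    have "a (?b # xs @ u # v # ys) = - a (?b # xs @ v # u # ys)"
      using alternating_Cons [OF Cons.prems, of ?b] unfolding alternating_def by (elim allE)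
    moreover note Cons.IH [OF alternating_Cons [OF Cons.prems, of b]]
    ultimately show ?case by simp
  qed
  with assms show ?thesis unfolding alternating_def by blast
qed

lemma list_polarization_support:
  assumes "list_polarization p q a L \<noteq> 0"
  shows "\<exists>xs u ys. L = xs @ u # ys \<and>
    Poly_Mapping.lookup (u + (unit_exponent q - unit_exponent p)) q \<noteq> 0 \<and>
    a (xs @ (u + (unit_exponent q - unit_exponent p)) # ys) \<noteq> 0"
  using assms
proof (induction L arbitrary: a)
  case (Cons b L)
  let ?b = "b + (unit_exponent q - unit_exponent p)"
  show ?case
  proof (cases "list_polarization p q (\<lambda>xs. a (b # xs)) L = 0")
    case True
    then have "Poly_Mapping.lookup ?b q \<noteq> 0 \<and> a ([] @ ?b # L) \<noteq> 0" using Cons.prems by simp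
    then show ?thesis by (metis append_Nil)
  next
    case False
    from Cons.IH [OF this] obtain xs u ys where "L = xs @ u # ys"
      "Poly_Mapping.lookup (u + (unit_exponent q - unit_exponent p)) q \<noteq> 0"
      "a ((b # xs) @ (u + (unit_exponent q - unit_exponent p)) # ys) \<noteq> 0" by auto
    then show ?thesis by (metis append_Cons)
  qed
qed simp

lemma sum_list_swap: "sum_list (xs @ u # v # ys) = sum_list (xs @ v # u # (ys :: 'a::comm_monoid_add list))"
  by (simp add: algebra_simps)

text \<open>Differentiating by x_q a monomial without x_q gives coefficient 0, so no negative
  exponent can arise.\<close>

lemma weight_chain_polarization:
  assumes a: "weight_chain n d \<alpha> i a" and pq: "p \<le> n" "q \<le> n"
  shows "weight_chain n d (\<alpha> + unit_exponent p - unit_exponent q) i (weight_polarization \<alpha> p q a)"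
  unfolding weight_chain_def
proof (intro conjI allI impI)
  let ?\<eta> = "unit_exponent q - unit_exponent p" and ?\<alpha>' = "\<alpha> + unit_exponent p - unit_exponent q"
  note A = weight_chainD [OF a]
  show "alternating (weight_polarization \<alpha> p q a)"
    unfolding alternating_def
  proof (intro allI)
    fix xs u v ys
    have "a (xs @ u # v # ys) = - a (xs @ v # u # ys)"
      "list_polarization p q a (xs @ u # v # ys) = - list_polarization p q a (xs @ v # u # ys)"
      using A(1) list_polarization_alternating [OF A(1), of p q] unfolding alternating_def by blast+
    then show "weight_polarization \<alpha> p q a (xs @ u # v # ys) = - weight_polarization \<alpha> p q a (xs @ v # u # ys)"
      unfolding weight_polarization_def sum_list_swap [of xs u v ys] by simp
  qed
  fix L assume nz: "weight_polarization \<alpha> p q a L \<noteq> 0"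
  show "length L = i" and "set L \<subseteq> exponents n d" and "0 \<le> Poly_Mapping.lookup (?\<alpha>' - sum_list L) k" for k
  proof -
    have "length L = i \<and> set L \<subseteq> exponents n d \<and> (\<forall>k. 0 \<le> Poly_Mapping.lookup (?\<alpha>' - sum_list L) k)"
    proof (cases "list_polarization p q a L = 0")
      case True
      then have aL: "a L \<noteq> 0" and q: "Poly_Mapping.lookup (\<alpha> - sum_list L) q \<noteq> 0"
        using nz by (auto simp: weight_polarization_def)
      have eq: "?\<alpha>' - sum_list L = (\<alpha> - sum_list L) + (unit_exponent p - unit_exponent q)"
        by (simp add: algebra_simps)
      have "0 \<le> Poly_Mapping.lookup (?\<alpha>' - sum_list L) k" for k
        using A(4) [OF aL, of k] A(4) [OF aL, of q] q
        unfolding eq lookup_add [of "\<alpha> - sum_list L"] lookup_minus [of "unit_exponent p"]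
        by (auto simp: lookup_single when_def)
      then show ?thesis using A(2,3) [OF aL] by blast
    next
      case False
      then obtain xs u ys where L: "L = xs @ u # ys" and q: "Poly_Mapping.lookup (u + ?\<eta>) q \<noteq> 0"
        and aL: "a (xs @ (u + ?\<eta>) # ys) \<noteq> 0"
        using list_polarization_support [of p q a L] by blast
      have u': "u + ?\<eta> \<in> exponents n d" and rest: "set xs \<subseteq> exponents n d" "set ys \<subseteq> exponents n d"
        using A(3) [OF aL] by auto
      have "1 \<le> Poly_Mapping.lookup (u + ?\<eta>) q" using exponents_nonneg [OF u', of q] q by simp
      then have "(u + ?\<eta>) + unit_exponent p - unit_exponent q \<in> exponents n d"
        using exponents_shift [OF u' pq] by blast
      then have "u \<in> exponents n d" by (simp add: algebra_simps)
      moreover have eq: "?\<alpha>' - sum_list L = \<alpha> - sum_list (xs @ (u + ?\<eta>) # ys)"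
        unfolding L by (simp add: algebra_simps)
      have "0 \<le> Poly_Mapping.lookup (?\<alpha>' - sum_list L) k" for k
        unfolding eq by (rule A(4) [OF aL])
      ultimately show ?thesis using A(2) [OF aL] L rest by auto
    qed
    then show "length L = i" "set L \<subseteq> exponents n d" "0 \<le> Poly_Mapping.lookup (?\<alpha>' - sum_list L) k" for k
      by blast+
  qed
qed

text \<open>Polarizations are derivations, and the differential multiplies an exterior factor x^b
  into x^\<gamma>; hence they commute. Shifting the summation index leaves the set of monomials of
  degree d, but only where the chain or the coefficient is 0.\<close>

lemma weight_d_polarization:
  assumes a: "weight_chain n d \<alpha> i a" and pq: "p \<le> n" "q \<le> n"
  shows "weight_d n d (weight_polarization \<alpha> p q a) L = weight_polarization \<alpha> p q (weight_d n d a) L"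
proof -
  let ?V = "exponents n d" and ?\<eta> = "unit_exponent q - unit_exponent p"
  define g where "g b = of_int (Poly_Mapping.lookup b q) * a (b # L)" for b
  have "(\<Sum>b\<in>?V. g (b + ?\<eta>)) = (\<Sum>b\<in>(\<lambda>b. b + ?\<eta>) ` ?V. g b)"
    by (subst sum.reindex) (auto simp: inj_on_def)
  also have "\<dots> = (\<Sum>b\<in>(\<lambda>b. b + ?\<eta>) ` ?V \<inter> ?V. g b)"
  proof (rule sum.mono_neutral_right)
    show "\<forall>b\<in>(\<lambda>b. b + ?\<eta>) ` ?V - (\<lambda>b. b + ?\<eta>) ` ?V \<inter> ?V. g b = 0"
    proof
      fix b assume "b \<in> (\<lambda>b. b + ?\<eta>) ` ?V - (\<lambda>b. b + ?\<eta>) ` ?V \<inter> ?V"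
      then have "b \<notin> ?V" by blast
      then have "a (b # L) = 0" using weight_chainD(3) [OF a, of "b # L"] by auto
      then show "g b = 0" by (simp add: g_def)
    qed
  qed (simp_all add: finite_exponents)
  also have "\<dots> = (\<Sum>b\<in>?V. g b)"
  proof (rule sum.mono_neutral_left)
    show "\<forall>b\<in>?V - (\<lambda>b. b + ?\<eta>) ` ?V \<inter> ?V. g b = 0"
    proof
      fix b assume b: "b \<in> ?V - (\<lambda>b. b + ?\<eta>) ` ?V \<inter> ?V"
      \<comment> \<open>A monomial involving x_q is the shift of one in ?V, obtained by trading x_q
        for x_p. So the b that are not reached do not involve x_q and have coefficient 0.\<close>
      have "\<not> 1 \<le> Poly_Mapping.lookup b q"
      proof
        assume "1 \<le> Poly_Mapping.lookup b q"
        then have "b + unit_exponent p - unit_exponent q \<in> ?V"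
          using b by (intro exponents_shift [OF _ pq]) auto
        moreover have "b = (b + unit_exponent p - unit_exponent q) + ?\<eta>" by simp
        ultimately show False using b by blast
      qed
      then have "Poly_Mapping.lookup b q = 0" using exponents_nonneg [of b n d q] b by force
      then show "g b = 0" by (simp add: g_def)
    qed
  qed (simp_all add: finite_exponents)
  finally have shift: "(\<Sum>b\<in>?V. g (b + ?\<eta>)) = (\<Sum>b\<in>?V. g b)" .
  have "weight_d n d (weight_polarization \<alpha> p q a) L =
      (\<Sum>b\<in>?V. of_int (Poly_Mapping.lookup (\<alpha> - sum_list (b # L)) q) * a (b # L) + g (b + ?\<eta>)
        + list_polarization p q (\<lambda>xs. a (b # xs)) L)"
    unfolding koszul_d_def weight_polarization_def g_def by (simp add: add.assoc)
  also have "\<dots> = (\<Sum>b\<in>?V. of_int (Poly_Mapping.lookup (\<alpha> - sum_list (b # L)) q) * a (b # L) + g b)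
        + (\<Sum>b\<in>?V. list_polarization p q (\<lambda>xs. a (b # xs)) L)"
    by (simp add: sum.distrib shift)
  \<comment> \<open>The exponents of x_q in x^b and in the remaining symmetric factor add up to the
    exponent in their product.\<close>
  also have "(\<Sum>b\<in>?V. of_int (Poly_Mapping.lookup (\<alpha> - sum_list (b # L)) q) * a (b # L) + g b) =
      of_int (Poly_Mapping.lookup (\<alpha> - sum_list L) q) * weight_d n d a L"
    unfolding koszul_d_def g_def sum_distrib_left
    by (intro sum.cong refl) (simp add: lookup_minus lookup_add algebra_simps)
  also have "(\<Sum>b\<in>?V. list_polarization p q (\<lambda>xs. a (b # xs)) L) = list_polarization p q (weight_d n d a) L"
    unfolding koszul_d_def by (rule list_polarization_sum [symmetric])
  finally show ?thesis unfolding weight_polarization_def .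
qed

text \<open>Rows 0, ..., i - 1 are the exterior factors, and row i is the symmetric factor,
  determined by the weight. This embeds the weight space into a tensor product of i + 1 symmetric
  powers, to which the Capelli determinant applies.\<close>

definition matrix_form ::
    "nat \<Rightarrow> (nat \<Rightarrow>\<^sub>0 int) \<Rightarrow> ((nat \<Rightarrow>\<^sub>0 int) list \<Rightarrow> complex) \<Rightarrow> exponent_matrix \<Rightarrow> complex" where
  "matrix_form i \<alpha> a M = (if (\<Sum>s<Suc i. M s) = \<alpha> then a (map M [0..<i]) else 0)"

lemma sum_fun_upd:
  fixes M :: "nat \<Rightarrow> 'a::comm_monoid_add"
  shows "s < m \<Longrightarrow> (\<Sum>t<m. (M(s := M s + x)) t) = (\<Sum>t<m. M t) + x"
proof -
  assume s: "s < m"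
  have "(\<Sum>t\<in>{..<m} - {s}. (M(s := M s + x)) t) = (\<Sum>t\<in>{..<m} - {s}. M t)"
    by (intro sum.cong) auto
  moreover have "(\<Sum>t<m. (M(s := M s + x)) t) = M s + x + (\<Sum>t\<in>{..<m} - {s}. (M(s := M s + x)) t)"
    using sum.remove [of "{..<m}" s "M(s := M s + x)"] s by simp
  moreover have "(\<Sum>t<m. M t) = M s + (\<Sum>t\<in>{..<m} - {s}. M t)"
    using sum.remove [of "{..<m}" s M] s by simp
  ultimately show ?thesis by (simp only: ac_simps)
qed

lemma polarization_matrix_form:
  "polarization (Suc i) p q (matrix_form i \<alpha> a) =
     matrix_form i (\<alpha> + unit_exponent p - unit_exponent q) (weight_polarization \<alpha> p q a)"
proof
  fix M :: exponent_matrix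
  let ?\<eta> = "unit_exponent q - unit_exponent p" and ?L = "map M [0..<i]"
  let ?c = "\<lambda>s. of_int (Poly_Mapping.lookup (M s + ?\<eta>) q) :: complex"
  have sum: "(\<Sum>t<Suc i. (M(s := M s + ?\<eta>)) t) = (\<Sum>t<Suc i. M t) + ?\<eta>" if "s < Suc i" for s
    using that by (rule sum_fun_upd)
  have weight: "(\<Sum>t<Suc i. M t) + ?\<eta> = \<alpha> \<longleftrightarrow> (\<Sum>t<Suc i. M t) = \<alpha> + unit_exponent p - unit_exponent q"
    by (auto simp: algebra_simps)
  have unfold: "polarization (Suc i) p q (matrix_form i \<alpha> a) M =
      (\<Sum>s<Suc i. ?c s * (if (\<Sum>t<Suc i. M t) = \<alpha> + unit_exponent p - unit_exponent q
         then a (map (M(s := M s + ?\<eta>)) [0..<i]) else 0))"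
    unfolding polarization_def matrix_form_def
    by (intro sum.cong refl) (simp only: sum weight lessThan_iff)
  show "polarization (Suc i) p q (matrix_form i \<alpha> a) M =
     matrix_form i (\<alpha> + unit_exponent p - unit_exponent q) (weight_polarization \<alpha> p q a) M"
  proof (cases "(\<Sum>t<Suc i. M t) = \<alpha> + unit_exponent p - unit_exponent q")
    case False
    then show ?thesis unfolding unfold matrix_form_def by simp
  next
    case True
    have sl: "sum_list ?L = (\<Sum>t<i. M t)" by (simp add: interv_sum_list_conv_sum_set_nat atLeast0LessThan)
    \<comment> \<open>The summand s = i leaves the list unchanged, and its coefficient is the
      exponent of x_q in the symmetric factor before the move.\<close>
    have "M i + ?\<eta> = \<alpha> - sum_list ?L" using True by (simp add: sl algebra_simps)
    moreover have "map (M(i := M i + ?\<eta>)) [0..<i] = ?L" by simp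
    moreover have "(\<Sum>s<i. ?c s * a (map (M(s := M s + ?\<eta>)) [0..<i])) = list_polarization p q a ?L"
      unfolding list_polarization_nth
    proof (intro sum.cong)
      fix s assume "s \<in> {..<length ?L}"
      then have s: "s < i" by simp
      then have "map (M(s := M s + ?\<eta>)) [0..<i] = ?L[s := M s + ?\<eta>]"
        by (intro nth_equalityI) (auto simp: nth_list_update)
      then show "?c s * a (map (M(s := M s + ?\<eta>)) [0..<i]) =
          of_int (Poly_Mapping.lookup (?L ! s + ?\<eta>) q) * a (?L[s := ?L ! s + ?\<eta>])"
        using s by simp
    qed simp
    ultimately show ?thesis
      using True unfolding unfold matrix_form_def by (simp add: weight_polarization_def)
  qed
qed

text \<open>All weights are treated at once, because polarizations change the weight; the bounding
  chains of different weights are independent of each other.\<close>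

definition boundary_matrices :: "nat \<Rightarrow> int \<Rightarrow> nat \<Rightarrow> (exponent_matrix \<Rightarrow> complex) set" where
  "boundary_matrices n d i = {F. \<forall>\<alpha>. \<exists>a. weight_chain n d \<alpha> (Suc i) a \<and>
     (\<forall>M. (\<Sum>s<Suc i. M s) = \<alpha> \<longrightarrow> F M = weight_d n d a (map M [0..<i]))}"

lemma weight_chain_zero: "weight_chain n d \<alpha> i (\<lambda>_. 0)"
  by (simp add: weight_chain_def alternating_def)

lemma weight_chain_add:
  assumes "weight_chain n d \<alpha> i a" "weight_chain n d \<alpha> i b"
  shows "weight_chain n d \<alpha> i (\<lambda>L. a L + b L)"
proof -
  note A = weight_chainD [OF assms(1)] and B = weight_chainD [OF assms(2)]
  have "alternating (\<lambda>L. a L + b L)"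
    unfolding alternating_def
  proof (intro allI)
    fix xs u v ys
    have "a (xs @ u # v # ys) = - a (xs @ v # u # ys)" "b (xs @ u # v # ys) = - b (xs @ v # u # ys)"
      using A(1) B(1) unfolding alternating_def by blast+
    then show "a (xs @ u # v # ys) + b (xs @ u # v # ys) = - (a (xs @ v # u # ys) + b (xs @ v # u # ys))"
      by simp
  qed
  moreover have "length L = i \<and> set L \<subseteq> exponents n d \<and> (\<forall>k. 0 \<le> Poly_Mapping.lookup (\<alpha> - sum_list L) k)"
    if "a L + b L \<noteq> 0" for L
    using A(2,3,4) [of L] B(2,3,4) [of L] that by (cases "a L = 0") auto
  ultimately show ?thesis unfolding weight_chain_def by blast
qed

lemma weight_chain_scale:
  assumes "weight_chain n d \<alpha> i a"
  shows "weight_chain n d \<alpha> i (\<lambda>L. c * a L)"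
proof -
  note A = weight_chainD [OF assms(1)]
  have "alternating (\<lambda>L. c * a L)"
    unfolding alternating_def
  proof (intro allI)
    fix xs u v ys
    have "a (xs @ u # v # ys) = - a (xs @ v # u # ys)"
      using A(1) unfolding alternating_def by blast
    then show "c * a (xs @ u # v # ys) = - (c * a (xs @ v # u # ys))" by simp
  qed
  moreover have "length L = i \<and> set L \<subseteq> exponents n d \<and> (\<forall>k. 0 \<le> Poly_Mapping.lookup (\<alpha> - sum_list L) k)"
    if "c * a L \<noteq> 0" for L
    using A(2,3,4) [of L] that by auto
  ultimately show ?thesis unfolding weight_chain_def by blast
qed

lemma boundary_matrices_stable: "polarization_stable (Suc i) {..n} (boundary_matrices n d i)"
  unfolding polarization_stable_def
proof (intro conjI ballI allI)
  show "(\<lambda>_. 0) \<in> boundary_matrices n d i"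
    unfolding boundary_matrices_def
    using weight_chain_zero by (auto simp: koszul_d_def intro!: exI [of _ "\<lambda>_. 0"])
next
  fix F G assume F: "F \<in> boundary_matrices n d i" and G: "G \<in> boundary_matrices n d i"
  show "(\<lambda>M. F M + G M) \<in> boundary_matrices n d i"
    unfolding boundary_matrices_def
  proof (intro CollectI allI)
    fix \<alpha>
    obtain a where a: "weight_chain n d \<alpha> (Suc i) a"
      "\<And>M. (\<Sum>s<Suc i. M s) = \<alpha> \<Longrightarrow> F M = weight_d n d a (map M [0..<i])"
      using F unfolding boundary_matrices_def by blast
    obtain b where b: "weight_chain n d \<alpha> (Suc i) b"
      "\<And>M. (\<Sum>s<Suc i. M s) = \<alpha> \<Longrightarrow> G M = weight_d n d b (map M [0..<i])"
      using G unfolding boundary_matrices_def by blast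
    show "\<exists>a. weight_chain n d \<alpha> (Suc i) a \<and>
      (\<forall>M. (\<Sum>s<Suc i. M s) = \<alpha> \<longrightarrow> F M + G M = weight_d n d a (map M [0..<i]))"
      by (intro exI [of _ "\<lambda>L. a L + b L"] conjI weight_chain_add a(1) b(1))
        (simp add: a(2) b(2) koszul_d_def sum.distrib)
  qed
next
  fix F c assume F: "F \<in> boundary_matrices n d i"
  show "(\<lambda>M. c * F M) \<in> boundary_matrices n d i"
    unfolding boundary_matrices_def
  proof (intro CollectI allI)
    fix \<alpha>
    obtain a where a: "weight_chain n d \<alpha> (Suc i) a"
      "\<And>M. (\<Sum>s<Suc i. M s) = \<alpha> \<Longrightarrow> F M = weight_d n d a (map M [0..<i])"
      using F unfolding boundary_matrices_def by blast
    show "\<exists>a. weight_chain n d \<alpha> (Suc i) a \<and>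
      (\<forall>M. (\<Sum>s<Suc i. M s) = \<alpha> \<longrightarrow> c * F M = weight_d n d a (map M [0..<i]))"
      by (intro exI [of _ "\<lambda>L. c * a L"] conjI weight_chain_scale a(1))
        (simp add: a(2) koszul_d_def sum_distrib_left)
  qed
next
  fix F p q assume F: "F \<in> boundary_matrices n d i" and pq: "p \<in> {..n}" "q \<in> {..n}"
  show "polarization (Suc i) p q F \<in> boundary_matrices n d i"
    unfolding boundary_matrices_def
  proof (intro CollectI allI)
    fix \<alpha>
    let ?\<eta> = "unit_exponent q - unit_exponent p"
    \<comment> \<open>At weight \<alpha> the polarization reads F at weight \<alpha> + \<eta>, so a
      chain bounding F in that weight has to be polarized into weight \<alpha>.\<close>
    let ?\<beta> = "\<alpha> + ?\<eta>"
    have \<alpha>: "?\<beta> + unit_exponent p - unit_exponent q = \<alpha>" by simp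
    obtain a where a: "weight_chain n d ?\<beta> (Suc i) a"
      "\<And>M. (\<Sum>s<Suc i. M s) = ?\<beta> \<Longrightarrow> F M = weight_d n d a (map M [0..<i])"
      using F unfolding boundary_matrices_def by blast
    let ?a = "weight_polarization ?\<beta> p q a"
    have "weight_chain n d \<alpha> (Suc i) ?a"
      using weight_chain_polarization [OF a(1), of p q] pq \<alpha> by simp
    moreover have "polarization (Suc i) p q F M = weight_d n d ?a (map M [0..<i])"
      if M: "(\<Sum>s<Suc i. M s) = \<alpha>" for M
    proof -
      have "F (M(s := M s + ?\<eta>)) = matrix_form i ?\<beta> (weight_d n d a) (M(s := M s + ?\<eta>))" if "s < Suc i" for s
        using sum_fun_upd [OF that, of M ?\<eta>] M a(2) [of "M(s := M s + ?\<eta>)"] by (simp only: matrix_form_def if_True refl)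
      then have "polarization (Suc i) p q F M = polarization (Suc i) p q (matrix_form i ?\<beta> (weight_d n d a)) M"
        unfolding polarization_def by (intro sum.cong refl) (simp only: lessThan_iff)
      also have "\<dots> = weight_polarization ?\<beta> p q (weight_d n d a) (map M [0..<i])"
        unfolding polarization_matrix_form \<alpha> matrix_form_def using M by (simp only: if_True refl)
      also have "\<dots> = weight_d n d ?a (map M [0..<i])"
        using pq by (intro weight_d_polarization [OF a(1), symmetric]) auto
      finally show ?thesis .
    qed
    ultimately show "\<exists>a. weight_chain n d \<alpha> (Suc i) a \<and>
      (\<forall>M. (\<Sum>s<Suc i. M s) = \<alpha> \<longrightarrow> polarization (Suc i) p q F M = weight_d n d a (map M [0..<i]))"
      by blast
  qed
qed

lemma boundary_matrixI:
  assumes "weight_chain n d \<alpha> (Suc i) a"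
  shows "matrix_form i \<alpha> (weight_d n d a) \<in> boundary_matrices n d i"
  unfolding boundary_matrices_def
proof (intro CollectI allI)
  fix \<beta>
  show "\<exists>a'. weight_chain n d \<beta> (Suc i) a' \<and>
      (\<forall>M. (\<Sum>s<Suc i. M s) = \<beta> \<longrightarrow> matrix_form i \<alpha> (weight_d n d a) M = weight_d n d a' (map M [0..<i]))"
  proof (cases "\<beta> = \<alpha>")
    case True
    then show ?thesis using assms by (intro exI [of _ a]) (simp add: matrix_form_def)
  next
    case False
    then show ?thesis
      using weight_chain_zero by (intro exI [of _ "\<lambda>_. 0"]) (simp add: matrix_form_def koszul_d_def)
  qed
qed

lemma boundary_matrixD:
  assumes a: "weight_chain n d \<alpha> i a" and "matrix_form i \<alpha> a \<in> boundary_matrices n d i"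
  shows "\<exists>a'. weight_chain n d \<alpha> (Suc i) a' \<and> weight_d n d a' = a"
proof -
  obtain a' where a': "weight_chain n d \<alpha> (Suc i) a'"
    "\<And>M. (\<Sum>s<Suc i. M s) = \<alpha> \<Longrightarrow> matrix_form i \<alpha> a M = weight_d n d a' (map M [0..<i])"
    using assms(2) unfolding boundary_matrices_def by blast
  have "weight_d n d a' L = a L" for L
  proof (cases "length L = i")
    case True
    \<comment> \<open>The list is completed to a matrix of weight \<alpha> by the only possible last
      row.\<close>
    let ?M = "\<lambda>s. if s < i then L ! s else \<alpha> - sum_list L"
    have L: "map ?M [0..<i] = L" using True by (intro nth_equalityI) auto
    have "(\<Sum>s<i. ?M s) = sum_list L"
      using True by (simp add: sum_list_sum_nth atLeast0LessThan)
    then have "(\<Sum>s<Suc i. ?M s) = \<alpha>" by simp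
    with a'(2) [OF this] L show ?thesis by (simp only: matrix_form_def if_True refl)
  next
    case False
    then show ?thesis
      using weight_d_support(1) [OF a'(1), of L] weight_chainD(2) [OF a, of L] by metis
  qed
  with a'(1) show ?thesis by blast
qed

text \<open>Nonnegative exponents cannot cancel: a variable absent from \<alpha> is absent from
  every exterior factor, so the weight complexes for p and n coincide.\<close>

lemma weight_vanishes_subspace:
  assumes "Poly_Mapping.keys \<alpha> \<subseteq> {..p}" "p \<le> n" "weight_vanishes p d \<alpha> i"
  shows "weight_vanishes n d \<alpha> i"
proof -
  have small: "set L \<subseteq> exponents p d"
    if L: "set L \<subseteq> exponents n d" and le: "\<And>k. 0 \<le> Poly_Mapping.lookup (\<alpha> - sum_list L) k" for L
  proof
    fix b assume b: "b \<in> set L"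
    then have bn: "b \<in> exponents n d" using L by blast
    have "Poly_Mapping.lookup b k = 0" if "k > p" for k
    proof -
      obtain xs ys where xy: "L = xs @ b # ys" using b by (meson split_list)
      have "sum_list xs \<in> exponents n (int (length xs) * d)" "sum_list ys \<in> exponents n (int (length ys) * d)"
        using L xy by (auto intro!: sum_list_exponents)
      then have "0 \<le> Poly_Mapping.lookup (sum_list xs) k" "0 \<le> Poly_Mapping.lookup (sum_list ys) k"
        by (simp_all add: exponents_nonneg)
      moreover have "Poly_Mapping.lookup \<alpha> k = 0"
        using assms(1) that by (metis atMost_iff in_keys_iff leD subsetD)
      ultimately show ?thesis
        using le [of k] exponents_nonneg [OF bn, of k] by (simp add: xy lookup_minus lookup_add)
    qed
    moreover have "(\<Sum>j\<le>p. Poly_Mapping.lookup b j) = (\<Sum>j\<le>n. Poly_Mapping.lookup b j)"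
      using assms(2) calculation by (intro sum.mono_neutral_left) auto
    ultimately show "b \<in> exponents p d" using bn unfolding exponents_iff by auto
  qed
  have sub: "exponents p d \<subseteq> exponents n d"
  proof
    fix b assume b: "b \<in> exponents p d"
    have "(\<Sum>j\<le>p. Poly_Mapping.lookup b j) = (\<Sum>j\<le>n. Poly_Mapping.lookup b j)"
      using assms(2) b by (intro sum.mono_neutral_left) (auto simp: exponents_iff)
    then show "b \<in> exponents n d" using b assms(2) unfolding exponents_iff by auto
  qed
  have chain: "weight_chain n d \<alpha> j a \<longleftrightarrow> weight_chain p d \<alpha> j a" for j a
  proof
    assume "weight_chain n d \<alpha> j a"
    then show "weight_chain p d \<alpha> j a" unfolding weight_chain_def using small by blast
  next
    assume "weight_chain p d \<alpha> j a"
    then show "weight_chain n d \<alpha> j a" unfolding weight_chain_def using sub by blast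
  qed
  have d: "weight_d n d a L = weight_d p d a L" if "weight_chain p d \<alpha> j a" for j a L
    unfolding koszul_d_def
  proof (rule sum.mono_neutral_right [OF finite_exponents sub])
    show "\<forall>b\<in>exponents n d - exponents p d. a (b # L) = 0"
      using weight_chainD(3) [OF that, of "_ # L"] by fastforce
  qed
  show ?thesis
  proof (rule weight_vanishesI)
    fix a assume "weight_chain n d \<alpha> i a" and cyc: "\<And>L. weight_d n d a L = 0"
    then have a: "weight_chain p d \<alpha> i a" using chain by blast
    have "weight_d p d a L = 0" for L using cyc d [OF a] by simp
    from weight_vanishesE [OF assms(3) a this] obtain a' where
      a': "weight_chain p d \<alpha> (Suc i) a'" "weight_d p d a' = a" by blast
    have "weight_d n d a' = a" using d [OF a'(1)] a'(2) by auto
    then show "\<exists>a'. weight_chain n d \<alpha> (Suc i) a' \<and> weight_d n d a' = a"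
      using a'(1) chain by blast
  qed
qed

text \<open>Dividing the symmetric factor by x_k^d and wedging with x_k^d is a contracting homotopy
  (the case \<kappa> = 0). The division is possible because i exterior factors use at most i d of
  \<alpha>_k and leave at least d.\<close>

lemma weight_vanishes_large:
  assumes k: "k \<le> n" and d: "0 \<le> d" and large: "int (Suc i) * d \<le> Poly_Mapping.lookup \<alpha> k"
  shows "weight_vanishes n d \<alpha> i"
proof (rule weight_vanishesI)
  fix a assume a: "weight_chain n d \<alpha> i a" and cyc: "\<And>L. weight_d n d a L = 0"
  note A = weight_chainD [OF a]
  let ?b0 = "Poly_Mapping.single k d" and ?V = "exponents n d"
  define w where "w = (\<lambda>b (x :: complex). if b = ?b0 then x else 0)"
  have b0: "?b0 \<in> ?V" using k d by (auto simp: exponents_iff lookup_single when_def)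
  have add: "w b (x + y) = w b x + w b y" for b x y by (simp add: w_def)
  have chain: "weight_chain n d \<alpha> (Suc i) (wedge w a)"
    unfolding weight_chain_def
  proof (intro conjI allI impI)
    show "alternating (wedge w a)" by (rule wedge_alternating [OF A(1) add])
    fix L assume "wedge w a L \<noteq> 0"
    then obtain xs b ys where L: "L = xs @ b # ys" "w b (a (xs @ ys)) \<noteq> 0"
      using wedge_support [of w a L] by (auto simp: w_def)
    then have b: "b = ?b0" and nz: "a (xs @ ys) \<noteq> 0" by (auto simp: w_def split: if_splits)
    have len: "length (xs @ ys) = i" and set: "set (xs @ ys) \<subseteq> ?V" using A(2,3) [OF nz] .
    show "length L = Suc i" "set L \<subseteq> ?V" using len set L(1) b b0 by auto
    fix j
    have S: "sum_list (xs @ ys) \<in> exponents n (int i * d)" using sum_list_exponents [OF set] unfolding len .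
    have eq: "sum_list L = sum_list (xs @ ys) + ?b0" by (simp add: L(1) b algebra_simps)
    show "0 \<le> Poly_Mapping.lookup (\<alpha> - sum_list L) j"
    proof (cases "j = k")
      case True
      have "Poly_Mapping.lookup (sum_list (xs @ ys)) k + d \<le> int i * d + d"
        using exponents_le [OF S, of k] by simp
      also have "\<dots> = int (Suc i) * d" by (simp add: algebra_simps)
      also note large
      finally show ?thesis unfolding eq True lookup_minus lookup_add by simp
    next
      case False
      then show ?thesis
        using A(4) [OF nz, of j] unfolding eq lookup_minus lookup_add by (simp add: lookup_single)
    qed
  qed
  have "weight_d n d (wedge w a) L = a L" for L
  proof (cases "set L \<subseteq> ?V")
    case True
    have "weight_d n d (wedge w a) L + wedge w (weight_d n d a) L =
        (\<Sum>v\<in>?V. w v (a L)) + (\<Sum>i<length L. (\<lambda>_. 0) (a L))"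
      by (rule koszul_homotopy [OF A(1) finite_exponents True]) (auto simp: w_def)
    moreover have "weight_d n d a = (\<lambda>_. 0)" using cyc by auto
    moreover have "wedge w (\<lambda>_. 0) L = 0" by (rule wedge_zero) (simp add: w_def)
    moreover have "(\<Sum>v\<in>?V. w v (a L)) = a L" using b0 finite_exponents by (simp add: w_def)
    ultimately show ?thesis by simp
  next
    case False
    then show ?thesis using weight_d_support(2) [OF chain, of L] A(3) [of L] by metis
  qed
  then show "\<exists>a'. weight_chain n d \<alpha> (Suc i) a' \<and> weight_d n d a' = a"
    using chain by blast
qed

text \<open>
  Raising operators strictly decrease \<open>\<Sum> k \<alpha>\<^sub>k\<close>. A weight not supported on the first \<open>p + 1\<close>
  variables is either reflected into a smaller one, or Capelli's identity applies to \<open>i + 2\<close> of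
  its rows.
\<close>

lemma weight_vanishes_extend:
  assumes base: "\<And>\<alpha>. \<alpha> \<in> exponents p e \<Longrightarrow> weight_vanishes p d \<alpha> i"
    and ip: "i \<le> p" "p \<le> n"
  shows "\<alpha> \<in> exponents n e \<Longrightarrow> weight_vanishes n d \<alpha> i"
proof (induction "nat (\<Sum>k\<le>n. int k * Poly_Mapping.lookup \<alpha> k)" arbitrary: \<alpha> rule: less_induct)
  case less
  note \<alpha> = less.prems
  show ?case
  proof (cases "Poly_Mapping.keys \<alpha> \<subseteq> {..p}")
    case True
    then have z: "\<forall>j>p. Poly_Mapping.lookup \<alpha> j = 0"
      by (metis atMost_iff in_keys_iff leD subsetD)
    then have "(\<Sum>j\<le>p. Poly_Mapping.lookup \<alpha> j) = (\<Sum>j\<le>n. Poly_Mapping.lookup \<alpha> j)"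
      using ip(2) by (intro sum.mono_neutral_left) auto
    then have "\<alpha> \<in> exponents p e" using \<alpha> z unfolding exponents_iff by auto
    from weight_vanishes_subspace [OF True ip(2) base [OF this]] show ?thesis .
  next
    case False
    then obtain b where "b \<in> Poly_Mapping.keys \<alpha>" and bp: "p < b" by force
    then have b0: "Poly_Mapping.lookup \<alpha> b \<noteq> 0" and bn: "b \<le> n"
      using \<alpha> by (auto simp: in_keys_iff exponents_def)
    have pos: "0 < Poly_Mapping.lookup \<alpha> b" using exponents_nonneg [OF \<alpha>, of b] b0 by simp
    show ?thesis
    proof (rule weight_vanishesI)
      fix a assume a: "weight_chain n d \<alpha> i a" and cyc: "\<And>L. weight_d n d a L = 0"
      define z where "z = matrix_form i \<alpha> a"
      let ?W = "boundary_matrices n d i"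
      \<comment> \<open>The homology of the raised weight vanishes by induction, and polarizations
        commute with the differential, so the raised cycle bounds: z is a highest weight vector
        modulo boundaries.\<close>
      have raise: "polarization (Suc i) r q z \<in> ?W"
        if rq: "r < q" "q \<le> n" "0 < Poly_Mapping.lookup \<alpha> q" for r q
      proof -
        let ?\<alpha>' = "\<alpha> + unit_exponent r - unit_exponent q"
        have \<alpha>': "?\<alpha>' \<in> exponents n e"
          using rq by (intro exponents_shift [OF \<alpha>]) auto
        let ?s = "\<lambda>\<beta>. \<Sum>k\<le>n. int k * Poly_Mapping.lookup \<beta> k"
        have single: "(\<Sum>k\<le>n. int k * Poly_Mapping.lookup (unit_exponent j) k) = int j" if "j \<le> n" for j
          using that by (simp add: lookup_single when_def if_distrib [of "\<lambda>x. _ * x"] cong: if_cong)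
        have "?s ?\<alpha>' = ?s \<alpha> + int r - int q"
          using single [of r] single [of q] rq
          by (simp add: lookup_add lookup_minus distrib_left right_diff_distrib sum.distrib sum_subtractf)
        moreover have "0 \<le> ?s ?\<alpha>'" using exponents_nonneg [OF \<alpha>'] by (intro sum_nonneg) simp
        ultimately have "nat (?s ?\<alpha>') < nat (?s \<alpha>)" using rq(1) by simp
        from less.hyps [OF this \<alpha>'] have van: "weight_vanishes n d ?\<alpha>' i" .
        let ?b = "weight_polarization \<alpha> r q a"
        have rqn: "r \<le> n" "q \<le> n" using rq by auto
        have "weight_d n d a = (\<lambda>_. 0)" using cyc by auto
        then have "weight_d n d ?b L = 0" for L
          unfolding weight_d_polarization [OF a rqn]
          by (simp add: weight_polarization_def list_polarization_zero)
        from weight_vanishesE [OF van weight_chain_polarization [OF a rqn] this]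
        obtain a' where "weight_chain n d ?\<alpha>' (Suc i) a'" "weight_d n d a' = ?b" by blast
        with boundary_matrixI [of n d ?\<alpha>' i a'] show ?thesis
          by (simp add: z_def polarization_matrix_form)
      qed
      have weight: "polarization (Suc i) k k z = (\<lambda>M. of_int (Poly_Mapping.lookup \<alpha> k) * z M)" for k
      proof
        fix M :: exponent_matrix
        have "polarization (Suc i) k k z M = of_int (\<Sum>s<Suc i. Poly_Mapping.lookup (M s) k) * z M"
          unfolding polarization_def by (simp add: sum_distrib_right del: sum.lessThan_Suc)
        also have "(\<Sum>s<Suc i. Poly_Mapping.lookup (M s) k) = Poly_Mapping.lookup (\<Sum>s<Suc i. M s) k"
          by (rule lookup_sum [symmetric])
        finally have eq: "polarization (Suc i) k k z M = of_int (Poly_Mapping.lookup (\<Sum>s<Suc i. M s) k) * z M" .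
        show "polarization (Suc i) k k z M = of_int (Poly_Mapping.lookup \<alpha> k) * z M"
        proof (cases "(\<Sum>s<Suc i. M s) = \<alpha>")
          case False
          then have "z M = 0" by (simp only: z_def matrix_form_def if_False)
          then show ?thesis unfolding eq by simp
        qed (simp only: eq)
      qed
      note stable = boundary_matrices_stable [of i n d]
      have "z \<in> ?W"
      proof (cases "\<exists>k\<le>i. Poly_Mapping.lookup \<alpha> k = 0")
        case True
        then obtain k where k: "k \<le> i" "Poly_Mapping.lookup \<alpha> k = 0" by blast
        \<comment> \<open>From k <= i <= p < b: moving b into the empty row k is a raising
          operator.\<close>
        have kb: "k < b" using k(1) ip(1) bp by simp
        show ?thesis
        proof (rule two_row_reflection [OF stable, of k b])
          show "k \<in> {..n}" "b \<in> {..n}" "k \<noteq> b" using kb bn by auto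
          show "polarization (Suc i) k b z \<in> ?W" using raise kb bn pos by blast
          show "polarization (Suc i) b b z = (\<lambda>M. of_int (Poly_Mapping.lookup \<alpha> b) * z M)" by (rule weight)
          show "complex_of_int (Poly_Mapping.lookup \<alpha> b) \<noteq> 0" using b0 by simp
          fix M s assume s: "s < Suc i" and nz: "z M \<noteq> 0"
          have sum: "(\<Sum>t<Suc i. M t) = \<alpha>" and nz': "a (map M [0..<i]) \<noteq> 0"
            using nz by (auto simp: z_def matrix_form_def split: if_splits)
          \<comment> \<open>Exponents outside the support of \<open>a\<close> could be negative; on
            the support they are not, so \<alpha>_k = 0 makes the exponent of x_k zero in every
            factor separately.\<close>
          have nonneg: "0 \<le> Poly_Mapping.lookup (M t) k" if "t < Suc i" for t
          proof (cases "t < i")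
            case True
            then have "M t \<in> set (map M [0..<i])" by auto
            then have "M t \<in> exponents n d" using weight_chainD(3) [OF a nz'] by blast
            then show ?thesis by (rule exponents_nonneg)
          next
            case False
            have "sum_list (map M [0..<i]) = (\<Sum>t<i. M t)"
              by (simp add: interv_sum_list_conv_sum_set_nat atLeast0LessThan)
            then have "\<alpha> - sum_list (map M [0..<i]) = M i" using sum by (simp add: algebra_simps)
            with weight_chainD(4) [OF a nz', of k] False that show ?thesis by (simp add: less_Suc_eq)
          qed
          have "(\<Sum>t<Suc i. Poly_Mapping.lookup (M t) k) = 0"
            using k(2) unfolding sum [symmetric] lookup_sum .
          then show "Poly_Mapping.lookup (M s) k = 0"
            using sum_nonneg_eq_0_iff [of "{..<Suc i}" "\<lambda>t. Poly_Mapping.lookup (M t) k"] nonneg s by auto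
        qed
      next
        case False
        \<comment> \<open>As b > p >= i, this has i + 2 elements, one more than the number of
          factors, and \<alpha> is positive on all of them.\<close>
        define A where "A = insert b {..i}"
        have posA: "0 < Poly_Mapping.lookup \<alpha> k" if "k \<in> A" for k
          using that pos False exponents_nonneg [OF \<alpha>, of k] unfolding A_def by (cases "k = b") (auto simp: order_less_le)
        have An: "k \<le> n" if "k \<in> A" for k using that bn ip by (auto simp: A_def)
        show ?thesis
        proof (rule capelli [OF stable, of A])
          show "finite A" "A \<subseteq> {..n}" using An by (auto simp: A_def)
          show "Suc i < card A" using ip(1) bp by (simp add: A_def)
          show "polarization (Suc i) r q z \<in> ?W" if "r \<in> A" "q \<in> A" "r < q" for r q
            using raise posA An that by blast
          show "polarization (Suc i) k k z = (\<lambda>M. of_real (of_int (Poly_Mapping.lookup \<alpha> k)) * z M)"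
            if "k \<in> A" for k by (simp add: weight)
          show "0 < real_of_int (Poly_Mapping.lookup \<alpha> k)" if "k \<in> A" for k using posA [OF that] by simp
        qed
      qed
      then show "\<exists>a'. weight_chain n d \<alpha> (Suc i) a' \<and> weight_d n d a' = a"
        unfolding z_def by (rule boundary_matrixD [OF a])
    qed
  qed
qed

section \<open>Decomposition of the Koszul complex of forms into weight spaces\<close>

definition variable_action :: "(nat \<Rightarrow>\<^sub>0 int) \<Rightarrow> laurent \<Rightarrow> laurent" where
  "variable_action b f = Poly_Mapping.single b 1 * f"

lemma lookup_variable_action:
  "Poly_Mapping.lookup (variable_action b f) g = Poly_Mapping.lookup f (g - b)"
  using lookup_times_monomial [of f b "g - b"] by (simp add: variable_action_def mult.commute)

lemma single_sum: "Poly_Mapping.single a (sum f A) = (\<Sum>x\<in>A. Poly_Mapping.single a (f x))"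
  by (induction A rule: infinite_finite_induct) (simp_all add: single_add)

lemma forms_sum: "(\<And>x. x \<in> A \<Longrightarrow> f x \<in> forms n k) \<Longrightarrow> sum f A \<in> forms n k"
  by (induction A rule: infinite_finite_induct) (simp_all add: forms_closed)

text \<open>Restoring the symmetric factor turns a cycle of weight \<alpha> into a Koszul cycle; of
  a chain bounding it, the part of weight \<alpha> already bounds it.\<close>

lemma weight_vanishes_if_koszul_vanishes:
  assumes van: "koszul_vanishes variable_action (exponents n d) (\<lambda>j. forms n (j * d)) i e"
    and \<alpha>: "\<alpha> \<in> exponents n (e * d)"
  shows "weight_vanishes n d \<alpha> i"
proof (rule weight_vanishesI)
  fix a assume a: "weight_chain n d \<alpha> i a" and cyc: "\<And>L. weight_d n d a L = 0"
  note A = weight_chainD [OF a]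
  let ?V = "exponents n d"
  let ?c = "\<lambda>L. Poly_Mapping.single (\<alpha> - sum_list L) (a L) :: laurent"
  have "koszul_chain ?V (\<lambda>j. forms n (j * d)) i e ?c"
    unfolding koszul_chain_def
  proof (intro conjI allI impI)
    show "alternating ?c"
      unfolding alternating_def
    proof (intro allI)
      fix xs u v ys
      have "a (xs @ u # v # ys) = - a (xs @ v # u # ys)"
        using A(1) unfolding alternating_def by blast
      then show "?c (xs @ u # v # ys) = - ?c (xs @ v # u # ys)"
        by (simp only: sum_list_swap [of xs u v ys] single_uminus)
    qed
    fix L
    show "?c L \<in> forms n ((e - int i) * d)"
    proof (cases "a L = 0")
      case True
      then show ?thesis by (simp add: forms_def)
    next
      case False
      have S: "sum_list L \<in> exponents n (int i * d)"
        using sum_list_exponents [OF A(3) [OF False]] A(2) [OF False] by simp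
      have "\<alpha> - sum_list L \<in> exponents n (e * d - int i * d)"
        using A(4) [OF False] \<alpha> S
        by (auto simp: exponents_iff lookup_minus sum_subtractf)
      then show ?thesis by (simp add: forms_def left_diff_distrib)
    qed
    assume "?c L \<noteq> 0"
    then have "a L \<noteq> 0" by auto
    then show "length L = i" "set L \<subseteq> ?V" using A(2,3) by blast+
  qed
  moreover have "koszul_d variable_action ?V ?c L = 0" for L
  proof -
    have "koszul_d variable_action ?V ?c L = Poly_Mapping.single (\<alpha> - sum_list L) (weight_d n d a L)"
      unfolding koszul_d_def variable_action_def by (simp add: mult_single single_sum algebra_simps)
    then show ?thesis by (simp add: cyc)
  qed
  ultimately obtain c' where c': "koszul_chain ?V (\<lambda>j. forms n (j * d)) (Suc i) e c'"
    and dc': "koszul_d variable_action ?V c' = ?c"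
    by (rule koszul_vanishesE [OF van])
  let ?a' = "\<lambda>L. Poly_Mapping.lookup (c' L) (\<alpha> - sum_list L)"
  have "weight_chain n d \<alpha> (Suc i) ?a'"
    unfolding weight_chain_def
  proof (intro conjI allI impI)
    show "alternating ?a'"
      unfolding alternating_def
    proof (intro allI)
      fix xs u v ys
      have "c' (xs @ u # v # ys) = - c' (xs @ v # u # ys)"
        using c' unfolding koszul_chain_def alternating_def by blast
      then show "?a' (xs @ u # v # ys) = - ?a' (xs @ v # u # ys)"
        by (simp only: sum_list_swap [of xs u v ys] lookup_uminus)
    qed
    fix L assume nz: "?a' L \<noteq> 0"
    then have "c' L \<noteq> 0" by auto
    then show "length L = Suc i" "set L \<subseteq> ?V" using c' unfolding koszul_chain_def by blast+
    have "\<alpha> - sum_list L \<in> Poly_Mapping.keys (c' L)" using nz by (simp add: in_keys_iff)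
    moreover have "c' L \<in> forms n ((e - int (Suc i)) * d)" using c' unfolding koszul_chain_def by blast
    ultimately have "\<alpha> - sum_list L \<in> exponents n ((e - int (Suc i)) * d)" unfolding forms_def by blast
    then show "0 \<le> Poly_Mapping.lookup (\<alpha> - sum_list L) k" for k by (rule exponents_nonneg)
  qed
  moreover have "weight_d n d ?a' L = a L" for L
  proof -
    have "weight_d n d ?a' L = Poly_Mapping.lookup (koszul_d variable_action ?V c' L) (\<alpha> - sum_list L)"
      unfolding koszul_d_def by (simp add: lookup_sum lookup_variable_action algebra_simps)
    then show ?thesis by (simp add: dc')
  qed
  ultimately show "\<exists>a'. weight_chain n d \<alpha> (Suc i) a' \<and> weight_d n d a' = a"
    by (intro exI [of _ ?a'] conjI ext)
qed

text \<open>In degree e only weights in the finite set \<open>exponents n (e * d)\<close> occur, so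
  chains bounding the weight parts can be chosen separately and added.\<close>

lemma koszul_vanishes_if_weight_vanishes:
  assumes van: "\<And>\<alpha>. \<alpha> \<in> exponents n (e * d) \<Longrightarrow> weight_vanishes n d \<alpha> i"
  shows "koszul_vanishes variable_action (exponents n d) (\<lambda>j. forms n (j * d)) i e"
proof (rule koszul_vanishesI)
  let ?V = "exponents n d" and ?A = "exponents n (e * d)"
  fix c assume c: "koszul_chain ?V (\<lambda>j. forms n (j * d)) i e c"
    and cyc: "\<And>L. koszul_d variable_action ?V c L = 0"
  define a where "a \<alpha> L = Poly_Mapping.lookup (c L) (\<alpha> - sum_list L)" for \<alpha> L
  have C: "alternating c" "c L \<in> forms n ((e - int i) * d)" "c L \<noteq> 0 \<Longrightarrow> length L = i \<and> set L \<subseteq> ?V" for L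
    using c unfolding koszul_chain_def by blast+
  have a: "weight_chain n d \<alpha> i (a \<alpha>)" for \<alpha>
    unfolding weight_chain_def
  proof (intro conjI allI impI)
    show "alternating (a \<alpha>)"
      unfolding alternating_def a_def
    proof (intro allI)
      fix xs u v ys
      have "c (xs @ u # v # ys) = - c (xs @ v # u # ys)"
        using C(1) unfolding alternating_def by blast
      then show "Poly_Mapping.lookup (c (xs @ u # v # ys)) (\<alpha> - sum_list (xs @ u # v # ys)) =
          - Poly_Mapping.lookup (c (xs @ v # u # ys)) (\<alpha> - sum_list (xs @ v # u # ys))"
        by (simp only: sum_list_swap [of xs u v ys] lookup_uminus)
    qed
    fix L assume nz: "a \<alpha> L \<noteq> 0"
    then have "c L \<noteq> 0" by (auto simp: a_def)
    then show "length L = i" "set L \<subseteq> ?V" using C(3) by blast+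
    have "\<alpha> - sum_list L \<in> Poly_Mapping.keys (c L)" using nz by (simp add: a_def in_keys_iff)
    then have "\<alpha> - sum_list L \<in> exponents n ((e - int i) * d)" using C(2) unfolding forms_def by blast
    then show "0 \<le> Poly_Mapping.lookup (\<alpha> - sum_list L) k" for k by (rule exponents_nonneg)
  qed
  have "weight_d n d (a \<alpha>) L = Poly_Mapping.lookup (koszul_d variable_action ?V c L) (\<alpha> - sum_list L)" for \<alpha> L
    unfolding koszul_d_def a_def by (simp add: lookup_sum lookup_variable_action algebra_simps)
  then have "weight_d n d (a \<alpha>) L = 0" for \<alpha> L by (simp add: cyc)
  then have "\<forall>\<alpha>\<in>?A. \<exists>a'. weight_chain n d \<alpha> (Suc i) a' \<and> weight_d n d a' = a \<alpha>"
    using weight_vanishesE [OF van a] by metis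
  from bchoice [OF this] obtain b where
    b: "\<And>\<alpha>. \<alpha> \<in> ?A \<Longrightarrow> weight_chain n d \<alpha> (Suc i) (b \<alpha>)" "\<And>\<alpha>. \<alpha> \<in> ?A \<Longrightarrow> weight_d n d (b \<alpha>) = a \<alpha>"
    by blast
  let ?c' = "\<lambda>L. \<Sum>\<alpha>\<in>?A. Poly_Mapping.single (\<alpha> - sum_list L) (b \<alpha> L) :: laurent"
  have "koszul_chain ?V (\<lambda>j. forms n (j * d)) (Suc i) e ?c'"
    unfolding koszul_chain_def
  proof (intro conjI allI impI)
    show "alternating ?c'"
      unfolding alternating_def
    proof (intro allI)
      fix xs u v ys
      have "b \<alpha> (xs @ u # v # ys) = - b \<alpha> (xs @ v # u # ys)" if "\<alpha> \<in> ?A" for \<alpha>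
        using weight_chainD(1) [OF b(1) [OF that]] unfolding alternating_def by blast
      then show "?c' (xs @ u # v # ys) = - ?c' (xs @ v # u # ys)"
        unfolding sum_list_swap [of xs u v ys] sum_negf [symmetric] single_uminus [symmetric]
        by (intro sum.cong refl) simp
    qed
    fix L
    have mem: "Poly_Mapping.single (\<alpha> - sum_list L) (b \<alpha> L) \<in> forms n ((e - int (Suc i)) * d)" if \<alpha>: "\<alpha> \<in> ?A" for \<alpha>
    proof (cases "b \<alpha> L = 0")
      case True
      then show ?thesis by (simp add: forms_def)
    next
      case False
      note B = weight_chainD [OF b(1) [OF \<alpha>]]
      have S: "sum_list L \<in> exponents n (int (Suc i) * d)"
        using sum_list_exponents [OF B(3) [OF False]] B(2) [OF False] by simp
      have "\<alpha> - sum_list L \<in> exponents n (e * d - int (Suc i) * d)"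
        using B(4) [OF False] \<alpha> S
        by (auto simp: exponents_iff lookup_minus sum_subtractf)
      then show ?thesis by (simp add: forms_def left_diff_distrib)
    qed
    show "?c' L \<in> forms n ((e - int (Suc i)) * d)" using mem by (rule forms_sum)
    assume "?c' L \<noteq> 0"
    then obtain \<alpha> where \<alpha>: "\<alpha> \<in> ?A" "Poly_Mapping.single (\<alpha> - sum_list L) (b \<alpha> L) \<noteq> 0"
      by (meson sum.not_neutral_contains_not_neutral)
    then have "b \<alpha> L \<noteq> 0" by auto
    then show "length L = Suc i" "set L \<subseteq> ?V" using weight_chainD(2,3) [OF b(1) [OF \<alpha>(1)]] by blast+
  qed
  moreover have "koszul_d variable_action ?V ?c' L = c L" for L
  proof -
    have "koszul_d variable_action ?V ?c' L =
        (\<Sum>v\<in>?V. \<Sum>\<alpha>\<in>?A. Poly_Mapping.single (\<alpha> - sum_list L) (b \<alpha> (v # L)))"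
      unfolding koszul_d_def variable_action_def
      by (simp add: sum_distrib_left mult_single algebra_simps)
    also have "\<dots> = (\<Sum>\<alpha>\<in>?A. Poly_Mapping.single (\<alpha> - sum_list L) (weight_d n d (b \<alpha>) L))"
      unfolding koszul_d_def by (subst sum.swap) (simp add: single_sum)
    also have "\<dots> = (\<Sum>\<alpha>\<in>?A. Poly_Mapping.single (\<alpha> - sum_list L) (Poly_Mapping.lookup (c L) (\<alpha> - sum_list L)))"
      by (intro sum.cong refl) (simp add: b(2) a_def)
    also have "\<dots> = (\<Sum>g\<in>(\<lambda>\<alpha>. \<alpha> - sum_list L) ` ?A. Poly_Mapping.single g (Poly_Mapping.lookup (c L) g))"
      by (subst sum.reindex) (auto simp: inj_on_def)
    also have "\<dots> = (\<Sum>g\<in>Poly_Mapping.keys (c L). Poly_Mapping.single g (Poly_Mapping.lookup (c L) g))"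
    proof (rule sum.mono_neutral_right)
      show "Poly_Mapping.keys (c L) \<subseteq> (\<lambda>\<alpha>. \<alpha> - sum_list L) ` ?A"
      proof
        fix g assume g: "g \<in> Poly_Mapping.keys (c L)"
        then have "c L \<noteq> 0" by auto
        then have L: "length L = i" "set L \<subseteq> ?V" using C(3) by blast+
        have "g \<in> exponents n ((e - int i) * d)" using g C(2) [of L] unfolding forms_def by blast
        then have "g + sum_list L \<in> exponents n ((e - int i) * d + int i * d)"
          using sum_list_exponents [OF L(2)] L(1) by (intro exponents_add) auto
        then have "g + sum_list L \<in> ?A" by (simp add: algebra_simps)
        then show "g \<in> (\<lambda>\<alpha>. \<alpha> - sum_list L) ` ?A" by (metis add_diff_cancel_right' image_eqI)
      qed
    qed (simp_all add: finite_exponents in_keys_iff)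
    also have "\<dots> = c L" by (rule poly_mapping_expansion [symmetric])
    finally show ?thesis .
  qed
  ultimately show "\<exists>c'. koszul_chain ?V (\<lambda>j. forms n (j * d)) (Suc i) e c' \<and>
      koszul_d variable_action ?V c' = c"
    by (intro exI [of _ ?c'] conjI ext)
qed

section \<open>Homogeneous polynomials\<close>

lemma lookup_single_mult:
  fixes f :: "'v mpoly"
  shows "Poly_Mapping.lookup (Poly_Mapping.single a x * f) (a + b) = x * Poly_Mapping.lookup f b"
proof -
  let ?s = "\<lambda>c. Poly_Mapping.single c (Poly_Mapping.lookup f c)"
  have "Poly_Mapping.single a x * f = Poly_Mapping.single a x * (\<Sum>c\<in>Poly_Mapping.keys f. ?s c)"
    by (simp only: poly_mapping_expansion [of f, symmetric])
  also have "\<dots> = (\<Sum>c\<in>Poly_Mapping.keys f. Poly_Mapping.single (a + c) (x * Poly_Mapping.lookup f c))"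
    by (simp only: sum_distrib_left mult_single)
  finally have "Poly_Mapping.lookup (Poly_Mapping.single a x * f) (a + b) =
      (\<Sum>c\<in>Poly_Mapping.keys f. if c = b then x * Poly_Mapping.lookup f c else 0)"
    by (simp add: lookup_sum lookup_single when_def)
  then show ?thesis by (simp add: in_keys_iff)
qed

lemma lookup_monomial_mult:
  fixes f :: "'v mpoly"
  shows "Poly_Mapping.lookup (Poly_Mapping.single a 1 * f) (a + b) = Poly_Mapping.lookup f b"
  by (simp add: lookup_single_mult)

lemma lookup_scale:
  fixes f :: "'v mpoly"
  shows "Poly_Mapping.lookup (Poly_Mapping.single 0 x * f) b = x * Poly_Mapping.lookup f b"
  using lookup_single_mult [of 0 x f b] by simp

abbreviation var :: "'v \<Rightarrow> 'v mpoly" where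
  "var v \<equiv> Poly_Mapping.single (Poly_Mapping.single v (Suc 0)) 1"

lemma lookup_var_mult_zero:
  assumes "Poly_Mapping.lookup m v = 0"
  shows "Poly_Mapping.lookup (var v * f) m = 0"
proof (rule ccontr)
  assume "Poly_Mapping.lookup (var v * f) m \<noteq> 0"
  then have "m \<in> Poly_Mapping.keys (var v * f)" by (simp add: in_keys_iff)
  then obtain b where "m = Poly_Mapping.single v (Suc 0) + b"
    using keys_mult [of "var v" f] by (auto split: if_splits)
  with assms show False by (simp add: lookup_add)
qed

lemma exponent_split:
  fixes m :: "'v \<Rightarrow>\<^sub>0 nat"
  assumes "Poly_Mapping.lookup m v \<noteq> 0"
  obtains m' where "m = Poly_Mapping.single v (Suc 0) + m'"
proof
  show "m = Poly_Mapping.single v (Suc 0) + (m - Poly_Mapping.single v (Suc 0))"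
    using assms by (intro poly_mapping_eqI) (auto simp: lookup_add lookup_minus lookup_single when_def)
qed

definition partial_derivative :: "'v \<Rightarrow> 'v mpoly \<Rightarrow> 'v mpoly" where
  "partial_derivative v f = (\<Sum>m\<in>Poly_Mapping.keys f. Poly_Mapping.single (m - Poly_Mapping.single v (Suc 0))
     (of_nat (Poly_Mapping.lookup m v) * Poly_Mapping.lookup f m))"

lemma lookup_partial_derivative:
  "Poly_Mapping.lookup (partial_derivative v f) m =
     of_nat (Poly_Mapping.lookup m v + 1) * Poly_Mapping.lookup f (Poly_Mapping.single v (Suc 0) + m)"
proof -
  let ?e = "Poly_Mapping.single v (Suc 0)"
  have "Poly_Mapping.lookup (partial_derivative v f) m =
      (\<Sum>m'\<in>Poly_Mapping.keys f. if m' = ?e + m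
         then of_nat (Poly_Mapping.lookup m' v) * Poly_Mapping.lookup f m' else 0)"
    unfolding partial_derivative_def lookup_sum
  proof (intro sum.cong refl)
    fix m'
    show "Poly_Mapping.lookup (Poly_Mapping.single (m' - ?e) (of_nat (Poly_Mapping.lookup m' v) * Poly_Mapping.lookup f m')) m =
        (if m' = ?e + m then of_nat (Poly_Mapping.lookup m' v) * Poly_Mapping.lookup f m' else 0)"
    proof (cases "Poly_Mapping.lookup m' v = 0")
      case True
      then show ?thesis by (auto simp: lookup_single lookup_add)
    next
      case False
      then obtain n where "m' = ?e + n" by (rule exponent_split)
      then show ?thesis by (auto simp: lookup_single when_def)
    qed
  qed
  then show ?thesis by (auto simp: in_keys_iff lookup_add)
qed

lemma partial_derivative_add: "partial_derivative v (f + g) = partial_derivative v f + partial_derivative v g"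
  by (rule poly_mapping_eqI) (simp add: lookup_partial_derivative lookup_add algebra_simps)

lemma lookup_var_partial_derivative:
  "Poly_Mapping.lookup (var v * partial_derivative v f) m =
     of_nat (Poly_Mapping.lookup m v) * Poly_Mapping.lookup f m"
proof (cases "Poly_Mapping.lookup m v = 0")
  case True
  then show ?thesis by (simp add: lookup_var_mult_zero)
next
  case False
  then obtain n where "m = Poly_Mapping.single v (Suc 0) + n" by (rule exponent_split)
  then show ?thesis by (simp add: lookup_monomial_mult lookup_partial_derivative lookup_add)
qed

text \<open>This is the commutation premise of \<open>koszul_homotopy\<close> with \<kappa> the
  identity.\<close>

lemma partial_derivative_var_mult:
  "partial_derivative u (var v * f) = var v * partial_derivative u f + (if u = v then f else 0)"
proof (rule poly_mapping_eqI)
  fix m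
  show "Poly_Mapping.lookup (partial_derivative u (var v * f)) m =
      Poly_Mapping.lookup (var v * partial_derivative u f + (if u = v then f else 0)) m"
  proof (cases "u = v")
    case True
    then show ?thesis
      unfolding lookup_add
      by (simp add: lookup_var_partial_derivative lookup_partial_derivative lookup_monomial_mult distrib_right)
  next
    case False
    show ?thesis
    proof (cases "Poly_Mapping.lookup m v = 0")
      case True
      then show ?thesis using False
        by (simp add: lookup_partial_derivative lookup_var_mult_zero lookup_add lookup_single)
    next
      case mv: False
      then obtain n where m: "m = Poly_Mapping.single v (Suc 0) + n" by (rule exponent_split)
      have "Poly_Mapping.single u (Suc 0) + m = Poly_Mapping.single v (Suc 0) + (Poly_Mapping.single u (Suc 0) + n)"
        by (simp add: m add.left_commute)
      then have "Poly_Mapping.lookup (var v * f) (Poly_Mapping.single u (Suc 0) + m) =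
          Poly_Mapping.lookup f (Poly_Mapping.single u (Suc 0) + n)"
        by (simp only: lookup_monomial_mult)
      then show ?thesis using False
        by (simp add: lookup_partial_derivative m lookup_monomial_mult lookup_add lookup_single)
    qed
  qed
qed

lemma monom_degree_superset:
  "finite A \<Longrightarrow> Poly_Mapping.keys m \<subseteq> A \<Longrightarrow> monom_degree m = (\<Sum>v\<in>A. Poly_Mapping.lookup m v)"
  unfolding monom_degree_def by (rule sum.mono_neutral_left) (auto simp: in_keys_iff)

lemma monom_degree_add: "monom_degree (m + m') = monom_degree m + monom_degree m'"
proof -
  let ?A = "Poly_Mapping.keys m \<union> Poly_Mapping.keys m'"
  show ?thesis
    using keys_add [of m m'] monom_degree_superset [of ?A m] monom_degree_superset [of ?A m']
      monom_degree_superset [of ?A "m + m'"] by (simp add: lookup_add sum.distrib)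
qed

lemma monom_degree_single [simp]: "monom_degree (Poly_Mapping.single v k) = k"
  by (simp add: monom_degree_def)

lemma monom_degree_zero [simp]: "monom_degree 0 = 0"
  by (simp add: monom_degree_def)

lemma monom_degree_eq_0: "monom_degree m = 0 \<longleftrightarrow> m = 0"
  unfolding monom_degree_def by (auto simp: in_keys_iff intro: poly_mapping_eqI)

lemma homogeneous_iff:
  "f \<in> homogeneous_polynomials V k \<longleftrightarrow>
     (\<forall>m. Poly_Mapping.lookup f m \<noteq> 0 \<longrightarrow> Poly_Mapping.keys m \<subseteq> V \<and> int (monom_degree m) = k)"
  by (auto simp: homogeneous_polynomials_def polynomials_in_def in_keys_iff)

lemma homogeneous_closed:
  "0 \<in> homogeneous_polynomials V k"
  "f \<in> homogeneous_polynomials V k \<Longrightarrow> g \<in> homogeneous_polynomials V k \<Longrightarrow> f + g \<in> homogeneous_polynomials V k"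
  "f \<in> homogeneous_polynomials V k \<Longrightarrow> - f \<in> homogeneous_polynomials V k"
  "f \<in> homogeneous_polynomials V k \<Longrightarrow> g \<in> homogeneous_polynomials V k \<Longrightarrow> f - g \<in> homogeneous_polynomials V k"
proof -
  show "0 \<in> homogeneous_polynomials V k" by (simp add: homogeneous_iff)
  show add: "f \<in> homogeneous_polynomials V k \<Longrightarrow> g \<in> homogeneous_polynomials V k \<Longrightarrow> f + g \<in> homogeneous_polynomials V k" for f g
    unfolding homogeneous_iff by (metis lookup_add add_0)
  show minus: "f \<in> homogeneous_polynomials V k \<Longrightarrow> - f \<in> homogeneous_polynomials V k" for f
    unfolding homogeneous_iff by simp
  show "f \<in> homogeneous_polynomials V k \<Longrightarrow> g \<in> homogeneous_polynomials V k \<Longrightarrow> f - g \<in> homogeneous_polynomials V k"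
    using add [of f "- g"] minus [of g] by simp
qed

lemma homogeneous_mult:
  assumes "f \<in> homogeneous_polynomials V k" "g \<in> homogeneous_polynomials V l"
  shows "f * g \<in> homogeneous_polynomials V (k + l)"
  unfolding homogeneous_iff
proof (intro allI impI)
  fix m assume "Poly_Mapping.lookup (f * g) m \<noteq> 0"
  then have "m \<in> Poly_Mapping.keys (f * g)" by (simp add: in_keys_iff)
  then obtain a b where m: "m = a + b" "a \<in> Poly_Mapping.keys f" "b \<in> Poly_Mapping.keys g"
    using keys_mult [of f g] by blast
  have "Poly_Mapping.keys a \<subseteq> V \<and> int (monom_degree a) = k" "Poly_Mapping.keys b \<subseteq> V \<and> int (monom_degree b) = l"
    using assms m unfolding homogeneous_iff by (auto simp: in_keys_iff)
  then show "Poly_Mapping.keys m \<subseteq> V \<and> int (monom_degree m) = k + l"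
    using keys_add [of a b] by (auto simp: m(1) monom_degree_add)
qed

lemma homogeneous_const: "Poly_Mapping.single 0 c \<in> homogeneous_polynomials V 0"
  by (auto simp: homogeneous_iff lookup_single when_def)

lemma homogeneous_var: "v \<in> V \<Longrightarrow> var v \<in> homogeneous_polynomials V 1"
  by (auto simp: homogeneous_iff lookup_single when_def split: if_splits)

lemma homogeneous_scale:
  "f \<in> homogeneous_polynomials V k \<Longrightarrow> Poly_Mapping.single 0 c * f \<in> homogeneous_polynomials V k"
  using homogeneous_mult [OF homogeneous_const] by fastforce

lemma homogeneous_var_mult:
  "v \<in> V \<Longrightarrow> f \<in> homogeneous_polynomials V k \<Longrightarrow> var v * f \<in> homogeneous_polynomials V (k + 1)"
  using homogeneous_mult [OF homogeneous_var, of v V f k] by (simp add: add.commute)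

lemma homogeneous_sum:
  "(\<And>x. x \<in> A \<Longrightarrow> f x \<in> homogeneous_polynomials V k) \<Longrightarrow> sum f A \<in> homogeneous_polynomials V k"
  by (induction A rule: infinite_finite_induct) (simp_all add: homogeneous_closed)

lemma homogeneous_negative: "f \<in> homogeneous_polynomials V k \<Longrightarrow> k < 0 \<Longrightarrow> f = 0"
  unfolding homogeneous_iff by (intro poly_mapping_eqI) (metis lookup_zero not_less of_nat_0_le_iff)

lemma homogeneous_constant_term:
  assumes "f \<in> homogeneous_polynomials V 0"
  shows "f = Poly_Mapping.single 0 (Poly_Mapping.lookup f 0)"
proof (rule poly_mapping_eqI)
  fix m
  show "Poly_Mapping.lookup f m = Poly_Mapping.lookup (Poly_Mapping.single 0 (Poly_Mapping.lookup f 0)) m"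
    using assms unfolding homogeneous_iff lookup_single when_def
    by (metis int_eq_iff_numeral monom_degree_eq_0 of_nat_eq_0_iff)
qed

lemma partial_derivative_homogeneous:
  assumes "f \<in> homogeneous_polynomials V k"
  shows "partial_derivative v f \<in> homogeneous_polynomials V (k - 1)"
  unfolding homogeneous_iff
proof (intro allI impI)
  fix m assume "Poly_Mapping.lookup (partial_derivative v f) m \<noteq> 0"
  then have "Poly_Mapping.lookup f (Poly_Mapping.single v (Suc 0) + m) \<noteq> 0"
    by (auto simp: lookup_partial_derivative)
  then have "Poly_Mapping.keys (Poly_Mapping.single v (Suc 0) + m) \<subseteq> V"
    "int (monom_degree (Poly_Mapping.single v (Suc 0) + m)) = k"
    using assms unfolding homogeneous_iff by blast+
  moreover have "Poly_Mapping.keys m \<subseteq> Poly_Mapping.keys (Poly_Mapping.single v (Suc 0) + m)"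
    by (auto simp: in_keys_iff lookup_add)
  ultimately show "Poly_Mapping.keys m \<subseteq> V \<and> int (monom_degree m) = k - 1"
    by (auto simp: monom_degree_add)
qed

text \<open>It keeps the homotopy made of all partial derivatives supported on lists over V.\<close>

lemma partial_derivative_outside:
  assumes "f \<in> polynomials_in V" "v \<notin> V"
  shows "partial_derivative v f = 0"
proof (rule poly_mapping_eqI)
  fix m
  have "v \<in> Poly_Mapping.keys (Poly_Mapping.single v (Suc 0) + m)"
    unfolding in_keys_iff lookup_add by simp
  then have "Poly_Mapping.single v (Suc 0) + m \<notin> Poly_Mapping.keys f"
    using assms unfolding polynomials_in_def by blast
  then show "Poly_Mapping.lookup (partial_derivative v f) m = Poly_Mapping.lookup 0 m"
    by (simp add: lookup_partial_derivative in_keys_iff)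
qed

lemma euler_identity:
  assumes "finite V" "f \<in> homogeneous_polynomials V k"
  shows "(\<Sum>v\<in>V. var v * partial_derivative v f) = Poly_Mapping.single 0 (of_int k) * f"
proof (rule poly_mapping_eqI)
  fix m
  have "Poly_Mapping.lookup (\<Sum>v\<in>V. var v * partial_derivative v f) m =
      of_nat (\<Sum>v\<in>V. Poly_Mapping.lookup m v) * Poly_Mapping.lookup f m"
    by (simp only: lookup_sum lookup_var_partial_derivative of_nat_sum sum_distrib_right)
  also have "\<dots> = of_int k * Poly_Mapping.lookup f m"
  proof (cases "Poly_Mapping.lookup f m = 0")
    case False
    then have "Poly_Mapping.keys m \<subseteq> V" "int (monom_degree m) = k"
      using assms(2) unfolding homogeneous_iff by blast+
    then have "int (\<Sum>v\<in>V. Poly_Mapping.lookup m v) = k"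
      using monom_degree_superset [OF assms(1)] by simp
    then show ?thesis by (metis of_int_of_nat_eq)
  qed simp
  finally show "Poly_Mapping.lookup (\<Sum>v\<in>V. var v * partial_derivative v f) m =
      Poly_Mapping.lookup (Poly_Mapping.single 0 (of_int k) * f) m"
    by (simp only: lookup_scale)
qed

section \<open>Graded free modules\<close>

lemma fun_sum_apply: "(sum f A) x = (\<Sum>a\<in>A. f a x)"
  by (induction A rule: infinite_finite_induct) simp_all

lemma fun_minus_apply: "(f - g) x = f x - (g x :: 'a::ab_group_add)" "(- f) x = - f x"
  by (simp_all add: fun_diff_def fun_Compl_def)

abbreviation free_carrier :: "'v set \<Rightarrow> int list \<Rightarrow> (nat \<Rightarrow> 'v mpoly) set" where
  "free_carrier V as \<equiv> carrier (graded_free_module V as)"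

abbreviation free_component :: "'v set \<Rightarrow> int list \<Rightarrow> int \<Rightarrow> (nat \<Rightarrow> 'v mpoly) set" where
  "free_component V as \<equiv> component (graded_free_module V as)"

definition free_action :: "'v \<Rightarrow> (nat \<Rightarrow> 'v mpoly) \<Rightarrow> nat \<Rightarrow> 'v mpoly" where
  "free_action v u = (\<lambda>j. var v * u j)"

lemma free_carrier_iff:
  "u \<in> free_carrier V as \<longleftrightarrow> (\<forall>j<length as. u j \<in> polynomials_in V) \<and> (\<forall>j\<ge>length as. u j = 0)"
  by (simp add: graded_free_module_def)

lemma free_component_iff:
  "u \<in> free_component V as e \<longleftrightarrow>
     (\<forall>j<length as. u j \<in> homogeneous_polynomials V (e - as ! j)) \<and> (\<forall>j\<ge>length as. u j = 0)"
  by (simp add: graded_free_module_def)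

lemma poly_double_zero: "f + f = (0 :: 'v mpoly) \<Longrightarrow> f = 0"
proof (rule poly_mapping_eqI)
  fix m assume "f + f = 0"
  then have "Poly_Mapping.lookup f m + Poly_Mapping.lookup f m = 0" by (metis lookup_add lookup_zero)
  then show "Poly_Mapping.lookup f m = Poly_Mapping.lookup 0 m" by simp
qed

lemma graded_action_free:
  assumes "finite V"
  shows "graded_action free_action V (free_component V as)"
  unfolding graded_action_def
proof (intro conjI allI ballI impI)
  show "finite V" by (rule assms)
  fix x y :: "nat \<Rightarrow> 'a mpoly" and u v e
  show "x = 0" if "x + x = 0"
  proof
    fix j
    have "x j + x j = 0" using that by (metis plus_fun_apply zero_fun_apply)
    from poly_double_zero [OF this] show "x j = 0 j" by simp
  qed
  show "free_action v (x + y) = free_action v x + free_action v y"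
    by (auto simp: free_action_def algebra_simps)
  show "free_action u (free_action v x) = free_action v (free_action u x)"
    by (simp add: free_action_def mult.left_commute)
  show "0 \<in> free_component V as e" by (simp add: free_component_iff homogeneous_closed)
  show "x - y \<in> free_component V as e" if "x \<in> free_component V as e" "y \<in> free_component V as e"
    using that by (simp add: free_component_iff fun_minus_apply homogeneous_closed)
  show "free_action v x \<in> free_component V as (e + 1)" if "v \<in> V" "x \<in> free_component V as e"
    using that homogeneous_var_mult [of v V _ "e - as ! _"]
    by (simp add: free_component_iff free_action_def add_diff_eq diff_add_eq)
qed

definition scale_free :: "complex \<Rightarrow> (nat \<Rightarrow> 'v mpoly) \<Rightarrow> nat \<Rightarrow> 'v mpoly" where
  "scale_free c u = (\<lambda>j. Poly_Mapping.single 0 c * u j)"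

interpretation free_vec: vector_space scale_free
  by unfold_locales
    (auto simp: scale_free_def fun_eq_iff distrib_left distrib_right single_add mult_single mult.assoc [symmetric])

text \<open>The homotopy of the de Rham complex: wedging with partial derivatives contracts the
  Koszul complex up to a factor in each coordinate. Only constants in homological degree 0 escape.
  Excluding them through \<open>const\<close> covers both the exactness for i > 0 and, for i = 0,
  values in the irrelevant ideal times the free module.\<close>

lemma free_koszul_exact:
  assumes fin: "finite V" and c: "koszul_chain V (free_component V as) i e c"
    and cyc: "\<And>L. koszul_d free_action V c L = 0"
    and const: "\<And>L j. i = 0 \<Longrightarrow> Poly_Mapping.lookup (c L j) 0 = 0"
  shows "\<exists>c'. koszul_chain V (free_component V as) (Suc i) e c' \<and> koszul_d free_action V c' = c"
proof -
  define w where "w v u = (\<lambda>j::nat. partial_derivative v (u j))" for v :: 'a and u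
  have C: "alternating c" "c L \<in> free_component V as (e - int i)" "c L \<noteq> 0 \<Longrightarrow> length L = i \<and> set L \<subseteq> V" for L
    using c unfolding koszul_chain_def by blast+
  have w0: "w v 0 = 0" for v by (auto simp: w_def partial_derivative_def)
  have wadd: "w v (x + y) = w v x + w v y" for v x y by (auto simp: w_def partial_derivative_add)
  \<comment> \<open>In coordinate j the homotopy formula gives (e - a_j) c: Euler's identity yields
    e - i - a_j, and the count in \<open>koszul_homotopy\<close> adds i. If e = a_j, the quotient is
    0 by convention, and c vanishes in that coordinate.\<close>
  define q where "q j = (if j < length as then 1 / of_int (e - as ! j) else 0 :: complex)" for j
  define c' where "c' L = (\<lambda>j. Poly_Mapping.single 0 (q j) * wedge w c L j)" for L
  have hom: "wedge w c L \<in> free_component V as (e - int (Suc i))" for L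
  proof (rule wedge_in)
    note F = graded_actionD [OF graded_action_free [OF fin, of as]]
    show "0 \<in> free_component V as (e - int (Suc i))" by (rule F(5))
    show "x - y \<in> free_component V as (e - int (Suc i))"
      if "x \<in> free_component V as (e - int (Suc i))" "y \<in> free_component V as (e - int (Suc i))" for x y
      by (rule F(6) [OF that])
    show "w v (c L) \<in> free_component V as (e - int (Suc i))" for v L
      using C(2) [of L] partial_derivative_homogeneous [of "c L _" V "e - int i - as ! _" v]
      by (auto simp: free_component_iff w_def partial_derivative_def algebra_simps)
  qed
  have supp: "length L = Suc i \<and> set L \<subseteq> V" if nz0: "wedge w c L \<noteq> 0" for L
  proof -
    obtain xs b ys where L: "L = xs @ b # ys" and nz: "w b (c (xs @ ys)) \<noteq> 0"
      using wedge_support [of w c L, OF w0 nz0] by blast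
    have "c (xs @ ys) \<noteq> 0" using nz w0 by metis
    then have xy: "length (xs @ ys) = i" "set (xs @ ys) \<subseteq> V" using C(3) by blast+
    have "b \<in> V"
    proof (rule ccontr)
      assume "b \<notin> V"
      have "partial_derivative b (c (xs @ ys) j) = 0" for j
      proof (cases "j < length as")
        case True
        then have "c (xs @ ys) j \<in> polynomials_in V"
          using C(2) [of "xs @ ys"] by (auto simp: free_component_iff homogeneous_polynomials_def)
        then show ?thesis by (rule partial_derivative_outside [OF _ \<open>b \<notin> V\<close>])
      next
        case False
        then show ?thesis
          using C(2) [of "xs @ ys"] by (simp add: free_component_iff partial_derivative_def)
      qed
      then show False using nz by (simp add: w_def zero_fun_def)
    qed
    then show ?thesis using xy L by auto
  qed
  have chain: "koszul_chain V (free_component V as) (Suc i) e c'"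
    unfolding koszul_chain_def
  proof (intro conjI allI impI)
    have alt: "alternating (wedge w c)" by (rule wedge_alternating [OF C(1) wadd])
    show "alternating c'"
      unfolding alternating_def
    proof (intro allI)
      fix xs u v ys
      have "wedge w c (xs @ u # v # ys) = - wedge w c (xs @ v # u # ys)"
        using alt unfolding alternating_def by (elim allE)
      then show "c' (xs @ u # v # ys) = - c' (xs @ v # u # ys)"
        by (simp add: c'_def fun_eq_iff fun_minus_apply)
    qed
    fix L
    show "c' L \<in> free_component V as (e - int (Suc i))"
      using hom [of L] by (auto simp: free_component_iff c'_def intro: homogeneous_scale)
    assume "c' L \<noteq> 0"
    then have "wedge w c L \<noteq> 0" by (auto simp: c'_def zero_fun_def)
    then show "length L = Suc i" "set L \<subseteq> V" using supp by blast+
  qed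
  have "koszul_d free_action V c' L = c L" for L
  proof (cases "c L = 0 \<and> \<not> set L \<subseteq> V")
    case True
    have "c' (v # L) = 0" for v
      using chain True unfolding koszul_chain_def by (metis set_subset_Cons subset_trans)
    then show ?thesis
      using True by (simp add: koszul_d_def graded_actionD(8) [OF graded_action_free [OF fin]])
  next
    case False
    then have L: "set L \<subseteq> V" using C(3) by blast
    have "wedge w (koszul_d free_action V c) L = 0"
    proof -
      have "koszul_d free_action V c = (\<lambda>_. 0)" using cyc by auto
      then show ?thesis by (simp add: wedge_zero [of w, OF w0])
    qed
    moreover have "koszul_d free_action V (wedge w c) L + wedge w (koszul_d free_action V c) L =
      (\<Sum>v\<in>V. free_action v (w v (c L))) + (\<Sum>i<length L. c L)"
    proof (rule koszul_homotopy [where \<kappa> = "\<lambda>x. x", OF C(1) fin L])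
      show "free_action v (x + y) = free_action v x + free_action v y" for v :: 'a and x y
        by (auto simp: free_action_def algebra_simps)
      show "w u (free_action v x) = free_action v (w u x) + (if u = v then x else 0)" for u v x
        by (auto simp: w_def free_action_def partial_derivative_var_mult)
    qed (rule wadd, rule refl)
    ultimately have eq: "koszul_d free_action V (wedge w c) L =
      (\<Sum>v\<in>V. free_action v (w v (c L))) + (\<Sum>i<length L. c L)" by simp
    show ?thesis
    proof
      fix j
      have dj: "koszul_d free_action V c' L j = Poly_Mapping.single 0 (q j) * koszul_d free_action V (wedge w c) L j"
        unfolding koszul_d_def fun_sum_apply
        by (simp add: free_action_def c'_def sum_distrib_left mult.left_commute)
      show "koszul_d free_action V c' L j = c L j"
      proof (cases "j < length as")
        case False
        then have "c L j = 0" "q j = 0" using C(2) [of L] by (auto simp: free_component_iff q_def)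
        then show ?thesis unfolding dj by simp
      next
        case True
        have h: "c L j \<in> homogeneous_polynomials V (e - int i - as ! j)"
          using C(2) [of L] True by (simp add: free_component_iff)
        show ?thesis
        proof (cases "c L j = 0")
          case zero: True
          have "koszul_d free_action V (wedge w c) L j = 0"
            unfolding eq by (simp add: fun_sum_apply free_action_def w_def zero partial_derivative_def)
          then show ?thesis unfolding dj by (simp add: zero)
        next
          case nz: False
          then have "c L \<noteq> 0" by auto
          then have len: "length L = i" using C(3) by blast
          \<comment> \<open>Otherwise the coordinate has degree -i: it is zero for i > 0, and for i
            = 0 it is a constant, which \<open>const\<close> excludes.\<close>
          have ne: "e - as ! j \<noteq> 0"
          proof
            assume ea: "e - as ! j = 0"
            show False
            proof (cases "i = 0")
              case True
              then have "c L j = Poly_Mapping.single 0 (Poly_Mapping.lookup (c L j) 0)"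
                using h ea by (intro homogeneous_constant_term [of _ V]) simp
              then show False using nz const [OF True] by simp
            next
              case False
              then show False using homogeneous_negative [OF h] ea nz by simp
            qed
          qed
          have "koszul_d free_action V (wedge w c) L j =
              (\<Sum>v\<in>V. var v * partial_derivative v (c L j)) + (\<Sum>k<i. c L j)"
            unfolding eq by (simp add: fun_sum_apply free_action_def w_def len)
          also have "\<dots> = Poly_Mapping.single 0 (of_int (e - int i - as ! j)) * c L j +
              Poly_Mapping.single 0 (of_nat i) * c L j"
            unfolding euler_identity [OF fin h] by simp
          also have "\<dots> = Poly_Mapping.single 0 (of_int (e - as ! j)) * c L j"
          proof -
            have "of_int (e - int i - as ! j) + of_nat i = (of_int (e - as ! j) :: complex)" by simp
            then show ?thesis by (simp only: distrib_right [symmetric] single_add [symmetric])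
          qed
          finally have "koszul_d free_action V c' L j =
              Poly_Mapping.single 0 (q j * of_int (e - as ! j)) * c L j"
            unfolding dj by (simp only: mult.assoc [symmetric] mult_single add_0)
          moreover have "q j * of_int (e - as ! j) = 1" using True ne by (simp add: q_def)
          ultimately show ?thesis by simp
        qed
      qed
    qed
  qed
  then have "koszul_d free_action V c' = c" by (rule ext)
  with chain show ?thesis by blast
qed

lemma koszul_vanishes_free:
  assumes "finite V"
  shows "koszul_vanishes free_action V (free_component V as) (Suc i) e"
  by (rule koszul_vanishesI) (rule free_koszul_exact [OF assms]; simp)

section \<open>Decomposition into homogeneous parts\<close>

definition homogeneous_part :: "int \<Rightarrow> 'v mpoly \<Rightarrow> 'v mpoly" where
  "homogeneous_part k f = (\<Sum>m\<in>{m \<in> Poly_Mapping.keys f. int (monom_degree m) = k}.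
     Poly_Mapping.single m (Poly_Mapping.lookup f m))"

lemma lookup_homogeneous_part:
  "Poly_Mapping.lookup (homogeneous_part k f) m =
     (if int (monom_degree m) = k then Poly_Mapping.lookup f m else 0)"
  unfolding homogeneous_part_def lookup_sum lookup_single when_def
  by (auto simp: in_keys_iff)

lemma homogeneous_part_add: "homogeneous_part k (f + g) = homogeneous_part k f + homogeneous_part k g"
  by (rule poly_mapping_eqI) (simp add: lookup_homogeneous_part lookup_add)

lemma homogeneous_part_homogeneous:
  "f \<in> polynomials_in V \<Longrightarrow> homogeneous_part k f \<in> homogeneous_polynomials V k"
  by (auto simp: homogeneous_iff lookup_homogeneous_part polynomials_in_def in_keys_iff split: if_splits)

lemma homogeneous_part_of_homogeneous:
  "f \<in> homogeneous_polynomials V k \<Longrightarrow> homogeneous_part l f = (if l = k then f else 0)"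
  by (rule poly_mapping_eqI) (auto simp: homogeneous_iff lookup_homogeneous_part)

lemma sum_homogeneous_parts:
  assumes "finite D" "(\<lambda>m. int (monom_degree m)) ` Poly_Mapping.keys f \<subseteq> D"
  shows "f = (\<Sum>k\<in>D. homogeneous_part k f)"
proof (rule poly_mapping_eqI)
  fix m
  show "Poly_Mapping.lookup f m = Poly_Mapping.lookup (\<Sum>k\<in>D. homogeneous_part k f) m"
    using assms by (auto simp: lookup_sum lookup_homogeneous_part in_keys_iff image_subset_iff)
qed

definition free_part :: "int list \<Rightarrow> int \<Rightarrow> (nat \<Rightarrow> 'v mpoly) \<Rightarrow> nat \<Rightarrow> 'v mpoly" where
  "free_part as e u = (\<lambda>j. if j < length as then homogeneous_part (e - as ! j) (u j) else 0)"

lemma free_part_add: "free_part as e (u + v) = free_part as e u + free_part as e v"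
  by (auto simp: free_part_def homogeneous_part_add)

lemma free_part_component: "u \<in> free_carrier V as \<Longrightarrow> free_part as e u \<in> free_component V as e"
  by (simp add: free_carrier_iff free_component_iff free_part_def homogeneous_part_homogeneous)

lemma free_part_of_component:
  "u \<in> free_component V as e \<Longrightarrow> free_part as e' u = (if e' = e then u else 0)"
  by (auto simp: free_component_iff free_part_def fun_eq_iff homogeneous_part_of_homogeneous)

lemma free_component_subset: "u \<in> free_component V as e \<Longrightarrow> u \<in> free_carrier V as"
  by (simp add: free_component_iff free_carrier_iff homogeneous_polynomials_def)

lemma free_carrier_sum_parts:
  assumes "u \<in> free_carrier V as"
  shows "\<exists>D. finite D \<and> u = (\<Sum>e\<in>D. free_part as e u)"
proof -
  let ?D = "\<Union>j<length as. (\<lambda>m. int (monom_degree m) + as ! j) ` Poly_Mapping.keys (u j)"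
  have fin: "finite ?D" by auto
  have "u j = (\<Sum>e\<in>?D. free_part as e u) j" for j
  proof (cases "j < length as")
    case True
    have "u j = (\<Sum>k\<in>(\<lambda>e. e - as ! j) ` ?D. homogeneous_part k (u j))"
    proof (rule sum_homogeneous_parts)
      show "(\<lambda>m. int (monom_degree m)) ` Poly_Mapping.keys (u j) \<subseteq> (\<lambda>e. e - as ! j) ` ?D"
      proof (intro image_subsetI)
        fix m assume "m \<in> Poly_Mapping.keys (u j)"
        then have "int (monom_degree m) + as ! j \<in> ?D" using True by auto
        then have "int (monom_degree m) + as ! j - as ! j \<in> (\<lambda>e. e - as ! j) ` ?D" by (rule imageI)
        then show "int (monom_degree m) \<in> (\<lambda>e. e - as ! j) ` ?D" by simp
      qed
    qed (use fin in simp)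
    also have "\<dots> = (\<Sum>e\<in>?D. homogeneous_part (e - as ! j) (u j))"
      by (subst sum.reindex) (auto simp: inj_on_def)
    finally show ?thesis using True by (simp add: fun_sum_apply free_part_def)
  next
    case False
    then show ?thesis using assms by (simp add: fun_sum_apply free_part_def free_carrier_iff)
  qed
  then have "u = (\<Sum>e\<in>?D. free_part as e u)" by (rule ext)
  with fin show ?thesis by blast
qed

section \<open>Minimal covers\<close>

text \<open>K_0 is M modulo the image of the variables: a 0-chain is its value at the empty list,
  where a boundary only involves lists of length one. Vanishing in degree e means that no generator
  of degree e is needed.\<close>

lemma koszul_vanishes_0D:
  assumes van: "koszul_vanishes X V M 0 e" and x: "x \<in> M e" and z: "\<And>j. 0 \<in> M j" "\<And>v. X v 0 = 0"
  shows "\<exists>y. (\<forall>v\<in>V. y v \<in> M (e - 1)) \<and> x = (\<Sum>v\<in>V. X v (y v))"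
proof -
  let ?c = "\<lambda>L. if L = [] then x else 0"
  have "koszul_chain V M 0 e ?c"
    unfolding koszul_chain_def alternating_def using x z by simp
  moreover have "koszul_d X V ?c L = 0" for L by (simp add: koszul_d_def z)
  ultimately obtain c' where c': "koszul_chain V M (Suc 0) e c'" "koszul_d X V c' = ?c"
    by (rule koszul_vanishesE [OF van])
  have "x = koszul_d X V c' []" by (simp add: c'(2))
  then have "x = (\<Sum>v\<in>V. X v (c' [v]))" by (simp add: koszul_d_def)
  moreover have "c' L \<in> M (e - int (Suc 0))" for L
    using c'(1) unfolding koszul_chain_def by blast
  ultimately show ?thesis by (intro exI [of _ "\<lambda>v. c' [v]"]) simp
qed

lemma koszul_vanishes_0I:
  assumes "\<And>x. x \<in> M e \<Longrightarrow> \<exists>y. (\<forall>v\<in>V. y v \<in> M (e - 1)) \<and> x = (\<Sum>v\<in>V. X v (y v))"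
    and z: "\<And>j. 0 \<in> M j" "\<And>v. X v 0 = 0"
  shows "koszul_vanishes X V M 0 e"
proof (rule koszul_vanishesI)
  fix c assume c: "koszul_chain V M 0 e c"
  have "c [] \<in> M (e - int 0)" using c unfolding koszul_chain_def by blast
  then obtain y where y: "\<forall>v\<in>V. y v \<in> M (e - 1)" "c [] = (\<Sum>v\<in>V. X v (y v))"
    using assms(1) [of "c []"] by auto
  let ?c' = "\<lambda>L. case L of [v] \<Rightarrow> if v \<in> V then y v else 0 | _ \<Rightarrow> 0"
  have "koszul_chain V M (Suc 0) e ?c'"
    unfolding koszul_chain_def
  proof (intro conjI allI impI)
    show "alternating ?c'"
      unfolding alternating_def
    proof (intro allI)
      fix xs u v ys
      show "?c' (xs @ u # v # ys) = - ?c' (xs @ v # u # ys)"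
        by (cases xs; cases "tl xs") simp_all
    qed
    fix L
    show "?c' L \<in> M (e - int (Suc 0))" using y(1) z(1) by (auto split: list.split)
    assume "?c' L \<noteq> 0"
    then show "length L = Suc 0" "set L \<subseteq> V" by (auto split: list.splits if_splits)
  qed
  moreover have "koszul_d X V ?c' L = c L" for L
  proof (cases L)
    case Nil
    then show ?thesis by (simp add: koszul_d_def y(2))
  next
    case (Cons u us)
    then have "c L = 0" using c unfolding koszul_chain_def by (metis length_0_conv list.distinct(1))
    then show ?thesis by (simp add: koszul_d_def Cons z)
  qed
  then have "koszul_d X V ?c' = c" by (rule ext)
  ultimately show "\<exists>c'. koszul_chain V M (Suc 0) e c' \<and> koszul_d X V c' = c" by blast
qed

lemma finite_monomials:
  assumes "finite V"
  shows "finite {m :: 'v \<Rightarrow>\<^sub>0 nat. Poly_Mapping.keys m \<subseteq> V \<and> monom_degree m = k}" (is "finite ?S")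
proof -
  let ?f = "\<lambda>m. restrict (Poly_Mapping.lookup m) V"
  have "?f ` ?S \<subseteq> V \<rightarrow>\<^sub>E {0..k}"
  proof (intro image_subsetI PiE_I)
    fix m :: "'v \<Rightarrow>\<^sub>0 nat" and v assume m: "m \<in> ?S" and v: "v \<in> V"
    have "Poly_Mapping.lookup m v \<le> (\<Sum>v\<in>V. Poly_Mapping.lookup m v)"
      using assms v by (intro member_le_sum) auto
    then show "?f m v \<in> {0..k}" using m v monom_degree_superset [OF assms, of m] by simp
  qed simp
  then have "finite (?f ` ?S)" by (rule finite_subset) (simp add: finite_PiE assms)
  moreover have "inj_on ?f ?S"
  proof (rule inj_onI, rule poly_mapping_eqI)
    fix a b v assume ab: "a \<in> ?S" "b \<in> ?S" "?f a = ?f b"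
    show "Poly_Mapping.lookup a v = Poly_Mapping.lookup b v"
    proof (cases "v \<in> V")
      case True
      then show ?thesis using fun_cong [OF ab(3), of v] by simp
    next
      case False
      then have "v \<notin> Poly_Mapping.keys a" "v \<notin> Poly_Mapping.keys b" using ab by blast+
      then show ?thesis by (simp add: in_keys_iff)
    qed
  qed
  ultimately show ?thesis by (rule finite_imageD)
qed

lemma free_component_finite_span:
  assumes "finite V"
  shows "\<exists>T. finite T \<and> free_component V as e \<subseteq> free_vec.span T"
proof -
  define b where "b j m = (\<lambda>k. if k = j then Poly_Mapping.single m 1 else 0 :: 'a mpoly)" for j :: nat and m
  define T where "T = (\<Union>j<length as. b j ` {m. Poly_Mapping.keys m \<subseteq> V \<and> monom_degree m = nat (e - as ! j)})"
  have "finite T" unfolding T_def using finite_monomials [OF assms] by blast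
  moreover have "x \<in> free_vec.span T" if x: "x \<in> free_component V as e" for x
  proof -
    have "x = (\<Sum>j<length as. \<Sum>m\<in>Poly_Mapping.keys (x j). scale_free (Poly_Mapping.lookup (x j) m) (b j m))"
    proof
      fix k
      have inner: "(\<Sum>m\<in>Poly_Mapping.keys (x j). scale_free (Poly_Mapping.lookup (x j) m) (b j m)) k =
          (if k = j then x k else 0)" for j
      proof (cases "k = j")
        case True
        then show ?thesis
          unfolding fun_sum_apply scale_free_def b_def
          by (simp add: mult_single poly_mapping_expansion [symmetric])
      qed (simp add: fun_sum_apply scale_free_def b_def)
      show "x k = (\<Sum>j<length as. \<Sum>m\<in>Poly_Mapping.keys (x j). scale_free (Poly_Mapping.lookup (x j) m) (b j m)) k"
        using x unfolding fun_sum_apply [of _ "{..<length as}"] inner by (simp add: free_component_iff)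
    qed
    also have "\<dots> \<in> free_vec.span T"
    proof (intro free_vec.span_sum free_vec.span_scale free_vec.span_base)
      fix j m assume j: "j \<in> {..<length as}" and m: "m \<in> Poly_Mapping.keys (x j)"
      then have "x j \<in> homogeneous_polynomials V (e - as ! j)" "Poly_Mapping.lookup (x j) m \<noteq> 0"
        using x by (simp_all add: free_component_iff in_keys_iff)
      then have "Poly_Mapping.keys m \<subseteq> V" "int (monom_degree m) = e - as ! j"
        unfolding homogeneous_iff by blast+
      then have "m \<in> {m. Poly_Mapping.keys m \<subseteq> V \<and> monom_degree m = nat (e - as ! j)}" by simp
      then show "b j m \<in> T" using j unfolding T_def by blast
    qed
    finally show ?thesis .
  qed
  ultimately show ?thesis by blast
qed

definition graded_submodule :: "'v set \<Rightarrow> int list \<Rightarrow> (nat \<Rightarrow> 'v mpoly) set \<Rightarrow> bool" where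
  "graded_submodule V as K \<longleftrightarrow> K \<subseteq> free_carrier V as \<and> 0 \<in> K \<and> (\<forall>u\<in>K. \<forall>v\<in>K. u + v \<in> K) \<and>
     (\<forall>f\<in>polynomials_in V. \<forall>u\<in>K. (\<lambda>j. f * u j) \<in> K) \<and> (\<forall>u\<in>K. \<forall>e. free_part as e u \<in> K)"

lemma graded_submoduleD:
  assumes "graded_submodule V as K"
  shows "u \<in> K \<Longrightarrow> u \<in> free_carrier V as" "0 \<in> K" "u \<in> K \<Longrightarrow> v \<in> K \<Longrightarrow> u + v \<in> K"
    "f \<in> polynomials_in V \<Longrightarrow> u \<in> K \<Longrightarrow> (\<lambda>j. f * u j) \<in> K" "u \<in> K \<Longrightarrow> free_part as e u \<in> K"
  using assms unfolding graded_submodule_def by blast+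

lemma graded_submodule_sum:
  "graded_submodule V as K \<Longrightarrow> (\<And>a. a \<in> A \<Longrightarrow> f a \<in> K) \<Longrightarrow> sum f A \<in> K"
  by (induction A rule: infinite_finite_induct) (simp_all add: graded_submoduleD)

lemma const_polynomial: "Poly_Mapping.single 0 c \<in> polynomials_in V"
  by (auto simp: polynomials_in_def)

lemma homogeneous_polynomial: "f \<in> homogeneous_polynomials V k \<Longrightarrow> f \<in> polynomials_in V"
  by (simp add: homogeneous_polynomials_def)

text \<open>Generators are paired with a degree, which later becomes the shift; the element alone
  would not determine it if it were 0.\<close>

definition combination :: "(int \<times> (nat \<Rightarrow> 'v mpoly)) set \<Rightarrow> (int \<times> (nat \<Rightarrow> 'v mpoly) \<Rightarrow> 'v mpoly) \<Rightarrow> nat \<Rightarrow> 'v mpoly" where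
  "combination A w = (\<lambda>j. \<Sum>p\<in>A. w p * snd p j)"

definition generates ::
    "'v set \<Rightarrow> (int \<Rightarrow> (nat \<Rightarrow> 'v mpoly) set) \<Rightarrow> (int \<times> (nat \<Rightarrow> 'v mpoly)) set \<Rightarrow> bool" where
  "generates V M A \<longleftrightarrow> finite A \<and> (\<forall>p\<in>A. snd p \<in> M (fst p)) \<and>
     (\<forall>e. \<forall>x\<in>M e. \<exists>w. (\<forall>p\<in>A. w p \<in> homogeneous_polynomials V (e - fst p)) \<and> x = combination A w)"

lemma combination_remove:
  "finite A \<Longrightarrow> p \<in> A \<Longrightarrow> combination A w j = w p * snd p j + combination (A - {p}) w j"
  by (simp add: combination_def sum.remove [of A p])

lemma generates_remove:
  assumes gen: "generates V M A" and p: "p \<in> A"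
    and r: "\<And>q. q \<in> A - {p} \<Longrightarrow> r q \<in> homogeneous_polynomials V (fst p - fst q)"
    and eq: "snd p = combination (A - {p}) r"
  shows "generates V M (A - {p})"
  unfolding generates_def
proof (intro conjI allI ballI)
  have fin: "finite A" using gen unfolding generates_def by blast
  then show "finite (A - {p})" by simp
  show "snd q \<in> M (fst q)" if "q \<in> A - {p}" for q using gen that unfolding generates_def by blast
  fix e x assume "x \<in> M e"
  then obtain w where w: "\<And>q. q \<in> A \<Longrightarrow> w q \<in> homogeneous_polynomials V (e - fst q)" "x = combination A w"
    using gen unfolding generates_def by blast
  show "\<exists>w. (\<forall>q\<in>A - {p}. w q \<in> homogeneous_polynomials V (e - fst q)) \<and> x = combination (A - {p}) w"
  proof (intro exI [of _ "\<lambda>q. w p * r q + w q"] conjI ballI)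
    fix q assume q: "q \<in> A - {p}"
    have "w p * r q \<in> homogeneous_polynomials V ((e - fst p) + (fst p - fst q))"
      by (rule homogeneous_mult [OF w(1) [OF p] r [OF q]])
    then show "w p * r q + w q \<in> homogeneous_polynomials V (e - fst q)"
      using w(1) [of q] q by (intro homogeneous_closed) auto
  next
    show "x = combination (A - {p}) (\<lambda>q. w p * r q + w q)"
    proof
      fix j
      show "x j = combination (A - {p}) (\<lambda>q. w p * r q + w q) j"
        unfolding w(2) combination_remove [OF fin p] fun_cong [OF eq, of j]
        by (simp add: combination_def distrib_right sum.distrib sum_distrib_left mult.assoc)
    qed
  qed
qed

lemma combination_action_sum:
  "(\<Sum>v\<in>V. free_action v (combination A (w v))) = combination A (\<lambda>p. \<Sum>v\<in>V. var v * w v p)"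
proof
  fix j
  have "(\<Sum>v\<in>V. free_action v (combination A (w v))) j = (\<Sum>v\<in>V. \<Sum>p\<in>A. var v * w v p * snd p j)"
    by (simp add: fun_sum_apply free_action_def combination_def sum_distrib_left mult.assoc)
  also have "\<dots> = combination A (\<lambda>p. \<Sum>v\<in>V. var v * w v p) j"
    unfolding combination_def sum_distrib_right by (rule sum.swap)
  finally show "(\<Sum>v\<in>V. free_action v (combination A (w v))) j =
      combination A (\<lambda>p. \<Sum>v\<in>V. var v * w v p) j" .
qed

text \<open>
  In place of Noetherianity: vanishing of \<open>K\<^sub>0\<close> in large degrees bounds the degrees of the
  generators, and each component is finite-dimensional.
\<close>

lemma generating_set_exists:
  fixes V :: "'v set"
  assumes fin: "finite V" and K: "graded_submodule V as K"
    and bound: "\<And>e. e > bnd \<Longrightarrow> koszul_vanishes free_action V (\<lambda>e. K \<inter> free_component V as e) 0 e"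
  shows "\<exists>A. generates V (\<lambda>e. K \<inter> free_component V as e) A"
proof -
  let ?M = "\<lambda>e. K \<inter> free_component V as e"
  note F = graded_actionD [OF graded_action_free [OF fin, of as]]
  have z: "0 \<in> ?M e" for e using graded_submoduleD(2) [OF K] F(5) by blast
  have "\<forall>e. \<exists>T. finite T \<and> T \<subseteq> ?M e \<and> (\<forall>x\<in>?M e. \<exists>c. x = (\<lambda>j. \<Sum>t\<in>T. Poly_Mapping.single 0 (c t) * t j))"
  proof
    fix e
    obtain S where S: "finite S" "free_component V as e \<subseteq> free_vec.span S"
      using free_component_finite_span [OF fin] by blast
    obtain T where T: "T \<subseteq> ?M e" "free_vec.independent T" "?M e \<subseteq> free_vec.span T"
      using free_vec.maximal_independent_subset by blast
    have finT: "finite T"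
      using free_vec.independent_span_bound [OF S(1) T(2)] T(1) S(2) by blast
    have "\<exists>c. x = (\<lambda>j. \<Sum>t\<in>T. Poly_Mapping.single 0 (c t) * t j)" if "x \<in> ?M e" for x
    proof -
      have "x \<in> free_vec.span T" using that T(3) by blast
      then obtain c where "x = (\<Sum>t\<in>T. scale_free (c t) t)"
        unfolding free_vec.span_finite [OF finT] by blast
      then have "x = (\<lambda>j. \<Sum>t\<in>T. Poly_Mapping.single 0 (c t) * t j)"
        by (auto simp: fun_sum_apply scale_free_def)
      then show ?thesis by blast
    qed
    with finT T(1) show "\<exists>T. finite T \<and> T \<subseteq> ?M e \<and> (\<forall>x\<in>?M e. \<exists>c. x = (\<lambda>j. \<Sum>t\<in>T. Poly_Mapping.single 0 (c t) * t j))"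
      by blast
  qed
  from choice [OF this] obtain T where "\<forall>e. finite (T e) \<and> T e \<subseteq> ?M e \<and>
    (\<forall>x\<in>?M e. \<exists>c. x = (\<lambda>j. \<Sum>t\<in>T e. Poly_Mapping.single 0 (c t) * t j))" ..
  then have T: "finite (T e)" "T e \<subseteq> ?M e"
    "x \<in> ?M e \<Longrightarrow> \<exists>c. x = (\<lambda>j. \<Sum>t\<in>T e. Poly_Mapping.single 0 (c t) * t j)" for e x
    by simp_all
  \<comment> \<open>Below e0, hence below every shift, all components are 0, and the induction on
    the degree ends there. The inserted 0 only makes \<open>Min\<close> meaningful for an empty list
    of shifts.\<close>
  define e0 where "e0 = Min (insert 0 (set as))"
  have low: "x = 0" if "x \<in> ?M e" "e < e0" for x e
  proof
    fix j
    show "x j = 0 j"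
    proof (cases "j < length as")
      case True
      then have "e0 \<le> as ! j" unfolding e0_def by (intro Min_le) auto
      then have "e - as ! j < 0" using that(2) by simp
      moreover have "x j \<in> homogeneous_polynomials V (e - as ! j)"
        using that(1) True by (simp add: free_component_iff)
      ultimately show ?thesis using homogeneous_negative [of "x j" V "e - as ! j"] by simp
    next
      case False
      then show ?thesis using that(1) by (simp add: free_component_iff)
    qed
  qed
  define A where "A = (SIGMA e:{e0..bnd}. T e)"
  have finA: "finite A" unfolding A_def using T(1) by auto
  have gen: "\<exists>w. (\<forall>p\<in>A. w p \<in> homogeneous_polynomials V (e - fst p)) \<and> x = combination A w"
    if "x \<in> ?M e" for e x
    using that
  proof (induction "nat (e - e0 + 1)" arbitrary: e x rule: less_induct)
    case less
    show ?case
    proof (cases "e < e0")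
      case True
      then have "x = 0" using low less.prems by blast
      then show ?thesis
        by (intro exI [of _ "\<lambda>_. 0"]) (auto simp: homogeneous_closed combination_def)
    next
      case e0: False
      show ?thesis
      proof (cases "e \<le> bnd")
        case True
        obtain c where c: "x = (\<lambda>j. \<Sum>t\<in>T e. Poly_Mapping.single 0 (c t) * t j)"
          using T(3) [OF less.prems] by blast
        let ?w = "\<lambda>p. if fst p = e then Poly_Mapping.single 0 (c (snd p)) else 0"
        have "combination A ?w j = x j" for j
        proof -
          have "combination A ?w j = (\<Sum>a\<in>{e0..bnd}. \<Sum>t\<in>T a. (if a = e then Poly_Mapping.single 0 (c t) else 0) * t j)"
            unfolding combination_def A_def using T(1) by (subst sum.Sigma) (auto simp: case_prod_beta)
          also have "\<dots> = (\<Sum>a\<in>{e0..bnd}. if a = e then x j else 0)"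
            by (intro sum.cong refl) (simp add: c)
          also have "\<dots> = x j" using e0 True by simp
          finally show ?thesis .
        qed
        then have "x = combination A ?w" by (intro ext) simp
        moreover have "\<forall>p\<in>A. ?w p \<in> homogeneous_polynomials V (e - fst p)"
          by (simp add: homogeneous_const homogeneous_closed)
        ultimately show ?thesis by (intro exI [of _ ?w] conjI)
      next
        case False
        then have van: "koszul_vanishes free_action V ?M 0 e" by (intro bound) simp
        obtain y where y: "\<And>v. v \<in> V \<Longrightarrow> y v \<in> ?M (e - 1)" "x = (\<Sum>v\<in>V. free_action v (y v))"
          using koszul_vanishes_0D [OF van less.prems z F(8)] by blast
        have "\<forall>v\<in>V. \<exists>w. (\<forall>p\<in>A. w p \<in> homogeneous_polynomials V (e - 1 - fst p)) \<and> y v = combination A w"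
          using e0 by (intro ballI less.hyps y(1)) simp_all
        from bchoice [OF this] obtain w where
          "\<forall>v\<in>V. (\<forall>p\<in>A. w v p \<in> homogeneous_polynomials V (e - 1 - fst p)) \<and> y v = combination A (w v)" ..
        then have w: "v \<in> V \<Longrightarrow> p \<in> A \<Longrightarrow> w v p \<in> homogeneous_polynomials V (e - 1 - fst p)"
          "v \<in> V \<Longrightarrow> y v = combination A (w v)" for v p
          by blast+
        have "x = (\<Sum>v\<in>V. free_action v (combination A (w v)))"
          unfolding y(2) by (intro sum.cong refl) (simp add: w(2))
        then have "x = combination A (\<lambda>p. \<Sum>v\<in>V. var v * w v p)"
          unfolding combination_action_sum .
        moreover have "(\<Sum>v\<in>V. var v * w v p) \<in> homogeneous_polynomials V (e - fst p)" if "p \<in> A" for p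
        proof (rule homogeneous_sum)
          fix v assume "v \<in> V"
          from homogeneous_var_mult [OF this w(1) [OF this \<open>p \<in> A\<close>]]
          show "var v * w v p \<in> homogeneous_polynomials V (e - fst p)" by simp
        qed
        ultimately show ?thesis by (intro exI [of _ "\<lambda>p. \<Sum>v\<in>V. var v * w v p"] conjI ballI)
      qed
    qed
  qed
  have "generates V ?M A"
    unfolding generates_def
  proof (intro conjI allI ballI)
    show "snd p \<in> ?M (fst p)" if "p \<in> A" for p
      using that T(2) [of "fst p"] unfolding A_def by auto
  qed (fact finA, fact gen)
  then show ?thesis by blast
qed

lemma graded_homD:
  assumes "h \<in> graded_hom (polynomial_ring V) (graded_free_module V as) N"
  shows "u \<in> free_carrier V as \<Longrightarrow> h u \<in> carrier N"
    "u \<in> free_carrier V as \<Longrightarrow> v \<in> free_carrier V as \<Longrightarrow> h (u + v) = h u \<oplus>\<^bsub>N\<^esub> h v"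
    "f \<in> polynomials_in V \<Longrightarrow> u \<in> free_carrier V as \<Longrightarrow> h (\<lambda>j. f * u j) = f \<odot>\<^bsub>N\<^esub> h u"
    "u \<in> free_component V as e \<Longrightarrow> h u \<in> component N e"
  using assms by (auto simp: graded_hom_def polynomial_ring_def graded_free_module_def plus_fun_def)

lemma free_module_ops:
  "u \<oplus>\<^bsub>graded_free_module V as\<^esub> v = u + v" "f \<odot>\<^bsub>graded_free_module V as\<^esub> u = (\<lambda>j. f * u j)"
  "\<zero>\<^bsub>graded_free_module V as\<^esub> = 0"
  by (auto simp: graded_free_module_def)

lemma free_carrier_add: "u \<in> free_carrier V as \<Longrightarrow> v \<in> free_carrier V as \<Longrightarrow> u + v \<in> free_carrier V as"
  by (simp add: free_carrier_iff polynomials_in_closed)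

lemma free_carrier_zero: "0 \<in> free_carrier V as"
  by (simp add: free_carrier_iff polynomials_in_closed)

lemma free_carrier_smult: "f \<in> polynomials_in V \<Longrightarrow> u \<in> free_carrier V as \<Longrightarrow> (\<lambda>j. f * u j) \<in> free_carrier V as"
  by (simp add: free_carrier_iff polynomials_in_closed)

lemma free_carrier_sum: "(\<And>a. a \<in> A \<Longrightarrow> f a \<in> free_carrier V as) \<Longrightarrow> sum f A \<in> free_carrier V as"
  by (induction A rule: infinite_finite_induct) (simp_all add: free_carrier_add free_carrier_zero)

lemma free_part_zero: "free_part as e 0 = 0"
  by (auto simp: free_part_def homogeneous_part_def)

lemma free_part_sum: "free_part as e (sum f A) = (\<Sum>a\<in>A. free_part as e (f a))"
  by (induction A rule: infinite_finite_induct)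
    (simp_all only: sum.infinite sum.empty sum.insert free_part_add free_part_zero not_False_eq_True)

text \<open>The projections \<pi> of the target are left abstract because the target is either a
  free module (\<open>free_part\<close>) or the section module
  (\<open>section_part\<close>).\<close>

lemma graded_map_part:
  fixes h :: "(nat \<Rightarrow> 'v mpoly) \<Rightarrow> 'b::ab_group_add"
  assumes u: "u \<in> free_carrier V as"
    and add: "\<And>u v. u \<in> free_carrier V as \<Longrightarrow> v \<in> free_carrier V as \<Longrightarrow> h (u + v) = h u + h v"
    and part: "\<And>e u e'. u \<in> free_component V as e \<Longrightarrow> \<pi> e' (h u) = (if e' = e then h u else 0)"
    and padd: "\<And>x y. \<pi> e (x + y) = \<pi> e x + \<pi> e y"
  shows "h (free_part as e u) = \<pi> e (h u)"
proof -
  have h0: "h 0 = 0" using add [OF free_carrier_zero free_carrier_zero] by simp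
  have p0: "\<pi> e 0 = 0" using padd [of 0 0] by simp
  have hsum: "h (sum f A) = (\<Sum>a\<in>A. h (f a))" if "\<And>a. a \<in> A \<Longrightarrow> f a \<in> free_carrier V as" for f and A :: "int set"
    using that by (induction A rule: infinite_finite_induct) (simp_all add: h0 add free_carrier_sum)
  have psum: "\<pi> e (sum f A) = (\<Sum>a\<in>A. \<pi> e (f a))" for f and A :: "int set"
    by (induction A rule: infinite_finite_induct) (simp_all add: p0 padd)
  obtain D where D: "finite D" "u = (\<Sum>e\<in>D. free_part as e u)"
    using free_carrier_sum_parts [OF u] by blast
  have comp: "free_part as k u \<in> free_component V as k" for k by (rule free_part_component [OF u])
  have "h u = (\<Sum>k\<in>D. h (free_part as k u))"
    by (subst D(2), rule hsum) (rule free_component_subset [OF comp])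
  then have "\<pi> e (h u) = (\<Sum>k\<in>D. if e = k then h (free_part as k u) else 0)"
    by (simp add: psum part [OF comp])
  also have "\<dots> = (if e \<in> D then h (free_part as e u) else 0)" using D(1) by simp
  also have "\<dots> = h (free_part as e u)"
  proof (cases "e \<in> D")
    case False
    have "free_part as e u = (\<Sum>k\<in>D. free_part as e (free_part as k u))"
      by (subst D(2)) (rule free_part_sum)
    also have "\<dots> = 0" using False by (intro sum.neutral) (auto simp: free_part_of_component [OF comp])
    finally show ?thesis using False h0 by simp
  qed simp
  finally show ?thesis by simp
qed

lemma graded_hom_free_part:
  assumes "h \<in> graded_hom (polynomial_ring V) (graded_free_module V as) (graded_free_module V bs)"
    and "u \<in> free_carrier V as"
  shows "h (free_part as e u) = free_part bs e (h u)"
proof (rule graded_map_part [where \<pi> = "free_part bs", OF assms(2)])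
  note H = graded_homD [OF assms(1)]
  show "h (u + v) = h u + h v" if "u \<in> free_carrier V as" "v \<in> free_carrier V as" for u v
    using H(2) [OF that] unfolding free_module_ops .
  show "free_part bs e' (h u) = (if e' = e then h u else 0)" if "u \<in> free_component V as e" for e u e'
    by (rule free_part_of_component [OF H(4) [OF that]])
qed (rule free_part_add)

lemma graded_submodule_kernel:
  fixes h :: "(nat \<Rightarrow> 'v mpoly) \<Rightarrow> 'b::ab_group_add"
  assumes add: "\<And>u v. u \<in> free_carrier V as \<Longrightarrow> v \<in> free_carrier V as \<Longrightarrow> h (u + v) = h u + h v"
    and smult: "\<And>f u. f \<in> polynomials_in V \<Longrightarrow> u \<in> free_carrier V as \<Longrightarrow> h u = 0 \<Longrightarrow> h (\<lambda>j. f * u j) = 0"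
    and part: "\<And>u e. u \<in> free_carrier V as \<Longrightarrow> h u = 0 \<Longrightarrow> h (free_part as e u) = 0"
  shows "graded_submodule V as {u \<in> free_carrier V as. h u = 0}"
proof -
  have "h 0 = 0" using add [OF free_carrier_zero free_carrier_zero] by simp
  then show ?thesis
    unfolding graded_submodule_def
    using assms free_carrier_zero free_carrier_add free_carrier_smult free_component_subset [OF free_part_component]
    by auto
qed

text \<open>Least cardinality of a generating set takes the place of Nakayama's lemma: a relation
  with a nonzero constant coefficient, or a generator in a degree where K_0 vanishes, would express
  one generator by the others, against \<open>generates_remove\<close>.\<close>

lemma minimal_cover:
  fixes V :: "'v set"
  assumes fin: "finite V" and K: "graded_submodule V as K"
    and bound: "\<And>e. e > bnd \<Longrightarrow> koszul_vanishes free_action V (\<lambda>e. K \<inter> free_component V as e) 0 e"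
  obtains bs h where "h \<in> graded_hom (polynomial_ring V) (graded_free_module V bs) (graded_free_module V as)"
    "h ` free_carrier V bs = K"
    "\<And>u j. u \<in> free_carrier V bs \<Longrightarrow> h u = 0 \<Longrightarrow> Poly_Mapping.lookup (u j) 0 = 0"
    "\<And>a. a \<in> set bs \<Longrightarrow> \<not> koszul_vanishes free_action V (\<lambda>e. K \<inter> free_component V as e) 0 a"
proof -
  let ?M = "\<lambda>e. K \<inter> free_component V as e"
  note F = graded_actionD [OF graded_action_free [OF fin, of as]]
  note KD = graded_submoduleD [OF K]
  have z: "0 \<in> ?M e" for e using KD(2) F(5) by blast
  obtain A where A: "generates V ?M A" and least: "\<And>B. generates V ?M B \<Longrightarrow> card A \<le> card B"
    using ex_has_least_nat [of "generates V ?M" _ card] generating_set_exists [OF fin K bound] by blast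
  have finA: "finite A" and memA: "\<And>p. p \<in> A \<Longrightarrow> snd p \<in> ?M (fst p)"
    and genA: "\<And>e x. x \<in> ?M e \<Longrightarrow> \<exists>w. (\<forall>p\<in>A. w p \<in> homogeneous_polynomials V (e - fst p)) \<and> x = combination A w"
    using A unfolding generates_def by blast+
  have irredundant: False if "p \<in> A" "\<And>q. q \<in> A - {p} \<Longrightarrow> r q \<in> homogeneous_polynomials V (fst p - fst q)"
      "snd p = combination (A - {p}) r" for p r
    using least [OF generates_remove [OF A that]] card_Diff1_less [OF finA that(1)] by simp
  obtain ps where ps: "set ps = A" "distinct ps" using finite_distinct_list [OF finA] by blast
  define bs where "bs = map fst ps"
  have len: "length bs = length ps" by (simp add: bs_def)
  define idx where "idx p = (SOME j. j < length ps \<and> ps ! j = p)" for p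
  have idx: "idx p < length ps" "ps ! idx p = p" if "p \<in> A" for p
  proof -
    have "\<exists>j. j < length ps \<and> ps ! j = p" using that unfolding ps(1) [symmetric] in_set_conv_nth .
    from someI_ex [OF this] show "idx p < length ps" "ps ! idx p = p" unfolding idx_def by blast+
  qed
  have idx_nth: "idx (ps ! j) = j" if "j < length ps" for j
    using idx [of "ps ! j"] ps that by (metis nth_eq_iff_index_eq nth_mem)
  define h where "h u = combination A (\<lambda>p. u (idx p))" for u
  have hmem: "h u \<in> K" if u: "u \<in> free_carrier V bs" for u
  proof -
    have "h u = (\<Sum>p\<in>A. (\<lambda>j. u (idx p) * snd p j))"
      by (auto simp: h_def combination_def fun_sum_apply)
    also have "\<dots> \<in> K"
    proof (rule graded_submodule_sum [OF K])
      fix p assume p: "p \<in> A"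
      have "u (idx p) \<in> polynomials_in V" using u idx(1) [OF p] by (simp add: free_carrier_iff len)
      then show "(\<lambda>j. u (idx p) * snd p j) \<in> K" using memA [OF p] by (intro KD(4)) auto
    qed
    finally show ?thesis .
  qed
  have hadd: "h (u + v) = h u + h v" for u v
    by (auto simp: h_def combination_def distrib_right sum.distrib)
  have hsum: "h (sum f D) = (\<Sum>a\<in>D. h (f a))" for f and D :: "int set"
  proof (induction D rule: infinite_finite_induct)
    case empty
    show ?case by (auto simp: h_def combination_def)
  next
    case (infinite D)
    then show ?case by (auto simp: h_def combination_def)
  qed (simp only: sum.insert hadd not_False_eq_True)
  have hcomp: "h u \<in> free_component V as e" if u: "u \<in> free_component V bs e" for u e
    unfolding free_component_iff
  proof (intro conjI allI impI)
    fix j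
    show "h u j \<in> homogeneous_polynomials V (e - as ! j)" if j: "j < length as"
      unfolding h_def combination_def
    proof (rule homogeneous_sum)
      fix p assume p: "p \<in> A"
      have "u (idx p) \<in> homogeneous_polynomials V (e - fst p)"
        using u idx [OF p] by (auto simp: free_component_iff len bs_def)
      moreover have "snd p j \<in> homogeneous_polynomials V (fst p - as ! j)"
        using memA [OF p] j by (simp add: free_component_iff)
      ultimately show "u (idx p) * snd p j \<in> homogeneous_polynomials V (e - as ! j)"
        using homogeneous_mult by fastforce
    qed
    show "h u j = 0" if j: "length as \<le> j"
    proof -
      have "snd p j = 0" if "p \<in> A" for p using memA [OF that] j by (simp add: free_component_iff)
      then show ?thesis by (simp add: h_def combination_def)
    qed
  qed
  have hom: "h \<in> graded_hom (polynomial_ring V) (graded_free_module V bs) (graded_free_module V as)"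
    unfolding graded_hom_def
  proof (intro CollectI conjI ballI allI)
    show "h \<in> free_carrier V bs \<rightarrow> free_carrier V as" using hmem KD(1) by blast
    show "h (f \<odot>\<^bsub>graded_free_module V bs\<^esub> u) = f \<odot>\<^bsub>graded_free_module V as\<^esub> h u" for f u
      unfolding free_module_ops by (simp add: h_def combination_def sum_distrib_left mult.assoc)
  qed (simp_all add: free_module_ops hadd hcomp)
  have onto: "\<exists>u. u \<in> free_component V bs e \<and> h u = x" if x: "x \<in> ?M e" for x e
  proof -
    obtain w where w: "\<And>p. p \<in> A \<Longrightarrow> w p \<in> homogeneous_polynomials V (e - fst p)" "x = combination A w"
      using genA [OF x] by blast
    let ?u = "\<lambda>j. if j < length ps then w (ps ! j) else 0"
    have "h ?u = x"
      unfolding w(2) h_def combination_def by (intro ext sum.cong refl) (simp add: idx)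
    moreover have "?u \<in> free_component V bs e"
      unfolding free_component_iff len
    proof (intro conjI allI impI)
      fix j assume j: "j < length ps"
      then have "ps ! j \<in> A" using ps(1) nth_mem by blast
      then show "?u j \<in> homogeneous_polynomials V (e - bs ! j)" using w(1) j by (simp add: bs_def)
    qed simp
    ultimately show ?thesis by blast
  qed
  have image: "h ` free_carrier V bs = K"
  proof
    show "h ` free_carrier V bs \<subseteq> K" using hmem by blast
    show "K \<subseteq> h ` free_carrier V bs"
    proof
      fix x assume x: "x \<in> K"
      obtain D where D: "x = (\<Sum>e\<in>D. free_part as e x)"
        using free_carrier_sum_parts [OF KD(1) [OF x]] by blast
      have "free_part as e x \<in> ?M e" for e
        using KD(5) [OF x] free_part_component [OF KD(1) [OF x]] by blast
      then have "\<forall>e. \<exists>u. u \<in> free_component V bs e \<and> h u = free_part as e x"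
        using onto by blast
      from choice [OF this] obtain u where "\<forall>e. u e \<in> free_component V bs e \<and> h (u e) = free_part as e x" ..
      then have u: "u e \<in> free_component V bs e" "h (u e) = free_part as e x" for e
        by blast+
      have "h (sum u D) = x" unfolding hsum u(2) D [symmetric] ..
      moreover have "sum u D \<in> free_carrier V bs"
        by (rule free_carrier_sum) (rule free_component_subset [OF u(1)])
      ultimately show "x \<in> h ` free_carrier V bs" by blast
    qed
  qed
  have minimal: "Poly_Mapping.lookup (u j) 0 = 0" if u: "u \<in> free_carrier V bs" and hu: "h u = 0" for u j
  proof (rule ccontr)
    assume nz: "Poly_Mapping.lookup (u j) 0 \<noteq> 0"
    have j: "j < length ps"
    proof (rule ccontr)
      assume "\<not> j < length ps"
      then have "u j = 0" using u by (simp add: free_carrier_iff len)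
      then show False using nz by simp
    qed
    define p where "p = ps ! j"
    have p: "p \<in> A" "idx p = j" "bs ! j = fst p" using j ps(1) idx_nth by (auto simp: p_def bs_def)
    \<comment> \<open>In the part of degree \<open>fst p\<close> the coefficient of \<open>p\<close>
      is exactly the nonzero constant, so the relation can be solved for \<open>p\<close>.\<close>
    define u' where "u' = free_part bs (fst p) u"
    define c where "c = Poly_Mapping.lookup (u j) 0"
    have "h u' = free_part as (fst p) (h u)" unfolding u'_def by (rule graded_hom_free_part [OF hom u])
    then have hu': "h u' k = 0" for k by (simp add: hu free_part_def homogeneous_part_def)
    have u': "u' \<in> free_component V bs (fst p)" unfolding u'_def by (rule free_part_component [OF u])
    have "u' j \<in> homogeneous_polynomials V 0" using u' j p(3) by (auto simp: free_component_iff len)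
    from homogeneous_constant_term [OF this] have u'j: "u' j = Poly_Mapping.single 0 c"
      using j p(3) by (simp add: u'_def free_part_def len lookup_homogeneous_part c_def)
    let ?i = "Poly_Mapping.single 0 (- 1 / c) :: 'v mpoly"
    let ?r = "\<lambda>q. ?i * u' (idx q)"
    have "snd p k = combination (A - {p}) ?r k" for k
    proof -
      have "Poly_Mapping.single 0 c * snd p k + combination (A - {p}) (\<lambda>q. u' (idx q)) k = 0"
        using hu' [of k] unfolding h_def combination_remove [OF finA p(1)] p(2) u'j .
      then have "?i * (Poly_Mapping.single 0 c * snd p k) + ?i * combination (A - {p}) (\<lambda>q. u' (idx q)) k = 0"
        by (simp only: distrib_left [symmetric] mult_zero_right)
      moreover have "?i * (Poly_Mapping.single 0 c * snd p k) = - snd p k"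
        using nz unfolding mult.assoc [symmetric] mult_single by (simp add: c_def single_uminus)
      moreover have "?i * combination (A - {p}) (\<lambda>q. u' (idx q)) k = combination (A - {p}) ?r k"
        by (simp add: combination_def sum_distrib_left mult.assoc)
      ultimately show ?thesis by (simp add: neg_eq_iff_add_eq_0)
    qed
    then have eq: "snd p = combination (A - {p}) ?r" by (rule ext)
    have "?r q \<in> homogeneous_polynomials V (fst p - fst q)" if "q \<in> A - {p}" for q
    proof (rule homogeneous_scale)
      show "u' (idx q) \<in> homogeneous_polynomials V (fst p - fst q)"
        using u' idx [of q] that by (auto simp: free_component_iff len bs_def)
    qed
    from irredundant [OF p(1) this eq] show False .
  qed
  have degrees: "\<not> koszul_vanishes free_action V ?M 0 a" if "a \<in> set bs" for a
  proof
    assume van: "koszul_vanishes free_action V ?M 0 a"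
    obtain p where p: "p \<in> A" "a = fst p" using \<open>a \<in> set bs\<close> ps(1) by (auto simp: bs_def)
    obtain y where y: "\<And>v. v \<in> V \<Longrightarrow> y v \<in> ?M (a - 1)" "snd p = (\<Sum>v\<in>V. free_action v (y v))"
      using koszul_vanishes_0D [OF van _ z F(8), of "snd p"] memA [OF p(1)] p(2) by blast
    have "\<forall>v\<in>V. \<exists>w. (\<forall>p\<in>A. w p \<in> homogeneous_polynomials V (a - 1 - fst p)) \<and> y v = combination A w"
      using genA [OF y(1)] by blast
    from bchoice [OF this] obtain w where
      "\<forall>v\<in>V. (\<forall>p\<in>A. w v p \<in> homogeneous_polynomials V (a - 1 - fst p)) \<and> y v = combination A (w v)" ..
    then have w: "v \<in> V \<Longrightarrow> q \<in> A \<Longrightarrow> w v q \<in> homogeneous_polynomials V (a - 1 - fst q)"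
      "v \<in> V \<Longrightarrow> y v = combination A (w v)" for v q
      by blast+
    let ?W = "\<lambda>q. \<Sum>v\<in>V. var v * w v q"
    have "snd p = (\<Sum>v\<in>V. free_action v (combination A (w v)))"
      unfolding y(2) by (intro sum.cong refl) (simp add: w(2))
    then have eq: "snd p = combination A ?W" unfolding combination_action_sum .
    \<comment> \<open>\<open>p\<close> cannot occur in its own expression, since its coefficient
      would have degree -1.\<close>
    have "w v p = 0" if "v \<in> V" for v
      using homogeneous_negative [OF w(1) [OF that p(1)]] p(2) by simp
    then have "?W p = 0" by simp
    then have "snd p k = combination (A - {p}) ?W k" for k
      using fun_cong [OF eq, of k] combination_remove [OF finA p(1), of ?W k] by simp
    then have eq': "snd p = combination (A - {p}) ?W" by (rule ext)
    have "?W q \<in> homogeneous_polynomials V (fst p - fst q)" if "q \<in> A - {p}" for q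
    proof (rule homogeneous_sum)
      fix v assume v: "v \<in> V"
      have "q \<in> A" using that by blast
      from homogeneous_var_mult [OF v w(1) [OF v this]]
      show "var v * w v q \<in> homogeneous_polynomials V (fst p - fst q)" by (simp add: p(2))
    qed
    from irredundant [OF p(1) this eq'] show False .
  qed
  show ?thesis
    by (rule that [OF hom image], rule minimal, assumption, assumption, rule degrees)
qed

section \<open>Sections of powers of a line bundle\<close>

text \<open>Transport along an isomorphism with relabelled variables. The maps depend on the degree
  because a section carries its degree as an index while a Laurent form does not;
  \<open>lookup\<close> and \<open>single\<close> at that index translate between them.\<close>

lemma koszul_vanishes_transfer:
  fixes X :: "'u \<Rightarrow> 'b::ab_group_add \<Rightarrow> 'b" and Y :: "'v \<Rightarrow> 'c::ab_group_add \<Rightarrow> 'c"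
  assumes M: "graded_action X U M" and N: "graded_action Y V N"
    and i: "\<And>u. u \<in> U \<Longrightarrow> \<iota> u \<in> V" "\<And>u. u \<in> U \<Longrightarrow> \<kappa> (\<iota> u) = u"
    and k: "\<And>v. v \<in> V \<Longrightarrow> \<kappa> v \<in> U" "\<And>v. v \<in> V \<Longrightarrow> \<iota> (\<kappa> v) = v"
    and T: "\<And>j x. x \<in> M j \<Longrightarrow> T j x \<in> N j" "\<And>j x y. T j (x + y) = T j x + T j y"
    and T': "\<And>j y. y \<in> N j \<Longrightarrow> T' j y \<in> M j" "\<And>j x y. T' j (x + y) = T' j x + T' j y"
    and inverse: "\<And>j x. x \<in> M j \<Longrightarrow> T' j (T j x) = x"
    and act: "\<And>u j x. u \<in> U \<Longrightarrow> x \<in> M j \<Longrightarrow> T (j + 1) (X u x) = Y (\<iota> u) (T j x)"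
    and act': "\<And>v j y. v \<in> V \<Longrightarrow> y \<in> N j \<Longrightarrow> T' (j + 1) (Y v y) = X (\<kappa> v) (T' j y)"
    and van: "koszul_vanishes Y V N i e"
  shows "koszul_vanishes X U M i e"
proof (rule koszul_vanishesI)
  note MM = graded_actionD [OF M] and NN = graded_actionD [OF N]
  have T0: "T j 0 = 0" for j using T(2) [of j 0 0] by simp
  have T'0: "T' j 0 = 0" for j using T'(2) [of j 0 0] by simp
  have Tm: "T j (- x) = - T j x" for j x
    using T(2) [of j x "- x"] T0 by (simp add: eq_neg_iff_add_eq_0 add.commute)
  have T'm: "T' j (- x) = - T' j x" for j x
    using T'(2) [of j x "- x"] T'0 by (simp add: eq_neg_iff_add_eq_0 add.commute)
  have Tsum: "T j (sum f A) = (\<Sum>a\<in>A. T j (f a))" for j and f :: "'u \<Rightarrow> 'b" and A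
    by (induction A rule: infinite_finite_induct) (simp_all add: T0 T(2))
  have T'sum: "T' j (sum f A) = (\<Sum>a\<in>A. T' j (f a))" for j and f :: "'v \<Rightarrow> 'c" and A
    by (induction A rule: infinite_finite_induct) (simp_all add: T'0 T'(2))
  have bij: "bij_betw \<iota> U V"
    by (rule bij_betw_byWitness [where f' = \<kappa>]) (auto simp: i k)
  have bij': "bij_betw \<kappa> V U"
    by (rule bij_betw_byWitness [where f' = \<iota>]) (auto simp: i k)
  have map_ki: "map \<kappa> (map \<iota> L) = L" if "set L \<subseteq> U" for L
    using that by (induction L) (auto simp: i)
  fix c assume c: "koszul_chain U M i e c" and cyc: "\<And>L. koszul_d X U c L = 0"
  have C: "alternating c" "c L \<in> M (e - int i)" "c L \<noteq> 0 \<Longrightarrow> length L = i \<and> set L \<subseteq> U" for L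
    using c unfolding koszul_chain_def by blast+
  define b where "b L = (if set L \<subseteq> V then T (e - int i) (c (map \<kappa> L)) else 0)" for L
  have b: "koszul_chain V N i e b"
    unfolding koszul_chain_def
  proof (intro conjI allI impI)
    show "alternating b"
      unfolding alternating_def
    proof (intro allI)
      fix xs u v ys
      have eq1: "c (map \<kappa> (xs @ u # v # ys)) = - c (map \<kappa> (xs @ v # u # ys))"
        using C(1) unfolding alternating_def map_append list.map by (elim allE)
      have eq2: "set (xs @ u # v # ys) = set (xs @ v # u # ys)" by auto
      show "b (xs @ u # v # ys) = - b (xs @ v # u # ys)"
        unfolding b_def eq2 eq1 Tm by simp
    qed
    fix L
    show "b L \<in> N (e - int i)" unfolding b_def using T(1) [OF C(2)] NN(5) by simp
    assume "b L \<noteq> 0"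
    then have L: "set L \<subseteq> V" "T (e - int i) (c (map \<kappa> L)) \<noteq> 0" by (auto simp: b_def split: if_splits)
    then have "c (map \<kappa> L) \<noteq> 0" using T0 by metis
    then have "length (map \<kappa> L) = i" using C(3) by blast
    then show "length L = i" by simp
    show "set L \<subseteq> V" by (rule L(1))
  qed
  have cycb: "koszul_d Y V b L = 0" for L
  proof (cases "set L \<subseteq> V")
    case True
    have "koszul_d Y V b L = (\<Sum>v\<in>V. Y v (T (e - int i) (c (\<kappa> v # map \<kappa> L))))"
      unfolding koszul_d_def by (intro sum.cong refl) (simp add: b_def True)
    also have "\<dots> = (\<Sum>v\<in>V. T (e - int i + 1) (X (\<kappa> v) (c (\<kappa> v # map \<kappa> L))))"
      by (intro sum.cong refl) (simp add: act C(2) k)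
    also have "\<dots> = T (e - int i + 1) (\<Sum>v\<in>V. X (\<kappa> v) (c (\<kappa> v # map \<kappa> L)))"
      using T(2) T0 by (induction V rule: infinite_finite_induct) simp_all
    also have "(\<Sum>v\<in>V. X (\<kappa> v) (c (\<kappa> v # map \<kappa> L))) = koszul_d X U c (map \<kappa> L)"
      unfolding koszul_d_def by (rule sum.reindex_bij_betw [OF bij'])
    finally show ?thesis by (simp add: cyc T0)
  next
    case False
    then show ?thesis unfolding koszul_d_def by (simp add: b_def NN(8))
  qed
  obtain b' where b': "koszul_chain V N (Suc i) e b'" "koszul_d Y V b' = b"
    by (rule koszul_vanishesE [OF van b cycb])
  have B': "alternating b'" "b' L \<in> N (e - int (Suc i))" "b' L \<noteq> 0 \<Longrightarrow> length L = Suc i \<and> set L \<subseteq> V" for L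
    using b'(1) unfolding koszul_chain_def by blast+
  define c' where "c' L = (if set L \<subseteq> U then T' (e - int (Suc i)) (b' (map \<iota> L)) else 0)" for L
  have "koszul_chain U M (Suc i) e c'"
    unfolding koszul_chain_def
  proof (intro conjI allI impI)
    show "alternating c'"
      unfolding alternating_def
    proof (intro allI)
      fix xs u v ys
      have eq1: "b' (map \<iota> (xs @ u # v # ys)) = - b' (map \<iota> (xs @ v # u # ys))"
        using B'(1) unfolding alternating_def map_append list.map by (elim allE)
      have eq2: "set (xs @ u # v # ys) = set (xs @ v # u # ys)" by auto
      show "c' (xs @ u # v # ys) = - c' (xs @ v # u # ys)"
        unfolding c'_def eq2 eq1 T'm by simp
    qed
    fix L
    show "c' L \<in> M (e - int (Suc i))" unfolding c'_def using T'(1) [OF B'(2)] MM(5) by simp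
    assume "c' L \<noteq> 0"
    then have L: "set L \<subseteq> U" "T' (e - int (Suc i)) (b' (map \<iota> L)) \<noteq> 0" by (auto simp: c'_def split: if_splits)
    then have "b' (map \<iota> L) \<noteq> 0" using T'0 by metis
    then have "length (map \<iota> L) = Suc i" using B'(3) by blast
    then show "length L = Suc i" by simp
    show "set L \<subseteq> U" by (rule L(1))
  qed
  moreover have "koszul_d X U c' L = c L" for L
  proof (cases "set L \<subseteq> U")
    case True
    have VL: "set (map \<iota> L) \<subseteq> V" using True i(1) by auto
    have "koszul_d X U c' L = (\<Sum>u\<in>U. X (\<kappa> (\<iota> u)) (T' (e - int (Suc i)) (b' (\<iota> u # map \<iota> L))))"
      unfolding koszul_d_def by (intro sum.cong refl) (simp add: c'_def True i)
    also have "\<dots> = (\<Sum>u\<in>U. T' (e - int (Suc i) + 1) (Y (\<iota> u) (b' (\<iota> u # map \<iota> L))))"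
      by (intro sum.cong refl) (simp only: act' [OF i(1) B'(2)])
    also have "\<dots> = T' (e - int (Suc i) + 1) (\<Sum>u\<in>U. Y (\<iota> u) (b' (\<iota> u # map \<iota> L)))"
      using T'(2) T'0 by (induction U rule: infinite_finite_induct) simp_all
    also have "(\<Sum>u\<in>U. Y (\<iota> u) (b' (\<iota> u # map \<iota> L))) = koszul_d Y V b' (map \<iota> L)"
      unfolding koszul_d_def by (rule sum.reindex_bij_betw [OF bij])
    also have "\<dots> = T (e - int i) (c L)" unfolding b'(2) b_def using VL map_ki [OF True] by simp
    also have "e - int (Suc i) + 1 = e - int i" by simp
    also have "T' (e - int i) (T (e - int i) (c L)) = c L" by (rule inverse [OF C(2)])
    finally show ?thesis .
  next
    case False
    then have "c L = 0" using C(3) by blast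
    then show ?thesis using False unfolding koszul_d_def by (simp add: c'_def MM(8))
  qed
  then have "koszul_d X U c' = c" by (rule ext)
  ultimately show "\<exists>c'. koszul_chain U M (Suc i) e c' \<and> koszul_d X U c' = c" by blast
qed

definition monomial :: "(nat \<Rightarrow>\<^sub>0 int) \<Rightarrow> laurent" where
  "monomial \<beta> = Poly_Mapping.single \<beta> 1"

lemma inj_monomial: "inj monomial"
  by (rule injI) (auto simp: monomial_def dest!: arg_cong [where f = Poly_Mapping.keys])

definition section_action :: "laurent \<Rightarrow> (nat \<Rightarrow>\<^sub>0 laurent) \<Rightarrow> (nat \<Rightarrow>\<^sub>0 laurent)" where
  "section_action b g = Poly_Mapping.single 1 b * g"

lemma forms_negative: "k < 0 \<Longrightarrow> forms n k = {0}"
proof -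
  assume "k < 0"
  then have "exponents n k = {}"
    by (auto simp: exponents_iff) (metis sum_nonneg leD)
  then show ?thesis by (auto simp: forms_def)
qed

section \<open>The section module of O(d) on projective n-space\<close>

locale veronese =
  fixes n d :: nat
  assumes d: "1 \<le> d"
begin

abbreviation "E \<equiv> exponents n (int d)"
abbreviation "B \<equiv> monomial_sections n (int d)"
abbreviation "R \<equiv> \<lambda>m::nat. global_sections n (int m * int d)"
abbreviation "G \<equiv> section_module R"
abbreviation "L \<equiv> \<lambda>j. forms n (j * int d)"

lemma R: "R m = forms n (int m * int d)"
  by (simp add: global_sections_eq_forms)

lemma B: "B = monomial ` E"
  by (auto simp: monomial_sections_def monomial_def)

lemma finite_B: "finite B"
  by (simp add: B finite_exponents)

text \<open>\<open>nat\<close> sends every negative degree to index 0; this is harmless because d >=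
  1 makes L e zero for e < 0.\<close>

lemma component_iff: "g \<in> component G e \<longleftrightarrow> (\<exists>f\<in>L e. g = Poly_Mapping.single (nat e) f)"
proof
  assume g: "g \<in> component G e"
  then have g': "\<And>m. Poly_Mapping.lookup g m \<in> forms n (int m * int d)" "\<And>m. m \<in> Poly_Mapping.keys g \<Longrightarrow> int m = e"
    by (auto simp: section_module_def R)
  have eq: "g = Poly_Mapping.single (nat e) (Poly_Mapping.lookup g (nat e))"
  proof (rule poly_mapping_eqI)
    fix k
    show "Poly_Mapping.lookup g k =
        Poly_Mapping.lookup (Poly_Mapping.single (nat e) (Poly_Mapping.lookup g (nat e))) k"
    proof (cases "k = nat e")
      case False
      then have "k \<notin> Poly_Mapping.keys g" using g'(2) [of k] by auto
      then show ?thesis using False by (simp add: lookup_single in_keys_iff)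
    qed simp
  qed
  have "Poly_Mapping.lookup g (nat e) \<in> L e"
  proof (cases "0 \<le> e")
    case True
    then show ?thesis using g'(1) [of "nat e"] by simp
  next
    case False
    then have "Poly_Mapping.lookup g (nat e) = 0" using g'(2) [of "nat e"] by (auto simp: in_keys_iff)
    then show ?thesis by (simp add: forms_closed)
  qed
  with eq show "\<exists>f\<in>L e. g = Poly_Mapping.single (nat e) f" by blast
next
  assume "\<exists>f\<in>L e. g = Poly_Mapping.single (nat e) f"
  then obtain f where f: "f \<in> L e" "g = Poly_Mapping.single (nat e) f" by blast
  show "g \<in> component G e"
  proof (cases "0 \<le> e")
    case True
    then show ?thesis
      using f by (auto simp: section_module_def R lookup_single when_def forms_closed split: if_splits)
  next
    case False
    then have "e * int d < 0" using d by (simp add: mult_neg_pos)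
    then have "f = 0" using f(1) forms_negative by blast
    then show ?thesis using f(2) by (simp add: section_module_def R forms_closed)
  qed
qed

lemma L_negative: "j < 0 \<Longrightarrow> f \<in> L j \<Longrightarrow> f = 0"
  using forms_negative [of "j * int d" n] d by (simp add: mult_neg_pos)

lemma monomial_form: "\<beta> \<in> E \<Longrightarrow> monomial \<beta> \<in> L 1"
  by (simp add: forms_def monomial_def)

lemma L_mult: "\<beta> \<in> E \<Longrightarrow> f \<in> L j \<Longrightarrow> monomial \<beta> * f \<in> L (j + 1)"
  using forms_closed(4) [of "monomial \<beta>" n "int d" f "j * int d"] monomial_form [of \<beta>]
  by (simp add: algebra_simps)

lemma lookup_double_zero:
  fixes x :: "'z \<Rightarrow>\<^sub>0 'y::ab_group_add"
  assumes "\<And>y::'y. y + y = 0 \<Longrightarrow> y = 0" "x + x = 0"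
  shows "x = 0"
proof (rule poly_mapping_eqI)
  fix m
  have "Poly_Mapping.lookup x m + Poly_Mapping.lookup x m = 0"
    using assms(2) by (metis lookup_add lookup_zero)
  from assms(1) [OF this] show "Poly_Mapping.lookup x m = Poly_Mapping.lookup 0 m" by simp
qed

lemma laurent_double_zero: "f + f = 0 \<Longrightarrow> f = (0::laurent)"
  by (rule lookup_double_zero) auto

lemma action_L: "graded_action variable_action E L"
  unfolding graded_action_def
proof (intro conjI allI ballI impI)
  show "finite E" by (rule finite_exponents)
  fix x y :: laurent and u v e
  show "x = 0" if "x + x = 0" by (rule laurent_double_zero [OF that])
  show "variable_action v (x + y) = variable_action v x + variable_action v y"
    by (simp add: variable_action_def distrib_left)
  show "variable_action u (variable_action v x) = variable_action v (variable_action u x)"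
    by (simp add: variable_action_def mult.left_commute)
  show "0 \<in> L e" by (rule forms_closed)
  show "x - y \<in> L e" if "x \<in> L e" "y \<in> L e"
    using forms_closed(2) [OF that(1) forms_closed(3) [OF that(2)]] by simp
  show "variable_action v x \<in> L (e + 1)" if "v \<in> E" "x \<in> L e"
    using L_mult [OF that] by (simp add: variable_action_def monomial_def)
qed

lemma component_cases:
  assumes "g \<in> component G e"
  obtains f where "f \<in> L e" "g = Poly_Mapping.single (nat e) f" "e < 0 \<Longrightarrow> f = 0"
  using assms L_negative unfolding component_iff by blast

text \<open>For negative j the indices 1 + \<open>nat j\<close> and \<open>nat (j + 1)\<close>
  differ, but then f = 0.\<close>

lemma section_action_single:
  assumes "f \<in> L j"
  shows "section_action b (Poly_Mapping.single (nat j) f) = Poly_Mapping.single (nat (j + 1)) (b * f)"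
proof (cases "0 \<le> j")
  case True
  then have "1 + nat j = nat (j + 1)" by simp
  then show ?thesis by (simp only: section_action_def mult_single)
next
  case False
  then show ?thesis using L_negative [OF _ assms] by (simp add: section_action_def)
qed

lemma action_G: "graded_action section_action B (component G)"
  unfolding graded_action_def
proof (intro conjI allI ballI impI)
  show "finite B" by (rule finite_B)
  fix x y :: "nat \<Rightarrow>\<^sub>0 laurent" and u v e
  show "x = 0" if "x + x = 0" by (rule lookup_double_zero [OF _ that]) (rule laurent_double_zero)
  show "section_action v (x + y) = section_action v x + section_action v y"
    by (simp add: section_action_def distrib_left)
  show "section_action u (section_action v x) = section_action v (section_action u x)"
    by (simp add: section_action_def mult.left_commute)
  show "0 \<in> component G e" unfolding component_iff by (rule bexI [of _ 0]) (simp_all add: forms_closed)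
  show "x - y \<in> component G e" if x: "x \<in> component G e" and y: "y \<in> component G e"
  proof -
    obtain f where f: "f \<in> L e" "x = Poly_Mapping.single (nat e) f" using x unfolding component_iff by blast
    obtain g where g: "g \<in> L e" "y = Poly_Mapping.single (nat e) g" using y unfolding component_iff by blast
    have "f - g \<in> L e" using forms_closed(2) [OF f(1) forms_closed(3) [OF g(1)]] by simp
    moreover have "x - y = Poly_Mapping.single (nat e) (f - g)" by (simp add: f g single_diff)
    ultimately show ?thesis unfolding component_iff by blast
  qed
  show "section_action v x \<in> component G (e + 1)" if v: "v \<in> B" and x: "x \<in> component G e"
  proof -
    obtain f where f: "f \<in> L e" "x = Poly_Mapping.single (nat e) f" using x unfolding component_iff by blast
    obtain \<beta> where \<beta>: "\<beta> \<in> E" "v = monomial \<beta>" using v unfolding B by blast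
    have "section_action v x = Poly_Mapping.single (nat (e + 1)) (v * f)"
      unfolding f(2) by (rule section_action_single [OF f(1)])
    moreover have "v * f \<in> L (e + 1)" unfolding \<beta>(2) by (rule L_mult [OF \<beta>(1) f(1)])
    ultimately show ?thesis unfolding component_iff by blast
  qed
qed

definition exponent_of :: "laurent \<Rightarrow> (nat \<Rightarrow>\<^sub>0 int)" where
  "exponent_of = inv_into E monomial"

lemma exponent_of:
  "b \<in> B \<Longrightarrow> exponent_of b \<in> E" "b \<in> B \<Longrightarrow> monomial (exponent_of b) = b"
  "\<beta> \<in> E \<Longrightarrow> monomial \<beta> \<in> B" "\<beta> \<in> E \<Longrightarrow> exponent_of (monomial \<beta>) = \<beta>"
proof -
  show "b \<in> B \<Longrightarrow> exponent_of b \<in> E" "b \<in> B \<Longrightarrow> monomial (exponent_of b) = b" "\<beta> \<in> E \<Longrightarrow> monomial \<beta> \<in> B"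
    unfolding B exponent_of_def by (rule inv_into_into, assumption, rule f_inv_into_f, assumption, rule imageI)
  show "\<beta> \<in> E \<Longrightarrow> exponent_of (monomial \<beta>) = \<beta>"
    unfolding exponent_of_def by (rule inv_into_f_f [OF inj_on_subset [OF inj_monomial subset_UNIV]])
qed

lemma to_L: "x \<in> component G j \<Longrightarrow> Poly_Mapping.lookup x (nat j) \<in> L j"
  unfolding component_iff by auto

lemma to_G: "f \<in> L j \<Longrightarrow> Poly_Mapping.single (nat j) f \<in> component G j"
  unfolding component_iff by blast

lemma to_L_action:
  assumes "b \<in> B" "x \<in> component G j"
  shows "Poly_Mapping.lookup (section_action b x) (nat (j + 1)) =
    variable_action (exponent_of b) (Poly_Mapping.lookup x (nat j))"
proof -
  obtain f where f: "f \<in> L j" "x = Poly_Mapping.single (nat j) f" using assms(2) unfolding component_iff by blast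
  have "variable_action (exponent_of b) f = b * f"
    using exponent_of(2) [OF assms(1)] by (simp add: variable_action_def monomial_def)
  then show ?thesis unfolding f(2) section_action_single [OF f(1)] by simp
qed

lemma to_G_action:
  assumes "\<beta> \<in> E" "f \<in> L j"
  shows "Poly_Mapping.single (nat (j + 1)) (variable_action \<beta> f) =
    section_action (monomial \<beta>) (Poly_Mapping.single (nat j) f)"
  unfolding section_action_single [OF assms(2)] by (simp add: variable_action_def monomial_def)

lemma koszul_section_iff:
  "koszul_vanishes section_action B (component G) i e \<longleftrightarrow> koszul_vanishes variable_action E L i e"
proof
  assume "koszul_vanishes variable_action E L i e"
  then show "koszul_vanishes section_action B (component G) i e"
    by (rule koszul_vanishes_transfer [where \<iota> = exponent_of and \<kappa> = monomial and
          T = "\<lambda>j x. Poly_Mapping.lookup x (nat j)" and T' = "\<lambda>j. Poly_Mapping.single (nat j)",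
          OF action_G action_L, rotated -1])
      (auto simp: exponent_of lookup_add single_add to_L to_L_action to_G_action elim: component_cases intro: to_G)
next
  assume "koszul_vanishes section_action B (component G) i e"
  then show "koszul_vanishes variable_action E L i e"
    by (rule koszul_vanishes_transfer [where \<kappa> = exponent_of and \<iota> = monomial and
          T' = "\<lambda>j x. Poly_Mapping.lookup x (nat j)" and T = "\<lambda>j. Poly_Mapping.single (nat j)",
          OF action_L action_G, rotated -1])
      (auto simp: exponent_of lookup_add single_add to_L to_L_action to_G_action intro: to_G)
qed

text \<open>The total e d of a weight is spread over n + 1 coordinates, so one of them is at least
  (i + 1) d and \<open>weight_vanishes_large\<close> applies. This explicit bound is what makes the
  syzygies finitely generated.\<close>

lemma koszul_vanishes_bounded:
  assumes e: "(int n + 1) * (int i + 1) < e"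
  shows "koszul_vanishes section_action B (component G) i e"
  unfolding koszul_section_iff
proof (rule koszul_vanishes_if_weight_vanishes)
  fix \<alpha> assume \<alpha>: "\<alpha> \<in> exponents n (e * int d)"
  have "\<exists>k\<le>n. int (Suc i) * int d \<le> Poly_Mapping.lookup \<alpha> k"
  proof (rule ccontr)
    assume "\<not> ?thesis"
    then have "Poly_Mapping.lookup \<alpha> k \<le> int (Suc i) * int d" if "k \<le> n" for k
      using that by (meson le_cases)
    then have "(\<Sum>k\<le>n. Poly_Mapping.lookup \<alpha> k) \<le> (\<Sum>k\<le>n. int (Suc i) * int d)"
      by (intro sum_mono) simp
    then have "e * int d \<le> (int n + 1) * (int i + 1) * int d"
      using \<alpha> by (simp add: exponents_iff algebra_simps)
    moreover have "(int n + 1) * (int i + 1) * int d < e * int d"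
      using e d by (intro mult_strict_right_mono) simp_all
    ultimately show False by simp
  qed
  then show "weight_vanishes n (int d) \<alpha> i"
    using weight_vanishes_large [of _ n "int d" i \<alpha>] by auto
qed

text \<open>An alternating function vanishes on lists longer than the number of variables. This
  bounds the length of the resolution, in place of Hilbert's syzygy theorem.\<close>

lemma koszul_vanishes_high:
  assumes "card E < i"
  shows "koszul_vanishes section_action B (component G) i e"
  unfolding koszul_section_iff
proof (intro koszul_vanishes_if_weight_vanishes weight_vanishesI)
  fix \<alpha> a assume a: "weight_chain n (int d) \<alpha> i a"
  have "a xs = 0" for xs
  proof (rule ccontr)
    assume nz: "a xs \<noteq> 0"
    then have "length xs = i" "set xs \<subseteq> E" using weight_chainD(2,3) [OF a] by blast+
    then have "\<not> distinct xs"
      using assms card_mono [OF finite_exponents, of "set xs" n "int d"] distinct_card [of xs] by auto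
    then show False using alternating_not_distinct [OF weight_chainD(1) [OF a]] nz by blast
  qed
  then have "a = (\<lambda>_. 0)" by auto
  then show "\<exists>a'. weight_chain n (int d) \<alpha> (Suc i) a' \<and> weight_d n (int d) a' = a"
    using weight_chain_zero by (intro exI [of _ "\<lambda>_. 0"]) (auto simp: koszul_d_def)
qed

end

text \<open>Vanishing is translated to weights on p-space, extended to the weights on n-space, and
  translated back; the degree e fixes the total e d of the weights on both sides.\<close>

lemma koszul_vanishes_extend:
  assumes d: "1 \<le> d" and ip: "i \<le> p" "p \<le> n"
    and van: "koszul_vanishes section_action (monomial_sections p (int d))
      (component (section_module (\<lambda>m. global_sections p (int m * int d)))) i e"
  shows "koszul_vanishes section_action (monomial_sections n (int d))
      (component (section_module (\<lambda>m. global_sections n (int m * int d)))) i e"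
proof -
  interpret p: veronese p d by (unfold_locales) (rule d)
  interpret n: veronese n d by (unfold_locales) (rule d)
  have "koszul_vanishes variable_action (exponents p (int d)) (\<lambda>j. forms p (j * int d)) i e"
    using van unfolding p.koszul_section_iff .
  from weight_vanishes_if_koszul_vanishes [OF this]
  have "weight_vanishes n (int d) \<alpha> i" if "\<alpha> \<in> exponents n (e * int d)" for \<alpha>
    using weight_vanishes_extend [OF _ ip, of "e * int d" "int d" \<alpha>] that by blast
  then show ?thesis
    unfolding n.koszul_section_iff by (rule koszul_vanishes_if_weight_vanishes)
qed

section \<open>Kernels and images of homomorphisms of graded free modules\<close>

definition free_kernel :: "'v set \<Rightarrow> int list \<Rightarrow> ((nat \<Rightarrow> 'v mpoly) \<Rightarrow> 'b::zero) \<Rightarrow> (nat \<Rightarrow> 'v mpoly) set" where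
  "free_kernel V as h = {u \<in> free_carrier V as. h u = 0}"

lemma kernel_components_free:
  "kernel_components (free_component V as) h = (\<lambda>e. free_kernel V as h \<inter> free_component V as e)"
  by (auto simp: kernel_components_def free_kernel_def fun_eq_iff intro: free_component_subset)

lemma free_component_half:
  assumes "x \<in> free_component V as e"
  shows "\<exists>y\<in>free_component V as e. y + y = x"
proof (rule bexI)
  let ?y = "\<lambda>j. Poly_Mapping.single 0 (1 / 2) * x j"
  have "?y j + ?y j = x j" for j
    by (simp add: distrib_right [symmetric] single_add [symmetric])
  then show "?y + ?y = x" by (intro ext) (simp only: plus_fun_apply)
  show "?y \<in> free_component V as e"
    using assms by (simp add: free_component_iff homogeneous_scale)
qed

lemma var_polynomial: "v \<in> V \<Longrightarrow> var v \<in> polynomials_in V"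
  by (rule homogeneous_polynomial [OF homogeneous_var])

lemma graded_action_submodule:
  assumes fin: "finite V" and K: "graded_submodule V as K"
  shows "graded_action free_action V (\<lambda>e. K \<inter> free_component V as e)"
proof -
  note F = graded_action_free [OF fin, of as] and KD = graded_submoduleD [OF K]
  have minus: "x - y \<in> K" if "x \<in> K" "y \<in> K" for x y
  proof -
    have "(\<lambda>j. Poly_Mapping.single 0 (- 1) * y j) \<in> K" by (rule KD(4) [OF const_polynomial that(2)])
    then have "x + (\<lambda>j. Poly_Mapping.single 0 (- 1) * y j) \<in> K" by (rule KD(3) [OF that(1)])
    moreover have "x + (\<lambda>j. Poly_Mapping.single 0 (- 1) * y j) = x - y"
      by (auto simp: fun_minus_apply single_uminus fun_eq_iff)
    ultimately show ?thesis by simp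
  qed
  have act: "free_action v x \<in> K" if "v \<in> V" "x \<in> K" for v x
    using KD(4) [OF var_polynomial [OF that(1)] that(2)] by (simp add: free_action_def)
  note FD = graded_actionD [OF F]
  show ?thesis
    unfolding graded_action_def
  proof (intro conjI allI ballI impI)
    show "x - y \<in> K \<inter> free_component V as e"
      if "x \<in> K \<inter> free_component V as e" "y \<in> K \<inter> free_component V as e" for x y e
      using minus FD(6) that by blast
    show "free_action v x \<in> K \<inter> free_component V as (e + 1)"
      if "v \<in> V" "x \<in> K \<inter> free_component V as e" for v x e
      using act FD(7) that by blast
    show "0 \<in> K \<inter> free_component V as e" for e using KD(2) FD(5) by blast
    show "x = 0" if "x + x = 0" for x :: "nat \<Rightarrow> 'a mpoly" using that by (rule FD(2))
  qed (rule FD(1), rule FD(3), rule FD(4))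
qed

lemma free_hom_kernel:
  assumes h: "h \<in> graded_hom (polynomial_ring V) (graded_free_module V bs) (graded_free_module V as)"
  shows "graded_submodule V bs (free_kernel V bs h)"
  unfolding free_kernel_def
proof (rule graded_submodule_kernel)
  note H = graded_homD [OF h, unfolded free_module_ops]
  show "h (u + v) = h u + h v" if "u \<in> free_carrier V bs" "v \<in> free_carrier V bs" for u v
    by (rule H(2) [OF that])
  show "h (\<lambda>j. f * u j) = 0" if "f \<in> polynomials_in V" "u \<in> free_carrier V bs" "h u = 0" for f u
    using H(3) [OF that(1,2)] that(3) by auto
  show "h (free_part bs e u) = 0" if "u \<in> free_carrier V bs" "h u = 0" for u e
    using graded_hom_free_part [OF h that(1), of e] that(2) by (simp only: free_part_zero)
qed

lemma free_hom_surjection: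
  assumes fin: "finite V"
    and h: "h \<in> graded_hom (polynomial_ring V) (graded_free_module V bs) (graded_free_module V as)"
    and K: "graded_submodule V as K" and image: "h ` free_carrier V bs = K"
  shows "graded_surjection free_action free_action V (free_component V bs) (\<lambda>e. K \<inter> free_component V as e) h"
  unfolding graded_surjection_def
proof (intro conjI allI ballI)
  note H = graded_homD [OF h, unfolded free_module_ops]
  show "graded_action free_action V (free_component V bs)" by (rule graded_action_free [OF fin])
  show "graded_action free_action V (\<lambda>e. K \<inter> free_component V as e)" by (rule graded_action_submodule [OF fin K])
  fix e x assume x: "x \<in> free_component V bs e"
  show "\<exists>y\<in>free_component V bs e. y + y = x" by (rule free_component_half [OF x])
  show "h (x + y) = h x + h y" if "y \<in> free_component V bs e" for y
    by (intro H(2) free_component_subset [OF x] free_component_subset [OF that])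
  show "h (free_action v x) = free_action v (h x)" if "v \<in> V" for v
    unfolding free_action_def by (rule H(3) [OF var_polynomial [OF that] free_component_subset [OF x]])
next
  fix e
  note H = graded_homD [OF h]
  show "h ` free_component V bs e = K \<inter> free_component V as e"
  proof
    show "h ` free_component V bs e \<subseteq> K \<inter> free_component V as e"
      using H(4) image free_component_subset by blast
    show "K \<inter> free_component V as e \<subseteq> h ` free_component V bs e"
    proof
      fix x assume x: "x \<in> K \<inter> free_component V as e"
      then obtain u where u: "u \<in> free_carrier V bs" "x = h u" using image by blast
      have "h (free_part bs e u) = x"
        using graded_hom_free_part [OF h u(1), of e] free_part_of_component [of x V as e e] x u(2) by simp
      then show "x \<in> h ` free_component V bs e" using free_part_component [OF u(1), of e] by blast
    qed
  qed
qed

text \<open>K_0 of S(-a) is \<complex> placed in degree a. In any other degree the coordinates have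
  no constant term, so \<open>free_koszul_exact\<close> applies with i = 0.\<close>

lemma koszul_vanishes_0_free:
  assumes fin: "finite V" and e: "e \<notin> set as"
  shows "koszul_vanishes free_action V (free_component V as) 0 e"
proof (rule koszul_vanishesI, rule free_koszul_exact [OF fin], assumption, assumption)
  fix c :: "'a list \<Rightarrow> nat \<Rightarrow> 'a mpoly" and xs :: "'a list" and j
  assume "koszul_chain V (free_component V as) 0 e c"
  then have c: "c xs \<in> free_component V as (e - int 0)" unfolding koszul_chain_def by blast
  show "Poly_Mapping.lookup (c xs j) 0 = 0"
  proof (cases "j < length as")
    case True
    then have "c xs j \<in> homogeneous_polynomials V (e - as ! j)" using c by (simp add: free_component_iff)
    moreover have "e \<noteq> as ! j" using True e by (metis nth_mem)
    ultimately show ?thesis unfolding homogeneous_iff by (metis eq_iff_diff_eq_0 monom_degree_zero of_nat_0)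
  next
    case False
    then show ?thesis using c by (simp add: free_component_iff)
  qed
qed

text \<open>K_0 is right exact: an expression of a preimage by the variables is mapped to one of the
  element itself.\<close>

lemma koszul_vanishes_0_image:
  assumes surj: "graded_surjection X Y V F M \<phi>" and van: "koszul_vanishes X V F 0 e"
  shows "koszul_vanishes Y V M 0 e"
proof (rule koszul_vanishes_0I)
  note F = graded_actionD [OF FM(1) [OF surj]] and MM = graded_actionD [OF FM(2) [OF surj]]
  show "0 \<in> M j" "Y v 0 = 0" for j v by (rule MM(5), rule MM(8))
  fix x assume "x \<in> M e"
  then obtain u where u: "u \<in> F e" "x = \<phi> u" using phi_onto [OF surj, of e] by blast
  obtain y where y: "\<forall>v\<in>V. y v \<in> F (e - 1)" "u = (\<Sum>v\<in>V. X v (y v))"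
    using koszul_vanishes_0D [OF van u(1) F(5) F(8)] by blast
  have "X v (y v) \<in> F e" if "v \<in> V" for v using F(7) [OF that, of "y v" "e - 1"] y(1) that by simp
  then have "x = (\<Sum>v\<in>V. \<phi> (X v (y v)))" unfolding u(2) y(2) by (rule phi_sum [OF surj])
  also have "\<dots> = (\<Sum>v\<in>V. Y v (\<phi> (y v)))"
    using y(1) by (intro sum.cong refl phi_act [OF surj, of _ "e - 1"]) auto
  finally have "x = (\<Sum>v\<in>V. Y v (\<phi> (y v)))" .
  moreover have "\<forall>v\<in>V. \<phi> (y v) \<in> M (e - 1)" using y(1) phi_onto [OF surj, of "e - 1"] by blast
  ultimately show "\<exists>y. (\<forall>v\<in>V. y v \<in> M (e - 1)) \<and> x = (\<Sum>v\<in>V. Y v (y v))"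
    by (intro exI [of _ "\<lambda>v. \<phi> (y v)"] conjI)
qed

section \<open>Evaluation of polynomials in the sections\<close>

lemma single_power: "Poly_Mapping.single (a::nat) b ^ k = Poly_Mapping.single (k * a) (b ^ k :: 'c::comm_semiring_1)"
  by (induction k) (simp_all add: mult_single)

lemma monomial_product_single:
  "monomial_product m = Poly_Mapping.single (monom_degree m) (\<Prod>b\<in>Poly_Mapping.keys m. b ^ Poly_Mapping.lookup m b)"
proof -
  have "(\<Prod>b\<in>A. Poly_Mapping.single 1 b ^ Poly_Mapping.lookup m b) =
      Poly_Mapping.single (\<Sum>b\<in>A. Poly_Mapping.lookup m b) (\<Prod>b\<in>A. b ^ Poly_Mapping.lookup m b)" if "finite A" for A
    using that by (induction A rule: finite_induct) (simp_all add: single_power mult_single)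
  then show ?thesis by (simp add: monomial_product_def monom_degree_def)
qed

lemma section_of_var: "section_of_polynomial (var b) = Poly_Mapping.single 1 b"
  by (simp add: section_of_polynomial_single monomial_product_single)

lemma section_of_polynomial_sum_degrees:
  "section_of_polynomial f = (\<Sum>m\<in>Poly_Mapping.keys f. Poly_Mapping.single (monom_degree m)
     (Poly_Mapping.single 0 (Poly_Mapping.lookup f m) * (\<Prod>b\<in>Poly_Mapping.keys m. b ^ Poly_Mapping.lookup m b)))"
  unfolding section_of_polynomial_def monomial_product_def [symmetric] monomial_product_single mult_single by simp

lemma section_constant_term:
  "Poly_Mapping.lookup (section_of_polynomial f) 0 = Poly_Mapping.single 0 (Poly_Mapping.lookup f 0)"
proof -
  have "Poly_Mapping.lookup (section_of_polynomial f) 0 =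
      (\<Sum>m\<in>Poly_Mapping.keys f. if m = 0 then Poly_Mapping.single 0 (Poly_Mapping.lookup f 0) else 0)"
    unfolding section_of_polynomial_sum_degrees lookup_sum
    by (intro sum.cong refl) (auto simp: lookup_single when_def monom_degree_eq_0)
  then show ?thesis by (simp add: in_keys_iff)
qed

text \<open>The divisor is built one variable at a time: as long as its degree is below l, the
  cofactor still has a positive exponent.\<close>

lemma exponents_below:
  assumes "0 \<le> k" "k \<le> l" "\<gamma> \<in> exponents n l"
  shows "\<exists>\<beta>. \<beta> \<in> exponents n k \<and> \<gamma> - \<beta> \<in> exponents n (l - k)"
  using assms
proof (induction "nat k" arbitrary: k)
  case 0
  then show ?case by (intro exI [of _ 0]) (simp add: exponents_iff)
next
  case (Suc m)
  then have "m = nat (k - 1)" "0 \<le> k - 1" "k - 1 \<le> l" by auto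
  from Suc.hyps(1) [OF this Suc.prems(3)] obtain \<beta> where
    \<beta>: "\<beta> \<in> exponents n (k - 1)" "\<gamma> - \<beta> \<in> exponents n (l - (k - 1))" by blast
  have "\<exists>j\<le>n. 0 < Poly_Mapping.lookup (\<gamma> - \<beta>) j"
  proof (rule ccontr)
    assume "\<not> ?thesis"
    then have "(\<Sum>j\<le>n. Poly_Mapping.lookup (\<gamma> - \<beta>) j) \<le> 0" by (intro sum_nonpos) force
    then show False using \<beta>(2) Suc.prems(2) by (simp add: exponents_iff)
  qed
  then obtain j where j: "j \<le> n" "0 < Poly_Mapping.lookup (\<gamma> - \<beta>) j" by blast
  have unit: "(\<Sum>i\<le>n. Poly_Mapping.lookup (unit_exponent j) i) = 1"
    using j(1) by (simp add: lookup_single when_def)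
  have "unit_exponent j \<in> exponents n 1"
    using j(1) unit by (auto simp: exponents_iff lookup_single when_def)
  with \<beta>(1) have "\<beta> + unit_exponent j \<in> exponents n (k - 1 + 1)" by (rule exponents_add)
  moreover have "\<gamma> - (\<beta> + unit_exponent j) \<in> exponents n (l - k)"
  proof -
    have eq: "Poly_Mapping.lookup (\<gamma> - (\<beta> + unit_exponent j)) i =
        Poly_Mapping.lookup (\<gamma> - \<beta>) i - Poly_Mapping.lookup (unit_exponent j) i" for i
      by (simp add: lookup_minus lookup_add)
    have "0 \<le> Poly_Mapping.lookup (\<gamma> - \<beta>) i - Poly_Mapping.lookup (unit_exponent j) i" for i
      using exponents_nonneg [OF \<beta>(2), of i] j(2) by (simp add: lookup_single when_def)
    moreover have "(\<Sum>i\<le>n. Poly_Mapping.lookup (\<gamma> - \<beta>) i - Poly_Mapping.lookup (unit_exponent j) i) = l - k"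
      using \<beta>(2) unit by (simp add: sum_subtractf exponents_iff)
    moreover have "Poly_Mapping.lookup (\<gamma> - \<beta>) i - Poly_Mapping.lookup (unit_exponent j) i = 0" if "n < i" for i
      using \<beta>(2) j(1) that by (simp add: exponents_iff lookup_single)
    ultimately show ?thesis unfolding exponents_iff eq by blast
  qed
  ultimately show ?case by (intro exI [of _ "\<beta> + unit_exponent j"]) simp
qed

text \<open>One factor of degree k is split off at a time. For k = d this is projective normality of
  the Veronese embedding, which makes \<open>evaluation\<close> onto and so gives E_0 = S.\<close>

lemma exponents_split:
  "0 \<le> k \<Longrightarrow> \<gamma> \<in> exponents n (int m * k) \<Longrightarrow>
    \<exists>bs. length bs = m \<and> set bs \<subseteq> exponents n k \<and> sum_list bs = \<gamma>"
proof (induction m arbitrary: \<gamma>)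
  case 0
  then have "\<gamma> = 0"
    using exponents_nonneg [OF 0(2)] exponents_le [OF 0(2)] by (intro poly_mapping_eqI) (simp add: order_antisym)
  then show ?case by simp
next
  case (Suc m)
  have "k \<le> int (Suc m) * k" using Suc.prems(1) by (simp add: algebra_simps)
  from exponents_below [OF Suc.prems(1) this Suc.prems(2)] obtain \<beta> where
    \<beta>: "\<beta> \<in> exponents n k" "\<gamma> - \<beta> \<in> exponents n (int (Suc m) * k - k)" by blast
  have "int (Suc m) * k - k = int m * k" by (simp add: algebra_simps)
  with \<beta>(2) Suc.IH [OF Suc.prems(1), of "\<gamma> - \<beta>"] obtain bs where
    "length bs = m" "set bs \<subseteq> exponents n k" "sum_list bs = \<gamma> - \<beta>" by auto
  then show ?case using \<beta>(1) by (intro exI [of _ "\<beta> # bs"]) simp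
qed

context veronese
begin

definition evaluation :: "(nat \<Rightarrow> laurent mpoly) \<Rightarrow> (nat \<Rightarrow>\<^sub>0 laurent)" where
  "evaluation u = section_of_polynomial (u 0)"

lemma G_ops:
  "x \<oplus>\<^bsub>G\<^esub> y = x + y" "\<zero>\<^bsub>G\<^esub> = 0" "f \<odot>\<^bsub>G\<^esub> x = section_of_polynomial f * x"
  by (simp_all add: section_module_def)

lemma carrier_G: "g \<in> carrier G \<longleftrightarrow> (\<forall>m. Poly_Mapping.lookup g m \<in> forms n (int m * int d))"
  by (simp add: section_module_def R)

text \<open>Letting f act on the section 1 reduces this to closure of the section module under its
  scalars.\<close>

lemma section_in_carrier:
  assumes "f \<in> polynomials_in B"
  shows "section_of_polynomial f \<in> carrier G"
proof -
  have "1 \<in> carrier G"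
    unfolding carrier_G
  proof
    fix m
    show "Poly_Mapping.lookup (1 :: nat \<Rightarrow>\<^sub>0 laurent) m \<in> forms n (int m * int d)"
      by (cases "m = 0") (auto simp: lookup_one when_def forms_def exponents_iff)
  qed
  moreover have "f \<in> carrier (polynomial_ring B)" using assms by (simp add: polynomial_ring_def)
  ultimately have "f \<odot>\<^bsub>G\<^esub> 1 \<in> carrier G"
    using module.smult_closed [OF module_section_module] by blast
  then show ?thesis by (simp add: G_ops)
qed

lemma section_in_component:
  assumes "f \<in> homogeneous_polynomials B e"
  shows "section_of_polynomial f \<in> component G e"
proof -
  have "Poly_Mapping.lookup (section_of_polynomial f) m \<in> R m" for m
    using section_in_carrier [OF homogeneous_polynomial [OF assms]] by (simp add: section_module_def)
  moreover have "int k = e" if "k \<in> Poly_Mapping.keys (section_of_polynomial f)" for k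
  proof -
    have "Poly_Mapping.lookup (section_of_polynomial f) k \<noteq> 0" using that by (simp add: in_keys_iff)
    then obtain m where m: "m \<in> Poly_Mapping.keys f" "monom_degree m = k"
      unfolding section_of_polynomial_sum_degrees lookup_sum lookup_single
      by (metis (mono_tags, lifting) sum.not_neutral_contains_not_neutral when_simps(2))
    then show ?thesis using assms unfolding homogeneous_iff by (auto simp: in_keys_iff)
  qed
  ultimately show ?thesis by (simp add: section_module_def)
qed

lemma evaluation_hom: "evaluation \<in> graded_hom (polynomial_ring B) (graded_free_module B [0]) G"
  unfolding graded_hom_def
proof (intro CollectI conjI ballI allI)
  show "evaluation \<in> free_carrier B [0] \<rightarrow> carrier G"
    by (auto simp: evaluation_def free_carrier_iff intro: section_in_carrier)
  show "evaluation u \<in> component G e" if "u \<in> free_component B [0] e" for u e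
    unfolding evaluation_def using that by (intro section_in_component) (simp add: free_component_iff)
qed (simp_all add: free_module_ops G_ops evaluation_def section_of_polynomial_add section_of_polynomial_mult)

lemma evaluation_onto: "evaluation ` free_carrier B [0] = carrier G"
proof
  show "evaluation ` free_carrier B [0] \<subseteq> carrier G"
    by (auto simp: evaluation_def free_carrier_iff intro: section_in_carrier)
  have mono: "\<exists>f\<in>polynomials_in B. section_of_polynomial f = Poly_Mapping.single m (Poly_Mapping.single \<gamma> c)"
    if \<gamma>: "\<gamma> \<in> exponents n (int m * int d)" for m \<gamma> c
  proof -
    obtain bs where bs: "length bs = m" "set bs \<subseteq> E" "sum_list bs = \<gamma>"
      using exponents_split [OF _ \<gamma>] by auto
    \<comment> \<open>The product of the variables named by the list; repeated factors add up in its
      exponent.\<close>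
    define M where "M xs = sum_list (map (\<lambda>\<beta>. Poly_Mapping.single (monomial \<beta>) (1::nat)) xs)" for xs
    have prod: "monomial_product (M xs) = Poly_Mapping.single (length xs) (monomial (sum_list xs))" for xs
    proof (induction xs)
      case Nil
      then show ?case by (simp add: M_def monomial_product_def monomial_def)
    next
      case (Cons \<beta> xs)
      have "monomial_product (M (\<beta> # xs)) = monomial_product (Poly_Mapping.single (monomial \<beta>) 1) * monomial_product (M xs)"
        by (simp only: M_def list.map sum_list.Cons monomial_product_add)
      also have "monomial_product (Poly_Mapping.single (monomial \<beta>) 1) = Poly_Mapping.single 1 (monomial \<beta>)"
        by (simp add: monomial_product_single)
      finally show ?case unfolding Cons by (simp add: mult_single monomial_def)
    qed
    have keys: "Poly_Mapping.keys (M xs) \<subseteq> B" if "set xs \<subseteq> E" for xs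
      using that
    proof (induction xs)
      case (Cons \<beta> xs)
      have "Poly_Mapping.keys (M (\<beta> # xs)) \<subseteq> Poly_Mapping.keys (Poly_Mapping.single (monomial \<beta>) (1::nat)) \<union> Poly_Mapping.keys (M xs)"
        unfolding M_def list.map sum_list.Cons by (rule keys_add)
      then show ?case using Cons exponent_of(3) [of \<beta>] by auto
    qed (simp add: M_def)
    have "section_of_polynomial (Poly_Mapping.single (M bs) c) = Poly_Mapping.single m (Poly_Mapping.single \<gamma> c)"
      by (simp add: section_of_polynomial_single prod bs mult_single monomial_def)
    moreover have "Poly_Mapping.single (M bs) c \<in> polynomials_in B"
      using keys [OF bs(2)] by (auto simp: polynomials_in_def)
    ultimately show ?thesis by blast
  qed
  have sums: "\<exists>f\<in>polynomials_in B. section_of_polynomial f = sum g A"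
    if "\<And>a. a \<in> A \<Longrightarrow> \<exists>f\<in>polynomials_in B. section_of_polynomial f = g a"
    for A :: "'z set" and g
    using that
  proof (induction A rule: infinite_finite_induct)
    case (insert a A)
    then obtain f f' where "f \<in> polynomials_in B" "section_of_polynomial f = g a"
      "f' \<in> polynomials_in B" "section_of_polynomial f' = sum g A" by blast
    then show ?case using insert.hyps
      by (intro bexI [of _ "f + f'"]) (simp_all add: section_of_polynomial_add polynomials_in_closed)
  qed (auto intro!: bexI [of _ 0] simp: section_of_polynomial_def polynomials_in_closed)
  show "carrier G \<subseteq> evaluation ` free_carrier B [0]"
  proof
    fix g assume g: "g \<in> carrier G"
    have "\<exists>f\<in>polynomials_in B. section_of_polynomial f = Poly_Mapping.single m (Poly_Mapping.lookup g m)" for m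
    proof -
      let ?h = "Poly_Mapping.lookup g m"
      have "Poly_Mapping.keys ?h \<subseteq> exponents n (int m * int d)" using g by (auto simp: carrier_G forms_def)
      then have "\<exists>f\<in>polynomials_in B. section_of_polynomial f =
          (\<Sum>\<gamma>\<in>Poly_Mapping.keys ?h. Poly_Mapping.single m (Poly_Mapping.single \<gamma> (Poly_Mapping.lookup ?h \<gamma>)))"
        by (intro sums mono) blast
      then show ?thesis by (simp add: single_sum [symmetric] poly_mapping_expansion [symmetric])
    qed
    then have "\<exists>f\<in>polynomials_in B. section_of_polynomial f =
        (\<Sum>m\<in>Poly_Mapping.keys g. Poly_Mapping.single m (Poly_Mapping.lookup g m))"
      by (intro sums)
    then obtain f where f: "f \<in> polynomials_in B" "section_of_polynomial f = g"
      by (auto simp: poly_mapping_expansion [symmetric])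
    then have "(\<lambda>j. if j = 0 then f else 0) \<in> free_carrier B [0]" "evaluation (\<lambda>j. if j = 0 then f else 0) = g"
      by (auto simp: free_carrier_iff evaluation_def)
    then show "g \<in> evaluation ` free_carrier B [0]" by blast
  qed
qed

text \<open>The guard prevents \<open>nat\<close> from identifying negative degrees with degree
  0.\<close>

definition section_part :: "int \<Rightarrow> (nat \<Rightarrow>\<^sub>0 laurent) \<Rightarrow> (nat \<Rightarrow>\<^sub>0 laurent)" where
  "section_part e g = (if 0 \<le> e then Poly_Mapping.single (nat e) (Poly_Mapping.lookup g (nat e)) else 0)"

lemma section_part_of_component:
  assumes "g \<in> component G e"
  shows "section_part e' g = (if e' = e then g else 0)"
proof -
  obtain f where "g = Poly_Mapping.single (nat e) f" "e < 0 \<Longrightarrow> f = 0"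
    using assms by (rule component_cases) blast
  then show ?thesis by (cases "0 \<le> e"; cases "0 \<le> e'") (auto simp: section_part_def lookup_single when_def)
qed

lemma section_part_add: "section_part e (x + y) = section_part e x + section_part e y"
  by (simp add: section_part_def lookup_add single_add)

lemma graded_hom_section_part:
  assumes h: "h \<in> graded_hom (polynomial_ring B) (graded_free_module B as) G" and u: "u \<in> free_carrier B as"
  shows "h (free_part as e u) = section_part e (h u)"
proof (rule graded_map_part [where \<pi> = section_part, OF u])
  note H = graded_homD [OF h]
  show "h (u + v) = h u + h v" if "u \<in> free_carrier B as" "v \<in> free_carrier B as" for u v
    using H(2) [OF that] unfolding G_ops .
  show "section_part e' (h u) = (if e' = e then h u else 0)" if "u \<in> free_component B as e" for e u e'
    by (rule section_part_of_component [OF H(4) [OF that]])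
qed (rule section_part_add)

lemma section_hom_kernel:
  assumes h: "h \<in> graded_hom (polynomial_ring B) (graded_free_module B as) G"
  shows "graded_submodule B as (free_kernel B as h)"
  unfolding free_kernel_def
proof (rule graded_submodule_kernel)
  note H = graded_homD [OF h, unfolded G_ops]
  show "h (u + v) = h u + h v" if "u \<in> free_carrier B as" "v \<in> free_carrier B as" for u v
    by (rule H(2) [OF that])
  show "h (\<lambda>j. f * u j) = 0" if "f \<in> polynomials_in B" "u \<in> free_carrier B as" "h u = 0" for f u
    using H(3) [OF that(1,2)] that(3) by simp
  show "h (free_part as e u) = 0" if "u \<in> free_carrier B as" "h u = 0" for u e
    using graded_hom_section_part [OF h that(1), of e] that(2) by (simp add: section_part_def)
qed

lemma section_hom_surjection:
  assumes h: "h \<in> graded_hom (polynomial_ring B) (graded_free_module B as) G"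
    and image: "h ` free_carrier B as = carrier G"
  shows "graded_surjection free_action section_action B (free_component B as) (component G) h"
  unfolding graded_surjection_def
proof (intro conjI allI ballI)
  note H = graded_homD [OF h, unfolded G_ops]
  show "graded_action free_action B (free_component B as)" by (rule graded_action_free [OF finite_B])
  show "graded_action section_action B (component G)" by (rule action_G)
  fix e x assume x: "x \<in> free_component B as e"
  show "\<exists>y\<in>free_component B as e. y + y = x" by (rule free_component_half [OF x])
  show "h (x + y) = h x + h y" if "y \<in> free_component B as e" for y
    by (intro H(2) free_component_subset [OF x] free_component_subset [OF that])
  show "h (free_action v x) = section_action v (h x)" if "v \<in> B" for v
    using H(3) [OF var_polynomial [OF that] free_component_subset [OF x]]
    by (simp only: free_action_def section_action_def section_of_var)
next
  fix e
  note H = graded_homD [OF h]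
  show "h ` free_component B as e = component G e"
  proof
    show "h ` free_component B as e \<subseteq> component G e" using H(4) by blast
    show "component G e \<subseteq> h ` free_component B as e"
    proof
      fix x assume x: "x \<in> component G e"
      then have "x \<in> carrier G" by (simp add: section_module_def)
      then obtain u where u: "u \<in> free_carrier B as" "x = h u" using image by blast
      have "h (free_part as e u) = x"
        using graded_hom_section_part [OF h u(1), of e] section_part_of_component [OF x, of e] u(2) by simp
      then show "x \<in> h ` free_component B as e" using free_part_component [OF u(1), of e] by blast
    qed
  qed
qed

end

section \<open>Minimal resolutions\<close>

context veronese
begin

text \<open>Free modules have no positive Koszul homology, so passing from G to successive syzygies
  embeds K_(i+1) of G into K_0 of the i-th syzygy. This syzygy is a quotient of E_(i+1), which has
  no generator in degree e.\<close>

lemma resolution_koszul_vanishes: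
  assumes res: "minimal_graded_free_resolution B G l shifts \<delta> \<epsilon>" and e: "e \<notin> set (shifts (Suc i))"
  shows "koszul_vanishes section_action B (component G) (Suc i) e"
proof -
  note res' = res [unfolded minimal_graded_free_resolution_def Let_def]
  have \<epsilon>: "\<epsilon> \<in> graded_hom (polynomial_ring B) (graded_free_module B (shifts 0)) G"
    and \<delta>: "\<And>i. \<delta> i \<in> graded_hom (polynomial_ring B) (graded_free_module B (shifts (Suc i))) (graded_free_module B (shifts i))"
    and onto: "\<epsilon> ` free_carrier B (shifts 0) = carrier G"
    and exact0: "\<delta> 0 ` free_carrier B (shifts 1) = a_kernel (graded_free_module B (shifts 0)) G \<epsilon>"
    and exact: "\<And>i. \<delta> (Suc i) ` free_carrier B (shifts (Suc (Suc i))) =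
      a_kernel (graded_free_module B (shifts (Suc i))) (graded_free_module B (shifts i)) (\<delta> i)"
    using res' by simp_all
  \<comment> \<open>\<open>K i\<close> is the syzygy inside E_i and thus the image of E_(i+1): the
    kernel of \<epsilon> for i = 0, the kernel of the map out of E_i afterwards.\<close>
  define K where "K = rec_nat (free_kernel B (shifts 0) \<epsilon>) (\<lambda>i _. free_kernel B (shifts (Suc i)) (\<delta> i))"
  have K0: "K 0 = free_kernel B (shifts 0) \<epsilon>" and KSuc: "\<And>i. K (Suc i) = free_kernel B (shifts (Suc i)) (\<delta> i)"
    by (simp_all add: K_def)
  have image: "\<delta> i ` free_carrier B (shifts (Suc i)) = K i" for i
    using exact0 exact by (cases i) (simp_all add: K0 KSuc free_kernel_def a_kernel_def' G_ops free_module_ops)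
  have sub: "graded_submodule B (shifts i) (K i)" for i
    using section_hom_kernel [OF \<epsilon>] free_hom_kernel [OF \<delta>] by (cases i) (simp_all add: K0 KSuc)
  have surj: "graded_surjection free_action free_action B (free_component B (shifts (Suc i)))
      (\<lambda>e. K i \<inter> free_component B (shifts i) e) (\<delta> i)" for i
    by (rule free_hom_surjection [OF finite_B \<delta> sub image])
  have surj0: "graded_surjection free_action section_action B (free_component B (shifts 0)) (component G) \<epsilon>"
    by (rule section_hom_surjection [OF \<epsilon> onto])
  \<comment> \<open>Each step from a syzygy back to the module it resolves raises the homological
    degree by one; i + 1 such steps lead from \<open>K i\<close> to G.\<close>
  have climb: "koszul_vanishes section_action B (component G) (Suc (i + j)) e"
    if "koszul_vanishes free_action B (\<lambda>e. K i \<inter> free_component B (shifts i) e) j e" for i j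
    using that
  proof (induction i arbitrary: j)
    case 0
    then have "koszul_vanishes free_action B (kernel_components (free_component B (shifts 0)) \<epsilon>) j e"
      by (simp add: kernel_components_free K0)
    from koszul_vanishes_from_kernel [OF surj0 koszul_vanishes_free [OF finite_B] this]
    show ?case by simp
  next
    case (Suc i)
    then have "koszul_vanishes free_action B (kernel_components (free_component B (shifts (Suc i))) (\<delta> i)) j e"
      by (simp add: kernel_components_free KSuc)
    from Suc.IH [OF koszul_vanishes_from_kernel [OF surj koszul_vanishes_free [OF finite_B] this]]
    show ?case by simp
  qed
  have "koszul_vanishes free_action B (\<lambda>e. K i \<inter> free_component B (shifts i) e) 0 e"
    by (rule koszul_vanishes_0_image [OF surj koszul_vanishes_0_free [OF finite_B e]])
  from climb [OF this] show ?thesis by simp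
qed

text \<open>Only the constant monomial contributes to degree 0 of the evaluated polynomial, so
  relations among sections lie in the irrelevant ideal. This is minimality at E_0.\<close>

lemma evaluation_kernel_constant:
  assumes "u \<in> free_kernel B [0] evaluation"
  shows "Poly_Mapping.lookup (u j) 0 = 0"
proof (cases "j = 0")
  case True
  have "Poly_Mapping.lookup (section_of_polynomial (u 0)) 0 = 0"
    using assms by (simp add: free_kernel_def evaluation_def)
  then have "Poly_Mapping.single 0 (Poly_Mapping.lookup (u 0) 0) = (0 :: laurent)"
    by (simp only: section_constant_term)
  then show ?thesis using True by (metis lookup_single_eq lookup_zero)
next
  case False
  then show ?thesis using assms by (simp add: free_kernel_def free_carrier_iff)
qed

text \<open>For i > 0 the free module has no homology. For i = 0, \<open>const\<close> places the
  kernel in the irrelevant ideal times the free module, so its K_0 maps to zero there. In both cases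
  the homology of M shifts down by one.\<close>

lemma koszul_vanishes_kernel_free:
  assumes surj: "graded_surjection free_action Y B (free_component B as) M h"
    and const: "\<forall>u\<in>free_kernel B as h. \<forall>j. Poly_Mapping.lookup (u j) 0 = 0"
    and van: "koszul_vanishes Y B M (Suc i) e"
  shows "koszul_vanishes free_action B (\<lambda>e. free_kernel B as h \<inter> free_component B as e) i e"
  unfolding kernel_components_free [symmetric]
proof (rule koszul_vanishes_kernel [OF surj van])
  fix c assume c: "koszul_chain B (kernel_components (free_component B as) h) i e c"
    and cyc: "\<And>L. koszul_d free_action B c L = 0"
  have "koszul_chain B (free_component B as) i e c"
    using c kernel_chain_iff [OF surj] by blast
  moreover have "Poly_Mapping.lookup (c xs j) 0 = 0" for xs j
  proof -
    have "c xs \<in> free_kernel B as h"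
      using c unfolding koszul_chain_def kernel_components_free by blast
    then show ?thesis using const by blast
  qed
  ultimately show "\<exists>c'. koszul_chain B (free_component B as) (Suc i) e c' \<and> koszul_d free_action B c' = c"
    using free_koszul_exact [OF finite_B _ cyc] by blast
qed

text \<open>
  The syzygies are constructed one at a time; the invariant identifies their Koszul homology with
  that of \<open>G\<close>, which bounds the degrees of the next generators and the length of the resolution.
\<close>

lemma minimal_resolution_exists:
  "\<exists>l shifts \<delta> \<epsilon>. minimal_graded_free_resolution B G l shifts \<delta> \<epsilon> \<and> shifts 0 = [0] \<and>
     (\<forall>i. \<forall>a\<in>set (shifts (Suc i)). \<not> koszul_vanishes section_action B (component G) (Suc i) a)"
proof -
  let ?kv = "koszul_vanishes section_action B (component G)"
  let ?S = "polynomial_ring B"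
  \<comment> \<open>State k holds the shifts of E_k, the syzygy inside E_k, and the map by which E_k
    was attached. The last clause shifts homological degree by k + 1: one for the kernel of
    \<open>evaluation\<close> and one for each later syzygy.\<close>
  define ok where "ok k s = (case s of (as, K, h) \<Rightarrow> graded_submodule B as K \<and>
      (\<forall>u\<in>K. \<forall>j. Poly_Mapping.lookup (u j) 0 = 0) \<and>
      (\<forall>i e. ?kv (Suc (i + k)) e \<longrightarrow> koszul_vanishes free_action B (\<lambda>e. K \<inter> free_component B as e) i e))"
    for k :: nat and s :: "int list \<times> (nat \<Rightarrow> laurent mpoly) set \<times> ((nat \<Rightarrow> laurent mpoly) \<Rightarrow> nat \<Rightarrow> laurent mpoly)"
  define step where "step k s s' = (case s of (as, K, _) \<Rightarrow> case s' of (bs, K', h) \<Rightarrow>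
      h \<in> graded_hom ?S (graded_free_module B bs) (graded_free_module B as) \<and>
      h ` free_carrier B bs = K \<and> K' = free_kernel B bs h \<and> (\<forall>a\<in>set bs. \<not> ?kv (Suc k) a))"
    for k :: nat and s s' :: "int list \<times> (nat \<Rightarrow> laurent mpoly) set \<times> ((nat \<Rightarrow> laurent mpoly) \<Rightarrow> nat \<Rightarrow> laurent mpoly)"
  have "\<exists>f. \<forall>k. ok k (f k) \<and> (k = 0 \<longrightarrow> fst (f k) = [0] \<and> fst (snd (f k)) = free_kernel B [0] evaluation) \<and>
      step k (f k) (f (Suc k))"
  proof -
    define ok' where "ok' k s \<longleftrightarrow> ok k s \<and> (k = 0 \<longrightarrow> fst s = [0] \<and> fst (snd s) = free_kernel B [0] evaluation)" for k s
    have "\<exists>f. \<forall>k. ok' k (f k) \<and> step k (f k) (f (Suc k))"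
    proof (rule dependent_nat_choice)
      have surj: "graded_surjection free_action section_action B (free_component B [0]) (component G) evaluation"
        by (rule section_hom_surjection [OF evaluation_hom evaluation_onto])
      have const: "\<forall>u\<in>free_kernel B [0] evaluation. \<forall>j. Poly_Mapping.lookup (u j) 0 = 0"
        using evaluation_kernel_constant by blast
      \<comment> \<open>The zero map is a placeholder; the maps of the resolution are those stored
        from state 1 on.\<close>
      have "ok 0 ([0], free_kernel B [0] evaluation, \<lambda>_ _. 0)"
        unfolding ok_def
        using section_hom_kernel [OF evaluation_hom] const koszul_vanishes_kernel_free [OF surj const] by simp
      then show "\<exists>s. ok' 0 s" unfolding ok'_def by (intro exI [of _ "([0], free_kernel B [0] evaluation, \<lambda>_ _. 0)"]) simp
    next
      fix s k assume "ok' k s"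
      obtain as K h0 where s: "s = (as, K, h0)" by (cases s)
      have ok: "ok k s" using \<open>ok' k s\<close> by (simp add: ok'_def)
      have K: "graded_submodule B as K"
        and inv: "\<And>i e. ?kv (Suc (i + k)) e \<Longrightarrow> koszul_vanishes free_action B (\<lambda>e. K \<inter> free_component B as e) i e"
        using ok by (simp_all add: ok_def s)
      \<comment> \<open>With i = 0 the invariant ties the next generators to K_(k+1) of G, whose
        degrees are bounded.\<close>
      have bound: "koszul_vanishes free_action B (\<lambda>e. K \<inter> free_component B as e) 0 e"
        if "e > (int n + 1) * (int (Suc k) + 1)" for e
        using inv [of 0 e] koszul_vanishes_bounded [of "Suc k" e] that by simp
      obtain bs h where h: "h \<in> graded_hom ?S (graded_free_module B bs) (graded_free_module B as)"
        and image: "h ` free_carrier B bs = K"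
        and const: "\<And>u j. u \<in> free_carrier B bs \<Longrightarrow> h u = 0 \<Longrightarrow> Poly_Mapping.lookup (u j) 0 = 0"
        and degrees: "\<And>a. a \<in> set bs \<Longrightarrow> \<not> koszul_vanishes free_action B (\<lambda>e. K \<inter> free_component B as e) 0 a"
        by (rule minimal_cover [OF finite_B K bound]) blast+
      have const': "\<forall>u\<in>free_kernel B bs h. \<forall>j. Poly_Mapping.lookup (u j) 0 = 0"
        using const by (simp add: free_kernel_def)
      have "ok (Suc k) (bs, free_kernel B bs h, h)"
        unfolding ok_def prod.case
      proof (intro conjI allI ballI impI)
        show "graded_submodule B bs (free_kernel B bs h)" by (rule free_hom_kernel [OF h])
        show "Poly_Mapping.lookup (u j) 0 = 0" if "u \<in> free_kernel B bs h" for u j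
          using const' that by blast
        fix i e assume "?kv (Suc (i + Suc k)) e"
        then have "koszul_vanishes free_action B (\<lambda>e. K \<inter> free_component B as e) (Suc i) e"
          using inv [of "Suc i" e] by simp
        from koszul_vanishes_kernel_free [OF free_hom_surjection [OF finite_B h K image] const' this]
        show "koszul_vanishes free_action B (\<lambda>e. free_kernel B bs h \<inter> free_component B bs e) i e" .
      qed
      moreover have "step k s (bs, free_kernel B bs h, h)"
        unfolding step_def s prod.case using h image degrees inv [of 0] by auto
      ultimately show "\<exists>s'. ok' (Suc k) s' \<and> step k s s'" unfolding ok'_def by blast
    qed
    then show ?thesis unfolding ok'_def by blast
  qed
  then obtain f where f: "\<And>k. ok k (f k)" "\<And>k. step k (f k) (f (Suc k))"
    "fst (f 0) = [0]" "fst (snd (f 0)) = free_kernel B [0] evaluation" by blast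
  define shifts where "shifts k = fst (f k)" for k
  define K where "K k = fst (snd (f k))" for k
  define \<delta> where "\<delta> k = snd (snd (f (Suc k)))" for k
  have const: "Poly_Mapping.lookup (u j) 0 = 0" if "u \<in> K k" for u j k
    using f(1) [of k] that by (auto simp: ok_def K_def split: prod.splits)
  have \<delta>: "\<delta> k \<in> graded_hom ?S (graded_free_module B (shifts (Suc k))) (graded_free_module B (shifts k))"
    and image: "\<delta> k ` free_carrier B (shifts (Suc k)) = K k"
    and kernel: "K (Suc k) = free_kernel B (shifts (Suc k)) (\<delta> k)"
    and degrees: "\<And>a. a \<in> set (shifts (Suc k)) \<Longrightarrow> \<not> ?kv (Suc k) a" for k
    using f(2) [of k] by (auto simp: step_def shifts_def K_def \<delta>_def split: prod.splits)
  have "minimal_graded_free_resolution B G (card E) shifts \<delta> evaluation"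
    unfolding minimal_graded_free_resolution_def Let_def
  proof (intro conjI allI impI ballI)
    \<comment> \<open>A shift in E_i witnesses that K_i of G is nonzero, which is impossible once i
      exceeds the number of variables.\<close>
    show "shifts i = []" if i: "card E < i" for i
    proof (rule ccontr)
      assume "shifts i \<noteq> []"
      moreover obtain k where k: "i = Suc k" using i by (cases i) auto
      ultimately obtain a where "a \<in> set (shifts (Suc k))" by (cases "shifts i") auto
      then show False using degrees koszul_vanishes_high [of "Suc k" a] i k by blast
    qed
    show "evaluation \<in> graded_hom ?S (graded_free_module B (shifts 0)) G"
      using evaluation_hom f(3) by (simp add: shifts_def)
    show "evaluation ` free_carrier B (shifts 0) = carrier G"
      using evaluation_onto f(3) by (simp add: shifts_def)
    show "\<delta> i \<in> graded_hom ?S (graded_free_module B (shifts (Suc i))) (graded_free_module B (shifts i))" for i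
      by (rule \<delta>)
    show "\<delta> 0 ` free_carrier B (shifts 1) = a_kernel (graded_free_module B (shifts 0)) G evaluation"
      using image [of 0] f(3,4) by (simp add: shifts_def K_def free_kernel_def a_kernel_def' G_ops)
    show "\<delta> (Suc i) ` free_carrier B (shifts (Suc (Suc i))) =
        a_kernel (graded_free_module B (shifts (Suc i))) (graded_free_module B (shifts i)) (\<delta> i)" for i
      using image [of "Suc i"] by (simp add: kernel free_kernel_def a_kernel_def' free_module_ops)
    show "Poly_Mapping.lookup (\<delta> i u j) 0 = 0" if "u \<in> free_carrier B (shifts (Suc i))" for i u j
      using const [of "\<delta> i u" i j] image [of i] that by blast
  qed
  moreover have "shifts 0 = [0]" using f(3) by (simp add: shifts_def)
  ultimately show ?thesis using degrees by blast
qed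

end

theorem proposition10:
  fixes d p :: nat
  assumes "d \<ge> 1"
  shows "(\<forall>n\<ge>p. O_satisfies_N n d p) \<longleftrightarrow> O_satisfies_N p d p"
proof
  assume "\<forall>n\<ge>p. O_satisfies_N n d p"
  then show "O_satisfies_N p d p" by blast
next
  assume N: "O_satisfies_N p d p"
  interpret p: veronese p d by unfold_locales (rule assms)
  obtain l shifts \<delta> \<epsilon> where res: "minimal_graded_free_resolution p.B p.G l shifts \<delta> \<epsilon>"
    and linear: "\<And>i. 1 \<le> i \<Longrightarrow> i \<le> p \<Longrightarrow> \<forall>a\<in>set (shifts i). a = int i + 1"
    using N unfolding O_satisfies_N_def property_N_def by blast
  \<comment> \<open>Every shift of the given resolution in step i + 1 <= p equals i + 2, so homology
    on p-space can live in no other degree.\<close>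
  have van: "koszul_vanishes section_action p.B (component p.G) (Suc i) e"
    if "Suc i \<le> p" "e \<noteq> int (Suc i) + 1" for i e
    using p.resolution_koszul_vanishes [OF res, of e i] linear [of "Suc i"] that by auto
  show "\<forall>n\<ge>p. O_satisfies_N n d p"
  proof (intro allI impI)
    fix n assume n: "p \<le> n"
    interpret n: veronese n d by unfold_locales (rule assms)
    obtain l shifts \<delta> \<epsilon> where res: "minimal_graded_free_resolution n.B n.G l shifts \<delta> \<epsilon>" "shifts 0 = [0]"
      and degrees: "\<And>i a. a \<in> set (shifts (Suc i)) \<Longrightarrow> \<not> koszul_vanishes section_action n.B (component n.G) (Suc i) a"
      using n.minimal_resolution_exists by blast
    \<comment> \<open>A shift of the constructed resolution witnesses nonvanishing homology on
      n-space. As i <= p, this homology is already nonzero on p-space, where its degree is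
      forced.\<close>
    have "a = int i + 1" if i: "1 \<le> i" "i \<le> p" and a: "a \<in> set (shifts i)" for i a
    proof (rule ccontr)
      assume ne: "a \<noteq> int i + 1"
      obtain k where k: "i = Suc k" using i(1) by (cases i) auto
      have "koszul_vanishes section_action n.B (component n.G) (Suc k) a"
        using koszul_vanishes_extend [OF assms _ n van, of k a] i(2) ne k by simp
      then show False using degrees a k by blast
    qed
    then show "O_satisfies_N n d p"
      unfolding O_satisfies_N_def property_N_def using res by blast
  qed
qed

end
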